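(* Let $\Omega\subset\mathbb{R}^3$ be an open bounded domain with polytopal boundary, and let $(\mathcal{T}_n)_{n\in\mathbb{N}}$ be a sequence of conforming tetrahedral triangulations of $\overline\Omega$ such that, with $V_n$ the number of vertices and $V_{b,n}$ the number of boundary vertices of $\mathcal{T}_n$, one has $V_n\to\infty$ and $V_{b,n}/V_n\to 0$ as $n\to\infty$. Let $\overline{e}_n$ be the average number of edges emanating from a vertex of $\mathcal{T}_n$, and let $\mathcal{T}_{W,n}$ be a Worsey--Farin split of $\mathcal{T}_n$. If there is a constant $c>4.4$ with $\overline{e}_n\geq c$ for all $n$, then for all sufficiently large $n$ the space $\mathbf{Z}_2(\mathcal{T}_{W,n})$ is strictly larger than $\operatorname{curl}\mathbf{S}_3(\mathcal{T}_{W,n})$, i.e. $$\operatorname{curl}\mathbf{S}_3(\mathcal{T}_{W,n})\subsetneq\mathbf{Z}_2(\mathcal{T}_{W,n}).$$ In particular, this strict inclusion holds for the Worsey--Farin split of (a) Freudenthal triangulations of a rectangular domain consisting of $n\cdot m\cdot\ell$ Kuhn cubes, for $n,m,\ell$ sufficiently large; and (b) meshes $\mathcal{T}_n$ arising from a conforming tetrahedral triangulation $\mathcal{T}_0$ of $\overline\Omega$ by sufficiently many uniform refinements $\mathcal{T}_n=\mathcal{R}(\mathcal{T}_{n-1})$, where $\mathcal{R}$ is a uniform refinement scheme, mapping each conforming tetrahedral mesh $\mathcal{T}$ to a conforming tetrahedral refinement $\mathcal{T}'=\mathcal{R}(\mathcal{T})$, such that each tetrahedron of $\mathcal{T}$ is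 split into $8$ tetrahedra, each face into $4$ faces, each edge into $2$ edges, and the vertices of $\mathcal{T}'$ are exactly the vertices of $\mathcal{T}$ and the midpoints of edges of $\mathcal{T}$.
   Context: A conforming tetrahedral triangulation of $\overline\Omega$ is a finite set of closed non-degenerate tetrahedra whose union is $\overline\Omega$ and such that any two distinct tetrahedra intersect in the empty set, a common vertex, a common edge or a common (triangular) face. Standing conventions on meshes: every face contained in $\partial\Omega$ belongs to exactly one tetrahedron, every other face to exactly two, and every edge contained in $\partial\Omega$ belongs to exactly two boundary faces. For a mesh with $V$ vertices and $E$ edges, $\overline{e}=2E/V$ is the average over all vertices of the number of edges ending at the vertex. Worsey--Farin split $\mathcal{T}_W$ of $\mathcal{T}$: choose an interior point in each tetrahedron of $\mathcal{T}$; on each interior face choose as face point the point where the segment connecting the interior points of the two tetrahedra sharing the face meets that face (interior points being chosen so that this lies in the relative interior of the face), and on each boundary face choose a point in its relative interior. Each face is subdivided into $3$ triangles by connecting its face point to its three vertices, and each tetrahedron is subdivided into $12$ subtetrahedra by connecting its interior point to its $4$ vertices and $4$ face points (the subtetrahedra are the convex hulls of the interior point with each of the $12$ subtriangles of the faces). For a mesh $\widetilde{\mathcal{T}}$ and $k\ge1$, $\mathbf{V}_k(\widetilde{\mathcal{T}})$ is the space of continuous functions $\overline\Omega\to\mathbb{R}^3$ each of whose components is, on each tetrahedron of $\widetilde{\mathcal{T}}$, a polynomial of degree at most $k$ (no boundary conditions imposed). Further, $$\mathbf{Z}_k(\widetilde{\mathcal{T}})=\{\mathbf{v}\in\mathbf{V}_k(\widetilde{\mathcal{T}}):\nabla\cdot\mathbf{v}=0\},\qquad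 \mathbf{S}_r(\widetilde{\mathcal{T}})=\mathbf{V}_r(\widetilde{\mathcal{T}})\cap C^1(\overline\Omega),$$ where $C^1$ is understood for vector-valued functions; one has $\operatorname{curl}\mathbf{S}_3(\mathcal{T}_W)\subset\mathbf{Z}_2(\mathcal{T}_W)$. Kuhn triangulation of the unit cube $[0,1]^3$: the $6$ tetrahedra $\{x\in[0,1]^3: x_{\pi(1)}\geq x_{\pi(2)}\geq x_{\pi(3)}\}$, $\pi$ a permutation of $\{1,2,3\}$. A Freudenthal triangulation of a rectangular domain is obtained by dividing it into an $n\times m\times\ell$ array of translated (and scaled) copies of this triangulated cube (Kuhn cubes). *)

theory Defs
  imports "HOL-Analysis.Analysis"
begin

section \<open>Tetrahedral meshes\<close>

definition polytopal_domain :: "(real^3) set \<Rightarrow> bool" where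
  "polytopal_domain \<Omega> \<longleftrightarrow>
     open \<Omega> \<and> connected \<Omega> \<and> \<Omega> \<noteq> {} \<and> bounded \<Omega> \<and>
     (\<exists>\<P>. finite \<P> \<and> (\<forall>P\<in>\<P>. polytope P) \<and> frontier \<Omega> = \<Union>\<P>)"

text \<open>A mesh is the set of its tetrahedra, each a closed subset of space. For a 3-simplex, the
  library's extreme points, edges and facets are its vertices, edges and triangular faces.\<close>

definition mesh_vertices :: "(real^3) set set \<Rightarrow> (real^3) set" where
  "mesh_vertices M = {v. \<exists>T\<in>M. v extreme_point_of T}"

definition mesh_edges :: "(real^3) set set \<Rightarrow> (real^3) set set" where
  "mesh_edges M = {e. \<exists>T\<in>M. e edge_of T}"

definition mesh_faces :: "(real^3) set set \<Rightarrow> (real^3) set set" where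
  "mesh_faces M = {F. \<exists>T\<in>M. F facet_of T}"

definition conforming_mesh :: "(real^3) set \<Rightarrow> (real^3) set set \<Rightarrow> bool" where
  "conforming_mesh \<Omega> M \<longleftrightarrow>
     finite M \<and> (\<forall>T\<in>M. 3 simplex T) \<and> \<Union>M = closure \<Omega> \<and>
     (\<forall>T\<in>M. \<forall>T'\<in>M. T \<noteq> T' \<longrightarrow>
        T \<inter> T' = {} \<or>
        (\<exists>v. T \<inter> T' = {v} \<and> v extreme_point_of T \<and> v extreme_point_of T') \<or>
        (T \<inter> T') edge_of T \<and> (T \<inter> T') edge_of T' \<or>
        (T \<inter> T') facet_of T \<and> (T \<inter> T') facet_of T') \<and>
     (\<forall>F\<in>mesh_faces M. card {T\<in>M. F facet_of T} = (if F \<subseteq> frontier \<Omega> then 1 else 2)) \<and>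
     (\<forall>e\<in>mesh_edges M. e \<subseteq> frontier \<Omega> \<longrightarrow>
        card {F\<in>mesh_faces M. F \<subseteq> frontier \<Omega> \<and> e edge_of F} = 2)"

definition boundary_vertices :: "(real^3) set \<Rightarrow> (real^3) set set \<Rightarrow> (real^3) set" where
  "boundary_vertices \<Omega> M = mesh_vertices M \<inter> frontier \<Omega>"

definition average_edges :: "(real^3) set set \<Rightarrow> real" where
  "average_edges M = 2 * real (card (mesh_edges M)) / real (card (mesh_vertices M))"


section \<open>Worsey--Farin splits\<close>

text \<open>Here \<open>z T\<close> is the interior point of the tetrahedron \<open>T\<close> and \<open>y F\<close> the face point of the face
  \<open>F\<close>. The subtetrahedra of \<open>T\<close> are indexed by the pairs of a face of \<open>T\<close> and an edge of that face;
  a face shared by no two tetrahedra carries an arbitrary relative interior point.\<close>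

definition Worsey_Farin_split :: "(real^3) set set \<Rightarrow> (real^3) set set \<Rightarrow> bool" where
  "Worsey_Farin_split M W \<longleftrightarrow>
     (\<exists>z y. (\<forall>T\<in>M. z T \<in> interior T) \<and>
            (\<forall>F\<in>mesh_faces M. y F \<in> rel_interior F) \<and>
            (\<forall>T\<in>M. \<forall>T'\<in>M. \<forall>F. T \<noteq> T' \<and> F facet_of T \<and> F facet_of T' \<longrightarrow>
               closed_segment (z T) (z T') \<inter> F = {y F}) \<and>
            W = {convex hull (insert (z T) (insert (y F) e)) | T F e.
                   T \<in> M \<and> F facet_of T \<and> e edge_of F})"


section \<open>Finite element spaces\<close>

definition polynomial_of_degree_le :: "nat \<Rightarrow> (real^3 \<Rightarrow> real) \<Rightarrow> bool" where
  "polynomial_of_degree_le k p \<longleftrightarrow>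
     (\<exists>c :: nat \<Rightarrow> nat \<Rightarrow> nat \<Rightarrow> real. \<forall>x.
        p x = (\<Sum>i\<le>k. \<Sum>j\<le>k - i. \<Sum>l\<le>k - i - j. c i j l * x$1 ^ i * x$2 ^ j * x$3 ^ l))"

text \<open>A function on \<open>closure \<Omega>\<close> is represented by its extension by zero, so that equality of
  functions on \<open>closure \<Omega>\<close> is equality in HOL.\<close>

definition V_space :: "(real^3) set \<Rightarrow> nat \<Rightarrow> (real^3) set set \<Rightarrow> (real^3 \<Rightarrow> real^3) set" where
  "V_space \<Omega> k M =
     {v. (\<forall>x. x \<notin> closure \<Omega> \<longrightarrow> v x = 0) \<and>
         continuous_on (closure \<Omega>) v \<and>
         (\<forall>T\<in>M. \<forall>i. \<exists>p. polynomial_of_degree_le k p \<and> (\<forall>x\<in>T. v x $ i = p x))}"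

definition divergence :: "(real^3 \<Rightarrow> real^3) \<Rightarrow> real^3 \<Rightarrow> real" where
  "divergence v x = (\<Sum>i\<in>UNIV. frechet_derivative v (at x) (axis i 1) $ i)"

text \<open>The divergence of a continuous piecewise polynomial is defined off the mesh faces, where it
  coincides with the weak divergence; it vanishes if it does so inside every tetrahedron.\<close>

definition Z_space :: "(real^3) set \<Rightarrow> nat \<Rightarrow> (real^3) set set \<Rightarrow> (real^3 \<Rightarrow> real^3) set" where
  "Z_space \<Omega> k M = {v \<in> V_space \<Omega> k M. \<forall>T\<in>M. \<forall>x\<in>interior T. divergence v x = 0}"

text \<open>\<open>s\<close> is in \<open>C\<^sup>1\<close> of \<open>closure \<Omega>\<close> iff it is continuous there and differentiable in \<open>\<Omega>\<close> with a
  derivative that extends continuously to \<open>closure \<Omega>\<close>. The matrix \<open>J x\<close> is the (extended)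
  Jacobian, with the \<open>j\<close>-th partial derivative of the \<open>i\<close>-th component as entry \<open>J x $ i $ j\<close>;
  it is unique on \<open>closure \<Omega>\<close>.\<close>

definition has_jacobian_on_closure ::
    "(real^3) set \<Rightarrow> (real^3 \<Rightarrow> real^3) \<Rightarrow> (real^3 \<Rightarrow> real^3^3) \<Rightarrow> bool" where
  "has_jacobian_on_closure \<Omega> s J \<longleftrightarrow>
     continuous_on (closure \<Omega>) J \<and> (\<forall>x\<in>\<Omega>. (s has_derivative (\<lambda>h. J x *v h)) (at x))"

definition C1_closure :: "(real^3) set \<Rightarrow> (real^3 \<Rightarrow> real^3) set" where
  "C1_closure \<Omega> = {s. continuous_on (closure \<Omega>) s \<and> (\<exists>J. has_jacobian_on_closure \<Omega> s J)}"

definition S_space :: "(real^3) set \<Rightarrow> nat \<Rightarrow> (real^3) set set \<Rightarrow> (real^3 \<Rightarrow> real^3) set" where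
  "S_space \<Omega> r M = V_space \<Omega> r M \<inter> C1_closure \<Omega>"

definition curl_of_jacobian :: "real^3^3 \<Rightarrow> real^3" where
  "curl_of_jacobian A = vector [A$3$2 - A$2$3, A$1$3 - A$3$1, A$2$1 - A$1$2]"

definition curl_image ::
    "(real^3) set \<Rightarrow> (real^3 \<Rightarrow> real^3) set \<Rightarrow> (real^3 \<Rightarrow> real^3) set" where
  "curl_image \<Omega> A =
     {w. \<exists>s\<in>A. \<exists>J. has_jacobian_on_closure \<Omega> s J \<and>
           w = (\<lambda>x. if x \<in> closure \<Omega> then curl_of_jacobian (J x) else 0)}"


section \<open>Freudenthal triangulations\<close>

definition kuhn_tetrahedron :: "(3 \<Rightarrow> 3) \<Rightarrow> (real^3) set" where
  "kuhn_tetrahedron \<pi> = {x \<in> cbox 0 1. x $ \<pi> 1 \<ge> x $ \<pi> 2 \<and> x $ \<pi> 2 \<ge> x $ \<pi> 3}"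

text \<open>The affine map of the unit cube onto the cell with index \<open>(i, j, k)\<close> of the
  \<open>n \<times> m \<times> l\<close> array that partitions the box with corners \<open>a\<close> and \<open>b\<close>.\<close>

definition cell_map ::
    "real^3 \<Rightarrow> real^3 \<Rightarrow> nat \<Rightarrow> nat \<Rightarrow> nat \<Rightarrow> nat \<Rightarrow> nat \<Rightarrow> nat \<Rightarrow> real^3 \<Rightarrow> real^3" where
  "cell_map a b n m l i j k x =
     vector [a$1 + (b$1 - a$1) * ((real i + x$1) / real n),
             a$2 + (b$2 - a$2) * ((real j + x$2) / real m),
             a$3 + (b$3 - a$3) * ((real k + x$3) / real l)]"

definition freudenthal_mesh ::
    "real^3 \<Rightarrow> real^3 \<Rightarrow> nat \<Rightarrow> nat \<Rightarrow> nat \<Rightarrow> (real^3) set set" where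
  "freudenthal_mesh a b n m l =
     {cell_map a b n m l i j k ` kuhn_tetrahedron \<pi> | i j k \<pi>.
        i < n \<and> j < m \<and> k < l \<and> bij \<pi>}"


section \<open>Uniform refinement\<close>

definition uniformly_refines :: "(real^3) set set \<Rightarrow> (real^3) set set \<Rightarrow> bool" where
  "uniformly_refines M' M \<longleftrightarrow>
     (\<forall>T'\<in>M'. \<exists>T\<in>M. T' \<subseteq> T) \<and>
     (\<forall>T\<in>M. card {T'\<in>M'. T' \<subseteq> T} = 8 \<and> \<Union>{T'\<in>M'. T' \<subseteq> T} = T) \<and>
     (\<forall>F\<in>mesh_faces M. card {F'\<in>mesh_faces M'. F' \<subseteq> F} = 4 \<and>
                        \<Union>{F'\<in>mesh_faces M'. F' \<subseteq> F} = F) \<and>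
     (\<forall>e\<in>mesh_edges M. card {e'\<in>mesh_edges M'. e' \<subseteq> e} = 2 \<and>
                        \<Union>{e'\<in>mesh_edges M'. e' \<subseteq> e} = e) \<and>
     mesh_vertices M' =
       mesh_vertices M \<union> {midpoint p q | p q. closed_segment p q \<in> mesh_edges M}"

text \<open>A refinement preserves the triangulated set, so a scheme restricts to the meshes of any given
  domain; only this restriction is recorded.\<close>

definition uniform_refinement_scheme ::
    "(real^3) set \<Rightarrow> ((real^3) set set \<Rightarrow> (real^3) set set) \<Rightarrow> bool" where
  "uniform_refinement_scheme \<Omega> R \<longleftrightarrow>
     (\<forall>M. conforming_mesh \<Omega> M \<longrightarrow> conforming_mesh \<Omega> (R M) \<and> uniformly_refines (R M) M)"

end

theory Submission
  imports Defs
begin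

text \<open>The theorem holds because of a count of dimensions. Let a mesh have \<open>V\<close> vertices, \<open>E\<close> edges,
  \<open>F\<close> faces and \<open>T\<close> tetrahedra. Every strict inclusion below is derived from the single inequality
  \<open>9 V + 3 E < 13 T\<close> (\<open>Worsey_Farin_curl_proper_subset\<close>), in two steps.

  There are many divergence-free fields. The split has \<open>V + F + T\<close> vertices and \<open>E + 3 F + 8 T\<close>
  edges, and the products of the hat functions of the vertices of its simplices of dimension at most 1
  are independent continuous piecewise quadratics; so the quadratic fields have dimension at least
  \<open>3 (V + E + 4 F + 9 T)\<close>. The divergence is linear on each of the \<open>12 T\<close> cells, which gives \<open>48 T\<close>
  equations. They are dependent: the face point of an interior face lies between the two interior points,
  so the four cells around an edge from the face point to a vertex of the face are separated by two planes,
  and the alternating sum of the four divergences vanishes along this edge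
  (\<open>singular_edge_divergence\<close>). This makes five equations at each interior face superfluous. As a face
  has at most two tetrahedra, a family of \<open>3 V + 3 E + 13 T\<close> independent divergence-free fields remains
  (\<open>independent_Z_space_family\<close>).

  There are few potentials. A continuously differentiable piecewise cubic field on the split is
  determined by its values and gradients at the vertices and by two directional derivatives at each edge
  midpoint, \<open>12 V + 6 E\<close> numbers in all (\<open>unisolvence\<close>). In terms of the polar forms of the cubic pieces,
  continuity of the gradient along an edge of the split says that \<open>B a b w\<close>, for the ends \<open>a\<close> and \<open>b\<close> of the
  edge and an arbitrary point \<open>w\<close>, is the same for all cells at the edge. If all data vanish, one edge after
  another is annihilated by finding four affinely independent points \<open>w\<close> where \<open>B a b w\<close> vanishes.
  So if all divergence-free fields were curls, there would be \<open>3 V + 3 E + 13 T\<close> potentials with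
  independent curls, but \<open>9 V + 3 E < 13 T\<close> leaves a nontrivial combination of them with zero data.

  The inequality follows from a substitute for Euler's relation (\<open>card_edges_le\<close>). Along a generic direction
  \<open>u\<close> a ray from a vertex, or from an interior point of an edge, inside the domain starts in exactly one
  tetrahedron, and through how many of its vertices and edges a tetrahedron is entered along \<open>u\<close>
  and \<open>- u\<close> depends only on the number of barycentric coordinates that decrease along \<open>u\<close>. Summation
  gives \<open>E - V \<le> T\<close> up to boundary terms, so that \<open>13 T - 9 V - 3 E\<close> is at least
  \<open>10 E - 22 V\<close> up to boundary terms, which is positive for average vertex degree \<open>2 E / V > 4.4\<close>. The boundary
  terms are multiples of the number of boundary vertices, because the boundary faces lie in finitely many
  planes, and in each plane the same argument with a generic direction bounds the number of triangles by
  twice the number of vertices (\<open>card_faces_in_hyperplane_le\<close>).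

  For uniform refinements the number of tetrahedra grows by the factor 8, that of boundary faces by the
  factor 4 at most, and the number of vertices is increased by that of edges. For Freudenthal meshes the
  numbers are explicit; what remains to be seen is that the Kuhn tetrahedra of all cubes
  intersect in common faces (\<open>kuhn_vertex_shared\<close>).\<close>


section \<open>Homogeneous linear systems\<close>

text \<open>Elimination of the equations one by one: each costs at most one member of an independent family of
  solutions. The unknowns themselves serve as indices of the family, since only its size matters.\<close>

lemma kernel_family:
  fixes M :: "'a \<Rightarrow> 'b \<Rightarrow> real"
  assumes "finite B" "finite A"
  shows "\<exists>I c. finite I \<and> card A \<le> card I + card B \<and>
     (\<forall>k\<in>I. \<forall>b\<in>B. (\<Sum>a\<in>A. c k a * M a b) = 0) \<and>
     (\<forall>d :: 'a \<Rightarrow> real. (\<forall>a\<in>A. (\<Sum>k\<in>I. d k * c k a) = 0) \<longrightarrow> (\<forall>k\<in>I. d k = 0))"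
  using assms(1)
proof (induction B rule: finite_induct)
  case empty
  show ?case
  proof (intro exI[of _ A] exI[of _ "\<lambda>k a. if k = a then 1 else 0"] conjI)
    show "\<forall>d :: 'a \<Rightarrow> real. (\<forall>a\<in>A. (\<Sum>k\<in>A. d k * (if k = a then 1 else 0)) = 0) \<longrightarrow> (\<forall>k\<in>A. d k = 0)"
      using assms(2) by (simp add: if_distrib sum.delta cong: if_cong)
  qed (use assms in auto)
next
  case (insert b B)
  then obtain I c where I: "finite I" "card A \<le> card I + card B"
    and ker: "\<forall>k\<in>I. \<forall>b\<in>B. (\<Sum>a\<in>A. c k a * M a b) = 0"
    and ind: "\<And>d :: 'a \<Rightarrow> real. (\<forall>a\<in>A. (\<Sum>k\<in>I. d k * c k a) = 0) \<Longrightarrow> (\<forall>k\<in>I. d k = 0)"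
    by blast
  define m where "m k = (\<Sum>a\<in>A. c k a * M a b)" for k
  show ?case
  proof (cases "\<exists>k0\<in>I. m k0 \<noteq> 0")
    case False
    show ?thesis
      by (intro exI[of _ I] exI[of _ c]) (use False I ker ind insert m_def in auto)
  next
    case True
    then obtain k0 where k0: "k0 \<in> I" "m k0 \<noteq> 0" by blast
    define J where "J = I - {k0}"
    define c' where "c' k a = c k a - m k / m k0 * c k0 a" for k a
    have sum_c': "(\<Sum>a\<in>A. c' k a * M a x) = (\<Sum>a\<in>A. c k a * M a x) - m k / m k0 * (\<Sum>a\<in>A. c k0 a * M a x)" for k x
      by (simp add: c'_def algebra_simps sum_subtractf sum_distrib_left)
    have "(\<Sum>a\<in>A. c' k a * M a x) = 0" if "k \<in> J" "x \<in> insert b B" for k x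
    proof (cases "x = b")
      case True
      then show ?thesis using k0(2) by (simp add: sum_c' m_def[symmetric])
    next
      case False
      then show ?thesis using that ker k0 by (auto simp: sum_c' J_def)
    qed
    moreover have "\<forall>k\<in>J. d k = 0" if d: "\<forall>a\<in>A. (\<Sum>k\<in>J. d k * c' k a) = 0" for d :: "'a \<Rightarrow> real"
    proof -
      define d' where "d' k = (if k = k0 then - (\<Sum>k\<in>J. d k * (m k / m k0)) else d k)" for k
      have "(\<Sum>k\<in>I. d' k * c k a) = 0" if "a \<in> A" for a
      proof -
        have "(\<Sum>k\<in>I. d' k * c k a) = d' k0 * c k0 a + (\<Sum>k\<in>J. d' k * c k a)"
          unfolding J_def by (rule sum.remove) (use I k0 in auto)
        also have "(\<Sum>k\<in>J. d' k * c k a) = (\<Sum>k\<in>J. d k * c k a)"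
          by (rule sum.cong) (auto simp: d'_def J_def)
        also have "d' k0 * c k0 a = - (\<Sum>k\<in>J. d k * (m k / m k0) * c k0 a)"
          by (simp add: d'_def sum_distrib_right)
        also have "- (\<Sum>k\<in>J. d k * (m k / m k0) * c k0 a) + (\<Sum>k\<in>J. d k * c k a) = (\<Sum>k\<in>J. d k * c' k a)"
          by (simp add: c'_def algebra_simps sum_subtractf)
        finally show ?thesis using d that by simp
      qed
      then have "\<forall>k\<in>I. d' k = 0" using ind by blast
      then show ?thesis by (auto simp: d'_def J_def split: if_splits)
    qed
    moreover have "card A \<le> card J + card (insert b B)"
      using I k0 insert by (simp add: J_def card_Diff_singleton)
    ultimately show ?thesis
      by (intro exI[of _ J] exI[of _ c']) (use I in \<open>auto simp: J_def\<close>)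
  qed
qed

lemma underdetermined_system:
  fixes M :: "'a \<Rightarrow> 'b \<Rightarrow> real"
  assumes "finite B" "finite A" "card B < card A"
  obtains c where "\<exists>a\<in>A. c a \<noteq> 0" "\<forall>b\<in>B. (\<Sum>a\<in>A. c a * M a b) = 0"
proof -
  obtain I c where I: "finite I" "card A \<le> card I + card B"
    and ker: "\<forall>k\<in>I. \<forall>b\<in>B. (\<Sum>a\<in>A. c k a * M a b) = 0"
    and ind: "\<And>d :: 'a \<Rightarrow> real. (\<forall>a\<in>A. (\<Sum>k\<in>I. d k * c k a) = 0) \<Longrightarrow> (\<forall>k\<in>I. d k = 0)"
    using kernel_family[OF assms(1,2), of M] by blast
  have "I \<noteq> {}" using I assms(3) by auto
  then obtain k where k: "k \<in> I" by auto
  have "\<exists>a\<in>A. c k a \<noteq> 0"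
  proof (rule ccontr)
    assume "\<not> ?thesis"
    then have "\<forall>a\<in>A. (\<Sum>j\<in>I. (if j = k then 1 else 0) * c j a) = 0"
      by (simp add: if_distrib[of "\<lambda>x. x * _"] sum.delta I k cong: if_cong)
    then have "\<forall>j\<in>I. (if j = k then 1 else 0 :: real) = 0"
      by (rule ind)
    then show False using k by auto
  qed
  then show ?thesis using that[of "c k"] ker k by blast
qed


section \<open>Affine functionals and polynomials of low degree\<close>

definition affine_functional :: "('a::euclidean_space \<Rightarrow> real) \<Rightarrow> bool" where
  "affine_functional f \<longleftrightarrow> (\<exists>a c. \<forall>x. f x = a \<bullet> x + c)"

lemma affine_functional_const [intro]: "affine_functional (\<lambda>x. c)"
  unfolding affine_functional_def by (intro exI[of _ 0] exI[of _ c]) auto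

lemma affine_functional_inner [intro]: "affine_functional (\<lambda>x. a \<bullet> x)"
  unfolding affine_functional_def by (intro exI[of _ a] exI[of _ 0]) auto

lemma affine_functional_add [intro]:
  "affine_functional f \<Longrightarrow> affine_functional g \<Longrightarrow> affine_functional (\<lambda>x. f x + g x)"
proof -
  assume "affine_functional f" "affine_functional g"
  then obtain a c b d where "\<And>x. f x = a \<bullet> x + c" "\<And>x. g x = b \<bullet> x + d"
    unfolding affine_functional_def by metis
  then show ?thesis unfolding affine_functional_def
    by (intro exI[of _ "a + b"] exI[of _ "c + d"]) (auto simp: inner_add_left)
qed

lemma affine_functional_cmult [intro]:
  "affine_functional f \<Longrightarrow> affine_functional (\<lambda>x. r * f x)"
proof -
  assume "affine_functional f"
  then obtain a c where "\<And>x. f x = a \<bullet> x + c"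
    unfolding affine_functional_def by metis
  then show ?thesis unfolding affine_functional_def
    by (intro exI[of _ "r *\<^sub>R a"] exI[of _ "r * c"]) (auto simp: algebra_simps)
qed

lemma affine_functional_multc [intro]:
  "affine_functional f \<Longrightarrow> affine_functional (\<lambda>x. f x * r)"
  using affine_functional_cmult[of f r] by (simp add: mult.commute)

lemma affine_functional_minus [intro]:
  "affine_functional f \<Longrightarrow> affine_functional (\<lambda>x. - f x)"
  using affine_functional_cmult[of f "-1"] by simp

lemma affine_functional_diff [intro]:
  "affine_functional f \<Longrightarrow> affine_functional g \<Longrightarrow> affine_functional (\<lambda>x. f x - g x)"
  using affine_functional_add[OF _ affine_functional_minus] by fastforce

lemma affine_functional_divide [intro]:
  "affine_functional f \<Longrightarrow> affine_functional (\<lambda>x. f x / r)"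
  using affine_functional_cmult[of f "inverse r"] by (simp add: field_simps)

lemma affine_functional_sum [intro]:
  "(\<And>i. i \<in> I \<Longrightarrow> affine_functional (f i)) \<Longrightarrow> affine_functional (\<lambda>x. \<Sum>i\<in>I. f i x)"
  by (induction I rule: infinite_finite_induct) auto

lemma affine_functional_combination:
  assumes "affine_functional f" "(\<Sum>i\<in>I. w i) = 1"
  shows "f (\<Sum>i\<in>I. w i *\<^sub>R x i) = (\<Sum>i\<in>I. w i * f (x i))"
proof -
  obtain a c where f: "\<And>x. f x = a \<bullet> x + c"
    using assms unfolding affine_functional_def by metis
  have "(\<Sum>i\<in>I. w i * f (x i)) = (\<Sum>i\<in>I. w i * (a \<bullet> x i)) + (\<Sum>i\<in>I. w i) * c"
    by (simp add: f algebra_simps sum.distrib sum_distrib_left)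
  then show ?thesis by (simp add: f inner_sum_right assms)
qed

lemma affine_functional_midpoint:
  assumes "affine_functional f"
  shows "f (midpoint a b) = (f a + f b) / 2"
proof -
  obtain a c where f: "\<And>x. f x = a \<bullet> x + c"
    using assms unfolding affine_functional_def by metis
  show ?thesis by (simp add: f midpoint_def inner_add_right field_simps)
qed

lemma affine_functional_continuous:
  "affine_functional f \<Longrightarrow> continuous_on S f"
proof -
  assume "affine_functional f"
  then obtain a c where f: "\<And>x. f x = a \<bullet> x + c"
    unfolding affine_functional_def by metis
  show ?thesis unfolding f by (intro continuous_intros)
qed

lemma affine_functional_has_derivative:
  "affine_functional f \<Longrightarrow> (f has_derivative (\<lambda>h. f h - f 0)) (at x within S)"
proof -
  assume "affine_functional f"
  then obtain a c where "\<And>x. f x = a \<bullet> x + c"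
    unfolding affine_functional_def by metis
  then have "f = (\<lambda>x. a \<bullet> x + c)" by auto
  then show ?thesis by (auto intro!: derivative_eq_intros)
qed

lemma affine_functional_line:
  assumes "affine_functional f"
  shows "f (x + t *\<^sub>R u) = f x + t * (f u - f 0)"
proof -
  obtain a c where "\<And>x. f x = a \<bullet> x + c"
    using assms unfolding affine_functional_def by metis
  then show ?thesis by (simp add: inner_add_right)
qed

lemma affine_functional_translate:
  assumes "affine_functional f"
  shows "affine_functional (\<lambda>w. f (w - x))" "affine_functional (\<lambda>w. f (x + w))"
proof -
  obtain a c where f: "\<And>x. f x = a \<bullet> x + c"
    using assms unfolding affine_functional_def by metis
  show "affine_functional (\<lambda>w. f (w - x))" "affine_functional (\<lambda>w. f (x + w))"
    unfolding f affine_functional_def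
    by (intro exI[of _ a] exI[of _ "c - a \<bullet> x"]; simp add: algebra_simps)
       (intro exI[of _ a] exI[of _ "c + a \<bullet> x"]; simp add: algebra_simps)
qed

lemma linear_imp_affine_functional:
  fixes f :: "'a::euclidean_space \<Rightarrow> real"
  assumes "linear f"
  shows "affine_functional f"
proof -
  have "f x = (adjoint f 1) \<bullet> x + 0" for x
    using adjoint_works[OF assms, of x 1] by (simp add: inner_commute)
  then show ?thesis unfolding affine_functional_def by blast
qed

lemma polynomial_of_degree_le_add:
  assumes "polynomial_of_degree_le k p" "polynomial_of_degree_le k q"
  shows "polynomial_of_degree_le k (\<lambda>x. p x + q x)"
proof -
  obtain c d where "\<forall>x. p x = (\<Sum>i\<le>k. \<Sum>j\<le>k - i. \<Sum>l\<le>k - i - j. c i j l * x$1 ^ i * x$2 ^ j * x$3 ^ l)"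
    "\<forall>x. q x = (\<Sum>i\<le>k. \<Sum>j\<le>k - i. \<Sum>l\<le>k - i - j. d i j l * x$1 ^ i * x$2 ^ j * x$3 ^ l)"
    using assms unfolding polynomial_of_degree_le_def by blast
  then show ?thesis unfolding polynomial_of_degree_le_def
    by (intro exI[of _ "\<lambda>i j l. c i j l + d i j l"]) (simp add: algebra_simps sum.distrib)
qed

lemma polynomial_of_degree_le_cmult:
  assumes "polynomial_of_degree_le k p"
  shows "polynomial_of_degree_le k (\<lambda>x. r * p x)"
proof -
  obtain c where "\<forall>x. p x = (\<Sum>i\<le>k. \<Sum>j\<le>k - i. \<Sum>l\<le>k - i - j. c i j l * x$1 ^ i * x$2 ^ j * x$3 ^ l)"
    using assms unfolding polynomial_of_degree_le_def by blast
  then show ?thesis unfolding polynomial_of_degree_le_def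
    by (intro exI[of _ "\<lambda>i j l. r * c i j l"]) (simp add: algebra_simps sum_distrib_left)
qed

lemma polynomial_of_degree_le_0: "polynomial_of_degree_le k (\<lambda>x. 0)"
  unfolding polynomial_of_degree_le_def by (intro exI[of _ "\<lambda>i j l. 0"]) simp

lemma polynomial_of_degree_le_diff:
  assumes "polynomial_of_degree_le k p" "polynomial_of_degree_le k q"
  shows "polynomial_of_degree_le k (\<lambda>x. p x - q x)"
  using polynomial_of_degree_le_add[OF assms(1) polynomial_of_degree_le_cmult[OF assms(2), of "-1"]]
  by simp

lemma polynomial_of_degree_le_sum:
  "(\<And>i. i \<in> I \<Longrightarrow> polynomial_of_degree_le k (f i)) \<Longrightarrow> polynomial_of_degree_le k (\<lambda>x. \<Sum>i\<in>I. f i x)"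
  by (induction I rule: infinite_finite_induct)
     (auto intro: polynomial_of_degree_le_0 polynomial_of_degree_le_add)

lemma polynomial_of_degree_le_monomial:
  assumes "i + j + l \<le> k"
  shows "polynomial_of_degree_le k (\<lambda>x. x$1 ^ i * x$2 ^ j * x$3 ^ l)"
  unfolding polynomial_of_degree_le_def
proof (intro exI allI)
  fix x :: "real^3"
  let ?c = "\<lambda>i' j' l'. if i' = i then if j' = j then if l' = l then 1 else 0 else 0 else (0::real)"
  have delta: "(\<Sum>n\<in>A. (if n = m then c else 0) * f n) = c * f m" if "finite A" "m \<in> A"
    for A m c and f :: "nat \<Rightarrow> real"
    using that by (simp add: if_distrib[of "\<lambda>t. t * _"] sum.delta cong: if_cong)
  have "(\<Sum>l'\<le>k - i' - j'. ?c i' j' l' * x$1 ^ i' * x$2 ^ j' * x$3 ^ l')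
      = (if i' = i then if j' = j then 1 else 0 else 0) * (x$1 ^ i' * x$2 ^ j' * x$3 ^ l)" for i' j'
    using assms delta[of "{..k - i - j}" l 1 "\<lambda>n. x$1 ^ i * x$2 ^ j * x$3 ^ n"]
    by (auto simp: mult.assoc)
  moreover have "(\<Sum>j'\<le>k - i'. (if i' = i then if j' = j then 1 else 0 else 0) * (x$1 ^ i' * x$2 ^ j' * x$3 ^ l))
      = (if i' = i then 1 else 0) * (x$1 ^ i' * x$2 ^ j * x$3 ^ l)" for i'
    using assms delta[of "{..k - i}" j 1 "\<lambda>n. x$1 ^ i * x$2 ^ n * x$3 ^ l"]
    by auto
  ultimately show "x$1 ^ i * x$2 ^ j * x$3 ^ l =
    (\<Sum>i'\<le>k. \<Sum>j'\<le>k - i'. \<Sum>l'\<le>k - i' - j'. ?c i' j' l' * x$1 ^ i' * x$2 ^ j' * x$3 ^ l')"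
    using assms delta[of "{..k}" i 1 "\<lambda>n. x$1 ^ n * x$2 ^ j * x$3 ^ l"] by simp
qed

lemma polynomial_of_degree_le_coordinate:
  assumes "1 \<le> k" shows "polynomial_of_degree_le k (\<lambda>x. x$i)"
  using polynomial_of_degree_le_monomial[of 1 0 0 k] polynomial_of_degree_le_monomial[of 0 1 0 k]
    polynomial_of_degree_le_monomial[of 0 0 1 k] exhaust_3[of i] assms by auto

lemma polynomial_of_degree_le_coordinate_product:
  "polynomial_of_degree_le 2 (\<lambda>x. x$i * x$j)"
  using polynomial_of_degree_le_monomial[of 2 0 0 2] polynomial_of_degree_le_monomial[of 0 2 0 2]
    polynomial_of_degree_le_monomial[of 0 0 2 2] polynomial_of_degree_le_monomial[of 1 1 0 2]
    polynomial_of_degree_le_monomial[of 1 0 1 2] polynomial_of_degree_le_monomial[of 0 1 1 2]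
    exhaust_3[of i] exhaust_3[of j] by (auto simp: power2_eq_square mult.commute)

lemma polynomial_of_degree_le_affine:
  assumes "affine_functional f" "1 \<le> k"
  shows "polynomial_of_degree_le k f"
proof -
  obtain a c where "\<And>x. f x = a \<bullet> x + c"
    using assms unfolding affine_functional_def by metis
  then have "f = (\<lambda>x. (\<Sum>i\<in>UNIV. a$i * x$i) + c * 1)" by (auto simp: inner_vec_def)
  moreover have "polynomial_of_degree_le k (\<lambda>x. 1)"
    using polynomial_of_degree_le_monomial[of 0 0 0 k] by simp
  ultimately show ?thesis
    using assms by (auto intro!: polynomial_of_degree_le_add polynomial_of_degree_le_sum
        polynomial_of_degree_le_cmult polynomial_of_degree_le_coordinate
        polynomial_of_degree_le_cmult[of _ "\<lambda>x. 1", simplified])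
qed

lemma polynomial_of_degree_le_affine_product:
  assumes "affine_functional f" "affine_functional g"
  shows "polynomial_of_degree_le 2 (\<lambda>x. f x * g x)"
proof -
  obtain a c b d where f: "\<And>x. f x = a \<bullet> x + c" and g: "\<And>x. g x = b \<bullet> x + d"
    using assms unfolding affine_functional_def by metis
  have "(a \<bullet> x) * (b \<bullet> x) = (\<Sum>i\<in>UNIV. a$i * (\<Sum>j\<in>UNIV. b$j * (x$i * x$j)))" for x
    unfolding inner_vec_def sum_product
    by (intro sum.cong refl) (simp add: sum_distrib_left mult_ac)
  then have "(\<lambda>x. f x * g x) = (\<lambda>x. (\<Sum>i\<in>UNIV. a$i * (\<Sum>j\<in>UNIV. b$j * (x$i * x$j))) +
      d * (a \<bullet> x) + c * g x)"
    by (auto simp: f g algebra_simps)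
  also have "\<dots> = (\<lambda>x. (\<Sum>i\<in>UNIV. a$i * (\<Sum>j\<in>UNIV. b$j * (x$i * x$j))) +
      d * (\<Sum>i\<in>UNIV. a$i * x$i) + c * g x)" by (simp add: inner_vec_def)
  finally show ?thesis
    using polynomial_of_degree_le_affine[OF assms(2), of 2]
    by (simp only:) (intro polynomial_of_degree_le_add polynomial_of_degree_le_sum
        polynomial_of_degree_le_cmult polynomial_of_degree_le_coordinate
        polynomial_of_degree_le_coordinate_product; simp)
qed

text \<open>Every monomial of degree at most 3 is a product of exactly three affine functionals (pad with
  ones), so a property of products of affine functionals that is closed under addition holds for
  all cubic polynomials.\<close>

lemma cubic_polynomial_induct [consumes 1, case_names product add]:
  assumes p: "polynomial_of_degree_le 3 p"
    and prod: "\<And>f g h :: real^3 \<Rightarrow> real. affine_functional f \<Longrightarrow> affine_functional g \<Longrightarrow>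
          affine_functional h \<Longrightarrow> P (\<lambda>x. f x * g x * h x)"
    and add: "\<And>p q. P p \<Longrightarrow> P q \<Longrightarrow> P (\<lambda>x. p x + q x)"
  shows "P p"
proof -
  have "P (\<lambda>x. 0)"
    using prod[of "\<lambda>x. 0" "\<lambda>x. 0" "\<lambda>x. 0"] by (simp add: affine_functional_const)
  then have sum: "P (\<lambda>x. \<Sum>i\<in>I. f i x)" if "\<And>i. i \<in> I \<Longrightarrow> P (f i)" for f and I :: "nat set"
    using that by (induction I rule: infinite_finite_induct) (auto intro: add)
  have mono: "P (\<lambda>x. c * x$1 ^ i * x$2 ^ j * x$3 ^ l)" if "i + j + l \<le> 3" for c i j l
  proof -
    define fs :: "(real^3 \<Rightarrow> real) list" where "fs = replicate i (\<lambda>x. x$1) @ replicate j (\<lambda>x. x$2) @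
      replicate l (\<lambda>x. x$3) @ replicate (3 - i - j - l) (\<lambda>x. 1)"
    have "length fs = 3" using that by (simp add: fs_def)
    then obtain f g h where fs: "fs = [f, g, h]"
      by (auto simp: numeral_3_eq_3 length_Suc_conv)
    have "affine_functional (\<lambda>x :: real^3. x$i)" for i
      using affine_functional_inner[of "axis i 1 :: real^3"] by (simp add: inner_axis' inner_real_def)
    then have "\<forall>u\<in>set fs. affine_functional u"
      by (auto simp: fs_def affine_functional_const)
    then have "P (\<lambda>x. (c * f x) * g x * h x)"
      by (intro prod) (auto simp: fs)
    moreover have "f x * g x * h x = x$1 ^ i * x$2 ^ j * x$3 ^ l" for x
    proof -
      have "f x * g x * h x = prod_list (map (\<lambda>f. f x) fs)" by (simp add: fs)
      also have "\<dots> = x$1 ^ i * x$2 ^ j * x$3 ^ l"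
        by (simp add: fs_def prod_list_replicate)
      finally show ?thesis .
    qed
    ultimately show ?thesis by (simp add: mult.assoc)
  qed
  obtain c where c: "\<forall>x. p x = (\<Sum>i\<le>3. \<Sum>j\<le>3 - i. \<Sum>l\<le>3 - i - j. c i j l * x$1 ^ i * x$2 ^ j * x$3 ^ l)"
    using p unfolding polynomial_of_degree_le_def by blast
  have "P (\<lambda>x. \<Sum>i\<le>3. \<Sum>j\<le>3 - i. \<Sum>l\<le>3 - i - j. c i j l * x$1 ^ i * x$2 ^ j * x$3 ^ l)"
    by (intro sum mono) auto
  moreover have "p = (\<lambda>x. \<Sum>i\<le>3. \<Sum>j\<le>3 - i. \<Sum>l\<le>3 - i - j. c i j l * x$1 ^ i * x$2 ^ j * x$3 ^ l)"
    using c by auto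
  ultimately show ?thesis by simp
qed

text \<open>The polar form of a cubic is the symmetric map, affine in each argument, whose restriction to
  the diagonal is the cubic. It carries value and gradient at a point \<open>x\<close> as the affine map
  \<open>B x x\<close>, and its values at the vertices of a tetrahedron are the Bernstein--Bezier coefficients.\<close>

definition polar_form :: "(real^3 \<Rightarrow> real) \<Rightarrow> (real^3 \<Rightarrow> real^3 \<Rightarrow> real^3 \<Rightarrow> real) \<Rightarrow> bool" where
  "polar_form p B \<longleftrightarrow>
     (\<forall>u v. affine_functional (B u v)) \<and>
     (\<forall>u v w. B u v w = B v u w \<and> B u v w = B u w v) \<and>
     (\<forall>x. p x = B x x x) \<and>
     (\<forall>x. (p has_derivative (\<lambda>h. 3 * (B x x (x + h) - B x x x))) (at x))"

lemma cubic_polar_form: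
  assumes "polynomial_of_degree_le 3 p"
  shows "\<exists>B. polar_form p B"
  using assms
proof (induction rule: cubic_polynomial_induct)
  case (product f g h)
  define B where "B u v w = (f u * g v * h w + f u * g w * h v + f v * g u * h w + f v * g w * h u +
    f w * g u * h v + f w * g v * h u) / 6" for u v w
  have "polar_form (\<lambda>x. f x * g x * h x) B"
    unfolding polar_form_def
  proof (intro conjI allI)
    fix u v w x
    show "affine_functional (B u v)"
      unfolding B_def
      by (intro affine_functional_divide affine_functional_add affine_functional_multc
          affine_functional_cmult product)
    show "B u v w = B v u w" "B u v w = B u w v" by (simp_all add: B_def algebra_simps)
    show "f x * g x * h x = B x x x" by (simp add: B_def)
    have l: "k (x + y) = k x + (k y - k 0)" if "affine_functional k" for k and y :: "real^3"
      using affine_functional_line[OF that, of x 1 y] by simp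
    show "((\<lambda>x. f x * g x * h x) has_derivative (\<lambda>h. 3 * (B x x (x + h) - B x x x))) (at x)"
      by (rule derivative_eq_intros affine_functional_has_derivative product refl)+
         (simp only: B_def l[OF product(1)] l[OF product(2)] l[OF product(3)],
          rule ext, simp add: field_simps)
  qed
  then show ?case by blast
next
  case (add p q)
  then obtain B C where B: "polar_form p B" and C: "polar_form q C" by blast
  have "polar_form (\<lambda>x. p x + q x) (\<lambda>u v w. B u v w + C u v w)"
    unfolding polar_form_def
  proof (intro conjI allI)
    fix u v w x
    show "affine_functional (\<lambda>w. B u v w + C u v w)"
      by (rule affine_functional_add) (use B C in \<open>unfold polar_form_def, blast+\<close>)
    show "B u v w + C u v w = B v u w + C v u w" "B u v w + C u v w = B u w v + C u w v"
      using B C unfolding polar_form_def by metis+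
    show "p x + q x = B x x x + C x x x"
      using B C unfolding polar_form_def by auto
    have "(p has_derivative (\<lambda>h. 3 * (B x x (x + h) - B x x x))) (at x)"
      "(q has_derivative (\<lambda>h. 3 * (C x x (x + h) - C x x x))) (at x)"
      using B C unfolding polar_form_def by auto
    then show "((\<lambda>x. p x + q x) has_derivative
        (\<lambda>h. 3 * (B x x (x + h) + C x x (x + h) - (B x x x + C x x x)))) (at x)"
      by (auto intro!: derivative_eq_intros simp: algebra_simps)
  qed
  then show ?case by blast
qed

text \<open>A gradient \<open>g\<close> and a Hessian \<open>H\<close> of \<open>p\<close>. That the gradient of a cubic is quadratic puts curls of
  cubic fields into the quadratic fields, and the symmetry of the Hessian makes them divergence-free.\<close>

definition quadratic_gradient :: "(real^3 \<Rightarrow> real) \<Rightarrow> (3 \<Rightarrow> real^3 \<Rightarrow> real) \<Rightarrow> (3 \<Rightarrow> 3 \<Rightarrow> real^3 \<Rightarrow> real) \<Rightarrow> bool" where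
  "quadratic_gradient p g H \<longleftrightarrow> (\<forall>i. polynomial_of_degree_le 2 (g i)) \<and>
     (\<forall>x. (p has_derivative (\<lambda>h. \<Sum>i\<in>UNIV. g i x * h $ i)) (at x)) \<and>
     (\<forall>i x. (g i has_derivative (\<lambda>h. \<Sum>j\<in>UNIV. H i j x * h $ j)) (at x)) \<and>
     (\<forall>i j x. H i j x = H j i x)"

lemma cubic_partial_derivatives:
  assumes "polynomial_of_degree_le 3 p"
  shows "\<exists>g H. (\<forall>i. polynomial_of_degree_le 2 (g i)) \<and>
     (\<forall>x. (p has_derivative (\<lambda>h. \<Sum>i\<in>UNIV. g i x * h $ i)) (at x)) \<and>
     (\<forall>i x. (g i has_derivative (\<lambda>h. \<Sum>j\<in>UNIV. H i j x * h $ j)) (at x)) \<and>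
     (\<forall>i j x. H i j x = (H j i x :: real))"
  using assms
proof (induction rule: cubic_polynomial_induct)
  case (product f1 f2 f3)
  obtain a1 c1 a2 c2 a3 c3 where f: "f1 = (\<lambda>x. a1 \<bullet> x + c1)" "f2 = (\<lambda>x. a2 \<bullet> x + c2)" "f3 = (\<lambda>x. a3 \<bullet> x + c3)"
    using product unfolding affine_functional_def by (metis ext)
  define g where "g i x = a1$i * (f2 x * f3 x) + a2$i * (f1 x * f3 x) + a3$i * (f1 x * f2 x)" for i x
  define H where "H i j x = (a1$i*a2$j + a1$j*a2$i) * f3 x + (a1$i*a3$j + a1$j*a3$i) * f2 x
     + (a2$i*a3$j + a2$j*a3$i) * f1 x" for i j x
  show ?case
  proof (intro exI[of _ g] exI[of _ H] conjI allI)
    fix i j x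
    show "polynomial_of_degree_le 2 (g i)"
      unfolding g_def by (intro polynomial_of_degree_le_add polynomial_of_degree_le_cmult
          polynomial_of_degree_le_affine_product product)
    show "H i j x = H j i x" by (simp add: H_def algebra_simps)
    show "((\<lambda>x. f1 x * f2 x * f3 x) has_derivative (\<lambda>h. \<Sum>i\<in>UNIV. g i x * h $ i)) (at x)"
      unfolding f by (rule derivative_eq_intros refl)+
        (auto simp: g_def f inner_vec_def sum_3 algebra_simps)
    show "(g i has_derivative (\<lambda>h. \<Sum>j\<in>UNIV. H i j x * h $ j)) (at x)"
      unfolding g_def[abs_def] f by (rule derivative_eq_intros refl)+
        (auto simp: H_def f inner_vec_def sum_3 algebra_simps)
  qed
next
  case (add p q)
  then obtain g H g' H' where "\<forall>i. polynomial_of_degree_le 2 (g i)"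
     "\<forall>x. (p has_derivative (\<lambda>h. \<Sum>i\<in>UNIV. g i x * h $ i)) (at x)"
     "\<forall>i x. (g i has_derivative (\<lambda>h. \<Sum>j\<in>UNIV. H i j x * h $ j)) (at x)"
     "\<forall>i j x. H i j x = (H j i x :: real)" "\<forall>i. polynomial_of_degree_le 2 (g' i)"
     "\<forall>x. (q has_derivative (\<lambda>h. \<Sum>i\<in>UNIV. g' i x * h $ i)) (at x)"
     "\<forall>i x. (g' i has_derivative (\<lambda>h. \<Sum>j\<in>UNIV. H' i j x * h $ j)) (at x)"
     "\<forall>i j x. H' i j x = (H' j i x :: real)" by blast
  then show ?case
    by (intro exI[of _ "\<lambda>i x. g i x + g' i x"] exI[of _ "\<lambda>i j x. H i j x + H' i j x"])
       (auto intro!: polynomial_of_degree_le_add derivative_eq_intros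
          simp: algebra_simps sum.distrib)
qed

lemma cubic_quadratic_gradient: "polynomial_of_degree_le 3 p \<Longrightarrow> \<exists>g H. quadratic_gradient p g H"
  unfolding quadratic_gradient_def by (rule cubic_partial_derivatives)

lemma quadratic_gradientD:
  assumes "quadratic_gradient p g H"
  shows "polynomial_of_degree_le 2 (g i)"
    "(p has_derivative (\<lambda>h. \<Sum>i\<in>UNIV. g i x * h $ i)) (at x)"
    "(g i has_derivative (\<lambda>h. \<Sum>j\<in>UNIV. H i j x * h $ j)) (at x)"
    "H i j x = H j i x" "continuous_on UNIV (g i)"
proof -
  show g: "(g i has_derivative (\<lambda>h. \<Sum>j\<in>UNIV. H i j x * h $ j)) (at x)" for x
    using assms unfolding quadratic_gradient_def by blast
  show "continuous_on UNIV (g i)"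
    by (intro continuous_at_imp_continuous_on ballI) (rule has_derivative_continuous[OF g])
qed (use assms in \<open>unfold quadratic_gradient_def, blast+\<close>)


section \<open>Barycentric coordinates\<close>

text \<open>The coefficients exist and are unique on an affine frame, so the choice is harmless there.\<close>

definition bary :: "(real^3) set \<Rightarrow> real^3 \<Rightarrow> real^3 \<Rightarrow> real" where
  "bary C p x = (SOME u. sum u C = 1 \<and> (\<Sum>v\<in>C. u v *\<^sub>R v) = x) p"

text \<open>Four affinely independent points of space span it affinely; they are the vertex sets of
  tetrahedra.\<close>

definition affine_frame :: "(real^3) set \<Rightarrow> bool" where
  "affine_frame C \<longleftrightarrow> \<not> affine_dependent C \<and> card C = 4"

lemma affine_frame_finite: "affine_frame C \<Longrightarrow> finite C"
  unfolding affine_frame_def using aff_independent_finite by blast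

lemma affine_frame_hull: "affine_frame C \<Longrightarrow> affine hull C = UNIV"
  unfolding affine_frame_def by (rule affine_independent_span_eq) auto

lemma affine_independent_unique_combination:
  fixes C :: "'a::real_vector set"
  assumes "\<not> affine_dependent C" "finite C" "sum u C = sum w C"
    "(\<Sum>v\<in>C. u v *\<^sub>R v) = (\<Sum>v\<in>C. w v *\<^sub>R v)" "p \<in> C"
  shows "u p = w p"
proof -
  have "sum (\<lambda>v. u v - w v) C = 0" "(\<Sum>v\<in>C. (u v - w v) *\<^sub>R v) = 0"
    using assms by (simp_all add: sum_subtractf scaleR_left_diff_distrib)
  then have "\<forall>v\<in>C. u v - w v = 0"
    using assms(1) affine_dependent_explicit_finite[OF assms(2)] by blast
  then show ?thesis using assms(5) by auto
qed

lemma bary_sums: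
  assumes "affine_frame C"
  shows sum_bary: "(\<Sum>p\<in>C. bary C p x) = 1"
    and sum_bary_scaleR: "(\<Sum>p\<in>C. bary C p x *\<^sub>R p) = x"
proof -
  have "\<exists>u. sum u C = 1 \<and> (\<Sum>v\<in>C. u v *\<^sub>R v) = x"
    using affine_frame_hull[OF assms] affine_hull_finite[OF affine_frame_finite[OF assms]] by blast
  from someI_ex[OF this] show "(\<Sum>p\<in>C. bary C p x) = 1" "(\<Sum>p\<in>C. bary C p x *\<^sub>R p) = x"
    unfolding bary_def by auto
qed

lemma bary_unique:
  assumes "affine_frame C" "sum u C = 1" "(\<Sum>v\<in>C. u v *\<^sub>R v) = x" "p \<in> C"
  shows "bary C p x = u p"
  using affine_independent_unique_combination[of C "\<lambda>p. bary C p x" u p] assms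
    bary_sums[OF assms(1), of x] affine_frame_finite[OF assms(1)]
  by (auto simp: affine_frame_def)

lemma affine_functional_bary:
  assumes C: "affine_frame C" "p \<in> C"
  shows "affine_functional (bary C p)"
proof -
  note s = bary_sums[OF C(1)]
  have "linear (\<lambda>x. bary C p x - bary C p 0)"
  proof (rule linearI)
    fix x y :: "real^3" and r :: real
    have "bary C p (x + y) = bary C p x + bary C p y - bary C p 0"
      by (rule bary_unique[OF C(1) _ _ C(2), where u = "\<lambda>p. bary C p x + bary C p y - bary C p 0"])
        (simp_all add: algebra_simps sum.distrib sum_subtractf s)
    then show "bary C p (x + y) - bary C p 0 = bary C p x - bary C p 0 + (bary C p y - bary C p 0)"
      by simp
    have "bary C p (r *\<^sub>R x) = r * bary C p x + (1 - r) * bary C p 0"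
    proof (rule bary_unique[OF C(1) _ _ C(2), where u = "\<lambda>p. r * bary C p x + (1 - r) * bary C p 0"])
      show "(\<Sum>p\<in>C. r * bary C p x + (1 - r) * bary C p 0) = 1"
        by (simp add: sum.distrib sum_distrib_left[symmetric] s)
      have "(\<Sum>v\<in>C. (r * bary C v x + (1 - r) * bary C v 0) *\<^sub>R v)
          = r *\<^sub>R (\<Sum>v\<in>C. bary C v x *\<^sub>R v) + (1 - r) *\<^sub>R (\<Sum>v\<in>C. bary C v 0 *\<^sub>R v)"
        by (simp add: scaleR_left_distrib sum.distrib scaleR_sum_right)
      then show "(\<Sum>v\<in>C. (r * bary C v x + (1 - r) * bary C v 0) *\<^sub>R v) = r *\<^sub>R x"
        by (simp add: s)
    qed
    then show "bary C p (r *\<^sub>R x) - bary C p 0 = r *\<^sub>R (bary C p x - bary C p 0)"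
      by (simp add: algebra_simps)
  qed
  from affine_functional_add[OF linear_imp_affine_functional[OF this] affine_functional_const[of "bary C p 0"]]
  show ?thesis by simp
qed

lemma bary_vertex:
  assumes "affine_frame C" "p \<in> C" "q \<in> C"
  shows "bary C p q = (if p = q then 1 else 0)"
  by (rule bary_unique[OF assms(1) _ _ assms(2), where u = "\<lambda>p. if p = q then 1 else 0"])
     (use affine_frame_finite[OF assms(1)] assms(3) in
       \<open>simp_all add: sum.delta if_distrib[of "\<lambda>t. t *\<^sub>R _"] cong: if_cong\<close>)

lemma affine_functional_bary_expansion:
  assumes "affine_functional f" "affine_frame C"
  shows "f x = (\<Sum>p\<in>C. bary C p x * f p)"
  using affine_functional_combination[OF assms(1) sum_bary[OF assms(2), of x], of "\<lambda>p. p"]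
  by (simp add: sum_bary_scaleR[OF assms(2)])

lemma affine_functional_eq_0:
  assumes "affine_functional f" "affine_frame C" "\<And>p. p \<in> C \<Longrightarrow> f p = 0"
  shows "f x = 0"
  using affine_functional_bary_expansion[OF assms(1,2), of x] assms(3) by simp

lemma bary_subset_unique:
  assumes C: "affine_frame C" "c \<subseteq> C" "sum u c = 1" "(\<Sum>v\<in>c. u v *\<^sub>R v) = x" "p \<in> C"
  shows "bary C p x = (if p \<in> c then u p else 0)"
proof -
  define w where "w p = (if p \<in> c then u p else 0)" for p
  have "sum w C = 1"
    using sum.mono_neutral_cong_left[of C c w u] affine_frame_finite[OF C(1)] C by (simp add: w_def)
  moreover have "(\<Sum>v\<in>C. w v *\<^sub>R v) = x"
    using sum.mono_neutral_cong_left[of C c "\<lambda>v. w v *\<^sub>R v" "\<lambda>v. u v *\<^sub>R v"]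
      affine_frame_finite[OF C(1)] C by (simp add: w_def)
  ultimately show ?thesis using bary_unique[OF C(1) _ _ C(5), of w x] by (simp add: w_def)
qed

lemma convex_hull_subset_bary:
  assumes "affine_frame C" "c \<subseteq> C"
  shows "x \<in> convex hull c \<longleftrightarrow> (\<forall>p\<in>C. 0 \<le> bary C p x) \<and> (\<forall>p\<in>C - c. bary C p x = 0)"
proof
  note fin = affine_frame_finite[OF assms(1)] finite_subset[OF assms(2) affine_frame_finite[OF assms(1)]]
  assume "x \<in> convex hull c"
  then obtain u where u: "\<forall>x\<in>c. 0 \<le> u x" "sum u c = 1" "(\<Sum>x\<in>c. u x *\<^sub>R x) = x"
    using convex_hull_finite[OF fin(2)] by auto
    note w = bary_subset_unique[OF assms u(2,3)]
  then show "(\<forall>p\<in>C. 0 \<le> bary C p x) \<and> (\<forall>p\<in>C - c. bary C p x = 0)"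
    using u w by auto
next
  note fin = affine_frame_finite[OF assms(1)] finite_subset[OF assms(2) affine_frame_finite[OF assms(1)]]
  assume R: "(\<forall>p\<in>C. 0 \<le> bary C p x) \<and> (\<forall>p\<in>C - c. bary C p x = 0)"
  have "(\<Sum>p\<in>c. bary C p x) = 1" "(\<Sum>p\<in>c. bary C p x *\<^sub>R p) = x"
    using sum.mono_neutral_left[of C c "\<lambda>p. bary C p x"]
      sum.mono_neutral_left[of C c "\<lambda>p. bary C p x *\<^sub>R p"] fin R assms bary_sums[OF assms(1), of x]
    by auto
  then show "x \<in> convex hull c"
    unfolding convex_hull_finite[OF fin(2)]
    by (intro CollectI exI[of _ "\<lambda>p. bary C p x"]) (use R assms(2) in auto)
qed

lemma rel_interior_convex_hull_bary:
  assumes "affine_frame C" "c \<subseteq> C"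
  shows "x \<in> rel_interior (convex hull c) \<longleftrightarrow>
    (\<forall>p\<in>c. 0 < bary C p x) \<and> (\<forall>p\<in>C - c. bary C p x = 0)"
proof -
  note fin = affine_frame_finite[OF assms(1)] finite_subset[OF assms(2) affine_frame_finite[OF assms(1)]]
  have ind: "\<not> affine_dependent c"
    using assms affine_independent_subset unfolding affine_frame_def by blast
  show ?thesis
  proof
    assume "x \<in> rel_interior (convex hull c)"
    then obtain u where u: "\<forall>x\<in>c. 0 < u x" "sum u c = 1" "(\<Sum>x\<in>c. u x *\<^sub>R x) = x"
      using rel_interior_convex_hull_explicit[OF ind] by auto
    note w = bary_subset_unique[OF assms u(2,3)]
    then show "(\<forall>p\<in>c. 0 < bary C p x) \<and> (\<forall>p\<in>C - c. bary C p x = 0)"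
      using u w assms(2) by auto
  next
    assume R: "(\<forall>p\<in>c. 0 < bary C p x) \<and> (\<forall>p\<in>C - c. bary C p x = 0)"
    have "(\<Sum>p\<in>c. bary C p x) = 1" "(\<Sum>p\<in>c. bary C p x *\<^sub>R p) = x"
      using sum.mono_neutral_left[of C c "\<lambda>p. bary C p x"]
        sum.mono_neutral_left[of C c "\<lambda>p. bary C p x *\<^sub>R p"] fin R assms bary_sums[OF assms(1), of x]
      by auto
    then show "x \<in> rel_interior (convex hull c)"
      using R unfolding rel_interior_convex_hull_explicit[OF ind] by auto
  qed
qed

lemma interior_convex_hull_bary:
  assumes "affine_frame C"
  shows "x \<in> interior (convex hull C) \<longleftrightarrow> (\<forall>p\<in>C. 0 < bary C p x)"
proof -
  have "rel_interior (convex hull C) = interior (convex hull C)"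
    by (rule rel_interior_interior) (simp add: affine_hull_convex_hull affine_frame_hull[OF assms])
  then show ?thesis using rel_interior_convex_hull_bary[OF assms, of C x] by auto
qed

lemma affine_frame_interior_nonempty:
  assumes "affine_frame C"
  shows "interior (convex hull C) \<noteq> {}"
proof -
  have f: "finite C" "card C = 4" using assms affine_frame_finite by (auto simp: affine_frame_def)
  have "bary C p (\<Sum>v\<in>C. (1/4) *\<^sub>R v) = 1/4" if "p \<in> C" for p
    by (rule bary_unique[OF assms _ _ that]) (auto simp: f)
  then show ?thesis
    using interior_convex_hull_bary[OF assms, of "\<Sum>v\<in>C. (1/4) *\<^sub>R v"] by fastforce
qed

section \<open>Tetrahedra and their faces\<close>

definition verts :: "(real^3) set \<Rightarrow> (real^3) set" where
  "verts S = {v. v extreme_point_of S}"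

lemma verts_convex_hull: "\<not> affine_dependent C \<Longrightarrow> verts (convex hull C) = C"
  unfolding verts_def by (simp add: extreme_point_of_convex_hull_affine_independent)

lemma simplex3_verts:
  assumes "3 simplex T"
  shows "affine_frame (verts T)" "convex hull (verts T) = T"
proof -
  obtain C where "\<not> affine_dependent C" "int (card C) = 4" "T = convex hull C"
    using assms unfolding simplex_def by auto
  then show "affine_frame (verts T)" "convex hull (verts T) = T"
    by (auto simp: verts_convex_hull affine_frame_def)
qed

lemma affine_frame_subset_independent:
  "affine_frame C \<Longrightarrow> c \<subseteq> C \<Longrightarrow> \<not> affine_dependent c"
  unfolding affine_frame_def using affine_independent_subset by blast

lemma verts_convex_hull_frame:
  "affine_frame C \<Longrightarrow> c \<subseteq> C \<Longrightarrow> verts (convex hull c) = c"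
  using affine_frame_subset_independent verts_convex_hull by blast

lemma face_of_simplex3:
  assumes "3 simplex T"
  shows "G face_of T \<longleftrightarrow> (\<exists>c\<subseteq>verts T. G = convex hull c)"
  using face_of_convex_hull_affine_independent[of "verts T" G] simplex3_verts[OF assms]
  unfolding affine_frame_def by auto

lemma facet_of_simplex3:
  assumes "3 simplex T"
  shows "F facet_of T \<longleftrightarrow> (\<exists>a\<in>verts T. F = convex hull (verts T - {a}))"
proof -
  have "verts T - {a} \<noteq> {}" if "a \<in> verts T" for a
  proof
    assume "verts T - {a} = {}"
    then have "verts T = {a}" using that by auto
    then show False using simplex3_verts(1)[OF assms] by (simp add: affine_frame_def)
  qed
  then show ?thesis
    using facet_of_convex_hull_affine_independent[of "verts T" F] simplex3_verts[OF assms]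
    unfolding affine_frame_def by (metis convex_hull_eq_empty)
qed

lemma edge_of_convex_hull:
  assumes "\<not> affine_dependent C"
  shows "e edge_of (convex hull C) \<longleftrightarrow> (\<exists>c\<subseteq>C. card c = 2 \<and> e = convex hull c)"
proof
  assume "e edge_of (convex hull C)"
  then have e: "e face_of (convex hull C)" "aff_dim e = 1" by (auto simp: edge_of_def)
  then obtain c where c: "c \<subseteq> C" "e = convex hull c"
    using face_of_convex_hull_affine_independent[OF assms] by auto
  have "\<not> affine_dependent c" using assms c affine_independent_subset by blast
  then have "card c = 2"
    using e c affine_independent_iff_card[of c] by (simp add: aff_dim_convex_hull)
  then show "\<exists>c\<subseteq>C. card c = 2 \<and> e = convex hull c" using c by blast
next
  assume "\<exists>c\<subseteq>C. card c = 2 \<and> e = convex hull c"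
  then obtain c where c: "c \<subseteq> C" "card c = 2" "e = convex hull c" by blast
  have "\<not> affine_dependent c" using assms c affine_independent_subset by blast
  then have "aff_dim e = 1"
    using c affine_independent_iff_card[of c] by (simp add: aff_dim_convex_hull)
  then show "e edge_of (convex hull C)"
    using c face_of_convex_hull_affine_independent[OF assms] by (auto simp: edge_of_def)
qed

lemma edge_of_simplex3:
  assumes "3 simplex T"
  shows "e edge_of T \<longleftrightarrow> (\<exists>c\<subseteq>verts T. card c = 2 \<and> e = convex hull c)"
  using edge_of_convex_hull[of "verts T" e] simplex3_verts[OF assms]
  unfolding affine_frame_def by auto

lemma verts_facet:
  assumes "3 simplex T" "F facet_of T"
  shows "verts F \<subseteq> verts T" "card (verts F) = 3" "finite (verts F)" "convex hull (verts F) = F"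
    "\<exists>a\<in>verts T. verts F = verts T - {a}"
proof -
  obtain a where a: "a \<in> verts T" "F = convex hull (verts T - {a})"
    using assms facet_of_simplex3 by blast
  have v: "verts F = verts T - {a}"
    unfolding a by (rule verts_convex_hull_frame[OF simplex3_verts(1)[OF assms(1)]]) auto
  show "verts F \<subseteq> verts T" "convex hull (verts F) = F" "\<exists>a\<in>verts T. verts F = verts T - {a}"
    using v a by auto
  show "finite (verts F)" "card (verts F) = 3"
    using simplex3_verts(1)[OF assms(1)] affine_frame_finite a unfolding v affine_frame_def
    by (auto simp: card_Diff_singleton)
qed

lemma verts_edge:
  assumes "3 simplex T" "e edge_of T"
  shows "verts e \<subseteq> verts T" "card (verts e) = 2" "convex hull (verts e) = e"
proof -
  obtain c where c: "c \<subseteq> verts T" "card c = 2" "e = convex hull c"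
    using assms edge_of_simplex3 by blast
  have v: "verts e = c"
    unfolding c by (rule verts_convex_hull_frame[OF simplex3_verts(1)[OF assms(1)] c(1)])
  then show "verts e \<subseteq> verts T" "card (verts e) = 2" "convex hull (verts e) = e"
    using c by auto
qed

lemma edge_of_facet:
  assumes "3 simplex T" "F facet_of T"
  shows "e edge_of F \<longleftrightarrow> (\<exists>m\<in>verts F. e = convex hull (verts F - {m}))"
proof -
  note v = verts_facet[OF assms]
  have ind: "\<not> affine_dependent (verts F)"
    using affine_frame_subset_independent[OF simplex3_verts(1)[OF assms(1)] v(1)] .
  have "(c \<subseteq> verts F \<and> card c = 2) \<longleftrightarrow> (\<exists>m\<in>verts F. c = verts F - {m})" for c
  proof
    assume c: "c \<subseteq> verts F \<and> card c = 2"
    then have "card (verts F - c) = 1"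
      using v by (subst card_Diff_subset) (auto intro: finite_subset)
    then obtain m where "verts F - c = {m}" using card_1_singletonE by blast
    then show "\<exists>m\<in>verts F. c = verts F - {m}" using c by blast
  next
    assume "\<exists>m\<in>verts F. c = verts F - {m}"
    then show "c \<subseteq> verts F \<and> card c = 2" using v by (auto simp: card_Diff_singleton)
  qed
  then show ?thesis
    using edge_of_convex_hull[OF ind, of e] v(4) by metis
qed

section \<open>Tetrahedral complexes\<close>

text \<open>Conforming meshes and Freudenthal triangulations have these properties in common. The intersection
  condition is what makes the barycentric coordinates of a point independent of the tetrahedron in which
  they are taken.\<close>

locale tet_complex =
  fixes \<Omega> :: "(real^3) set" and M :: "(real^3) set set"
  assumes open_\<Omega>: "open \<Omega>" and finite_M: "finite M"
    and simplex_M: "T \<in> M \<Longrightarrow> 3 simplex T"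
    and cover: "\<Union>M = closure \<Omega>"
    and Int_subset: "T \<in> M \<Longrightarrow> S \<in> M \<Longrightarrow> T \<inter> S \<subseteq> convex hull (verts T \<inter> verts S)"
begin

lemma frame: "T \<in> M \<Longrightarrow> affine_frame (verts T)"
  and hull_verts: "T \<in> M \<Longrightarrow> convex hull (verts T) = T"
  using simplex3_verts simplex_M by auto

lemma mem_interior_bary: "T \<in> M \<Longrightarrow> x \<in> interior T \<longleftrightarrow> (\<forall>p\<in>verts T. 0 < bary (verts T) p x)"
  using interior_convex_hull_bary[OF frame, of T x] by (simp add: hull_verts)

lemma finite_verts: "T \<in> M \<Longrightarrow> finite (verts T)"
  and card_verts: "T \<in> M \<Longrightarrow> card (verts T) = 4"
  using frame affine_frame_finite by (auto simp: affine_frame_def)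

lemma verts_inj: "T \<in> M \<Longrightarrow> S \<in> M \<Longrightarrow> verts T = verts S \<Longrightarrow> T = S"
  using hull_verts by metis

lemma verts_subset_eq: "T \<in> M \<Longrightarrow> S \<in> M \<Longrightarrow> verts T \<subseteq> verts S \<Longrightarrow> T = S"
  using verts_inj card_subset_eq[OF finite_verts] card_verts by metis

lemma M_subset_closure: "T \<in> M \<Longrightarrow> T \<subseteq> closure \<Omega>"
  using cover by auto

lemma mesh_vertices_eq: "mesh_vertices M = (\<Union>T\<in>M. verts T)"
  by (auto simp: mesh_vertices_def verts_def)

lemma finite_mesh_vertices: "finite (mesh_vertices M)"
  unfolding mesh_vertices_eq using finite_M finite_verts by auto

lemma mesh_faces_eq: "mesh_faces M = (\<Union>T\<in>M. (\<lambda>a. convex hull (verts T - {a})) ` verts T)"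
  unfolding mesh_faces_def by (auto simp: facet_of_simplex3[OF simplex_M])

lemma finite_mesh_faces: "finite (mesh_faces M)"
  unfolding mesh_faces_eq using finite_M finite_verts by auto

lemma mesh_edges_eq: "mesh_edges M = (\<Union>T\<in>M. (\<lambda>c. convex hull c) ` {c. c \<subseteq> verts T \<and> card c = 2})"
  unfolding mesh_edges_def by (auto simp: edge_of_simplex3[OF simplex_M])

lemma finite_mesh_edges: "finite (mesh_edges M)"
  unfolding mesh_edges_eq using finite_M finite_verts by auto

text \<open>The barycentric coordinate of \<open>x\<close> at the vertex \<open>p\<close> in any tetrahedron that contains \<open>x\<close>
  (and 0 if \<open>p\<close> is not one of its vertices): the value at \<open>x\<close> of the piecewise linear hat function
  of \<open>p\<close>.\<close>

definition coord :: "real^3 \<Rightarrow> real^3 \<Rightarrow> real" where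
  "coord x p = (let T = (SOME T. T \<in> M \<and> x \<in> T) in
     if x \<in> \<Union>M \<and> p \<in> verts T then bary (verts T) p x else 0)"

lemma coord_eq:
  assumes "T \<in> M" "x \<in> T"
  shows "coord x p = (if p \<in> verts T then bary (verts T) p x else 0)"
proof -
  define S where "S = (SOME T. T \<in> M \<and> x \<in> T)"
  have S: "S \<in> M" "x \<in> S"
    using someI[of "\<lambda>T. T \<in> M \<and> x \<in> T" T] assms by (auto simp: S_def)
  let ?c = "verts T \<inter> verts S"
  have "x \<in> convex hull ?c" using Int_subset assms S by blast
  then obtain u where u: "sum u ?c = 1" "(\<Sum>v\<in>?c. u v *\<^sub>R v) = x"
    using convex_hull_finite[of ?c] finite_verts[OF S(1)] by auto
  have "bary (verts T) p x = (if p \<in> ?c then u p else 0)" if "p \<in> verts T"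
    using bary_subset_unique[OF frame[OF assms(1)] _ u that] by auto
  moreover have "bary (verts S) p x = (if p \<in> ?c then u p else 0)" if "p \<in> verts S"
    using bary_subset_unique[OF frame[OF S(1)] _ u that] by auto
  moreover have "coord x p = (if p \<in> verts S then bary (verts S) p x else 0)"
    using assms unfolding coord_def S_def[symmetric] Let_def by auto
  ultimately show ?thesis by simp
qed

lemma coord_outside: "x \<notin> closure \<Omega> \<Longrightarrow> coord x p = 0"
  by (auto simp: coord_def cover Let_def)

lemma coord_nonneg: "0 \<le> coord x p"
proof (cases "x \<in> \<Union>M")
  case True
  then obtain T where T: "T \<in> M" "x \<in> T" by auto
  then have "x \<in> convex hull (verts T)" using hull_verts by simp
  then show ?thesis
    using convex_hull_subset_bary[OF frame[OF T(1)], of "verts T" x] coord_eq[OF T, of p] by auto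
qed (simp add: coord_def)

lemma continuous_on_coord: "continuous_on (closure \<Omega>) (\<lambda>x. coord x p)"
proof -
  have "continuous_on (\<Union>T\<in>M. T) (\<lambda>x. coord x p)"
  proof (rule continuous_on_closed_Union[OF finite_M])
    fix T assume T: "T \<in> M"
    show "closed T" using closed_simplex simplex_M T by blast
    have "continuous_on T (\<lambda>x. if p \<in> verts T then bary (verts T) p x else 0)"
      using affine_functional_continuous[OF affine_functional_bary[OF frame[OF T]]]
      by (cases "p \<in> verts T") auto
    then show "continuous_on T (\<lambda>x. coord x p)"
      using coord_eq[OF T] by (simp cong: continuous_on_cong)
  qed
  then show ?thesis using cover by simp
qed

text \<open>The set of vertices with positive coordinate determines the face in whose relative interior
  a point lies, whichever tetrahedron this face is taken from.\<close>

lemma coord_rel_interior: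
  assumes "T \<in> M" "c \<subseteq> verts T" "x \<in> rel_interior (convex hull c)"
  shows "x \<in> T" "0 < coord x p \<longleftrightarrow> p \<in> c"
proof -
  have "convex hull c \<subseteq> T" using hull_mono[OF assms(2), of convex] hull_verts[OF assms(1)] by simp
  then show x: "x \<in> T" using assms(3) rel_interior_subset by blast
  show "0 < coord x p \<longleftrightarrow> p \<in> c"
    using rel_interior_convex_hull_bary[OF frame[OF assms(1)] assms(2), of x] assms(2,3)
    unfolding coord_eq[OF assms(1) x] by (cases "p \<in> c"; cases "p \<in> verts T") auto
qed

lemma coord_zero_outside: "T \<in> M \<Longrightarrow> x \<in> T \<Longrightarrow> p \<notin> verts T \<Longrightarrow> coord x p = 0"
  by (simp add: coord_eq)

lemma coord_vertex: "q \<in> mesh_vertices M \<Longrightarrow> coord q p = (if p = q then 1 else 0)"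
proof -
  assume "q \<in> mesh_vertices M"
  then obtain T where T: "T \<in> M" "q \<in> verts T" by (auto simp: mesh_vertices_eq)
  then have "q \<in> T" using hull_verts[OF T(1)] hull_inc[of q "verts T" convex] by auto
  then show ?thesis using coord_eq[OF T(1)] bary_vertex[OF frame[OF T(1)] _ T(2)] T(2) by auto
qed


end


section \<open>Generic directions\<close>

lemma generic_direction:
  fixes A :: "'a::euclidean_space set"
  assumes "finite A" "0 \<notin> A"
  obtains u where "\<And>a. a \<in> A \<Longrightarrow> a \<bullet> u \<noteq> 0"
proof -
  have "negligible (\<Union>a\<in>A. {x. a \<bullet> x = 0})"
    using assms by (intro negligible_Union) (auto intro!: negligible_hyperplane)
  then have "(\<Union>a\<in>A. {x. a \<bullet> x = 0}) \<noteq> UNIV" by auto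
  then show ?thesis using that by blast
qed

text \<open>Barycentric coordinates are affine, so this difference is their derivative in direction \<open>u\<close>.\<close>

definition bary_slope :: "(real^3) set \<Rightarrow> real^3 \<Rightarrow> real^3 \<Rightarrow> real" where
  "bary_slope T p u = bary (verts T) p u - bary (verts T) p 0"

text \<open>A ray in direction \<open>u\<close> from a relative interior point of the face with vertex set \<open>c\<close> starts
  inside \<open>T\<close>.\<close>

definition enters :: "real^3 \<Rightarrow> (real^3) set \<Rightarrow> (real^3) set \<Rightarrow> bool" where
  "enters u T c \<longleftrightarrow> (\<forall>p\<in>verts T - c. 0 < bary_slope T p u)"

context tet_complex begin

lemma bary_line:
  "T \<in> M \<Longrightarrow> p \<in> verts T \<Longrightarrow> bary (verts T) p (x + t *\<^sub>R u) = bary (verts T) p x + t * bary_slope T p u"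
  unfolding bary_slope_def by (rule affine_functional_line[OF affine_functional_bary[OF frame]])

lemma sum_bary_slope: "T \<in> M \<Longrightarrow> (\<Sum>p\<in>verts T. bary_slope T p u) = 0"
  using sum_bary[OF frame] by (simp add: bary_slope_def sum_subtractf)

lemma bary_slope_minus: "T \<in> M \<Longrightarrow> p \<in> verts T \<Longrightarrow> bary_slope T p (- u) = - bary_slope T p u"
  using bary_line[of T p 0 "-1" u] by (simp add: bary_slope_def)

lemma generic_slopes:
  obtains u where "\<And>T p. T \<in> M \<Longrightarrow> p \<in> verts T \<Longrightarrow> bary_slope T p u \<noteq> 0"
proof -
  have "\<exists>a. a \<noteq> 0 \<and> (\<forall>u. bary_slope T p u = a \<bullet> u)" if T: "T \<in> M" "p \<in> verts T" for T p
  proof -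
    obtain a c where a: "\<And>x. bary (verts T) p x = a \<bullet> x + c"
      using affine_functional_bary[OF frame[OF T(1)] T(2)] unfolding affine_functional_def by auto
    have "verts T \<noteq> {p}" using card_verts[OF T(1)] by auto
    then obtain q where q: "q \<in> verts T" "q \<noteq> p" using T by auto
    have "a \<bullet> (p - q) = 1"
      using a[of p] a[of q] bary_vertex[OF frame[OF T(1)] T(2)] q T(2) by (simp add: inner_diff_right)
    then have "a \<noteq> 0" by auto
    then show ?thesis using a by (auto simp: bary_slope_def)
  qed
  then obtain a where a: "\<And>T p. T \<in> M \<Longrightarrow> p \<in> verts T \<Longrightarrow> a T p \<noteq> 0 \<and> (\<forall>u. bary_slope T p u = a T p \<bullet> u)"
    by metis
  obtain u where "\<And>v. v \<in> (\<Union>T\<in>M. a T ` verts T) \<Longrightarrow> v \<bullet> u \<noteq> 0"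
    by (rule generic_direction[of "\<Union>T\<in>M. a T ` verts T"]) (use finite_M finite_verts a in auto)
  then show ?thesis using that[of u] a by auto
qed

lemma enters_interior:
  assumes "T \<in> M" "c \<subseteq> verts T" "x \<in> rel_interior (convex hull c)" "enters u T c"
  shows "\<forall>\<^sub>F t in at_right 0. \<forall>p\<in>verts T. 0 < bary (verts T) p (x + t *\<^sub>R u)"
proof -
  note R = rel_interior_convex_hull_bary[OF frame[OF assms(1)] assms(2), of x]
  have "\<forall>\<^sub>F t in at_right 0. 0 < bary (verts T) p (x + t *\<^sub>R u)" if p: "p \<in> verts T" for p
  proof (cases "p \<in> c")
    case True
    have "((\<lambda>t. bary (verts T) p x + t * bary_slope T p u) \<longlongrightarrow> bary (verts T) p x + 0 * bary_slope T p u) (at_right 0)"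
      by (intro tendsto_intros)
    moreover have "0 < bary (verts T) p x" using R True assms(3) by auto
    ultimately show ?thesis
      using order_tendstoD(1)[of _ "bary (verts T) p x" _ 0] by (simp add: bary_line[OF assms(1) p])
  next
    case False
    then have "0 < bary_slope T p u" "bary (verts T) p x = 0"
      using assms(4) p R assms(3) by (auto simp: enters_def)
    then show ?thesis
      using eventually_at_right_less[of "0::real"]
      by (auto simp: bary_line[OF assms(1) p] elim!: eventually_mono)
  qed
  then show ?thesis by (intro eventually_ball_finite finite_verts assms) auto
qed

text \<open>Two tetrahedra that are both entered through the same face have a common interior point.\<close>

lemma enters_unique:
  assumes T: "T \<in> M" "c \<subseteq> verts T" "enters u T c" and S: "S \<in> M" "c \<subseteq> verts S" "enters u S c"
    and "c \<noteq> {}"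
  shows "T = S"
proof -
  obtain x where x: "x \<in> rel_interior (convex hull c)"
    using rel_interior_eq_empty[of "convex hull c"] assms(7) by auto
  have "\<forall>\<^sub>F t in at_right 0. (\<forall>p\<in>verts T. 0 < bary (verts T) p (x + t *\<^sub>R u)) \<and>
      (\<forall>p\<in>verts S. 0 < bary (verts S) p (x + t *\<^sub>R u))"
    using enters_interior[OF T(1,2) x T(3)] enters_interior[OF S(1,2) x S(3)]
    by eventually_elim auto
  then obtain t where t: "\<forall>p\<in>verts T. 0 < bary (verts T) p (x + t *\<^sub>R u)"
      "\<forall>p\<in>verts S. 0 < bary (verts S) p (x + t *\<^sub>R u)"
    using eventually_happens'[OF trivial_limit_at_right_real] by blast
  let ?y = "x + t *\<^sub>R u"
  have y: "?y \<in> T" "?y \<in> S"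
    using t mem_interior_bary[OF T(1)] mem_interior_bary[OF S(1)] interior_subset by blast+
  have "verts T \<subseteq> verts S"
  proof
    fix p assume "p \<in> verts T"
    then have "0 < coord ?y p" using t coord_eq[OF T(1) y(1)] by auto
    then show "p \<in> verts S" using coord_eq[OF S(1) y(2), of p] by (auto split: if_splits)
  qed
  then show ?thesis using verts_subset_eq T S by blast
qed

definition opp :: "(real^3) set \<Rightarrow> (real^3) set \<Rightarrow> real^3" where
  "opp T F = (SOME a. a \<in> verts T \<and> verts F = verts T - {a})"

lemma opp:
  assumes "T \<in> M" "F facet_of T"
  shows "opp T F \<in> verts T" "verts F = verts T - {opp T F}"
  using someI_ex[of "\<lambda>a. a \<in> verts T \<and> verts F = verts T - {a}"]
    verts_facet(5)[OF simplex_M[OF assms(1)] assms(2)] unfolding opp_def by blast+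

lemma enters_facet:
  assumes "T \<in> M" "F facet_of T"
  shows "enters u T (verts F) \<longleftrightarrow> 0 < bary_slope T (opp T F) u"
proof -
  have "verts T - verts F = {opp T F}"
    unfolding opp(2)[OF assms] using opp(1)[OF assms] by blast
  then show ?thesis by (simp add: enters_def)
qed

text \<open>A tetrahedron with facet \<open>F\<close> is entered through \<open>F\<close> along \<open>u\<close> or along \<open>- u\<close>, and each of these
  directions admits only one.\<close>

lemma card_facet_le_2: "card {T\<in>M. F facet_of T} \<le> 2"
proof -
  obtain u where u: "\<And>T p. T \<in> M \<Longrightarrow> p \<in> verts T \<Longrightarrow> bary_slope T p u \<noteq> 0"
    using generic_slopes by blast
  have "inj_on (\<lambda>T. 0 < bary_slope T (opp T F) u) {T\<in>M. F facet_of T}"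
  proof (rule inj_onI; clarify)
    fix T S assume T: "T \<in> M" "F facet_of T" and S: "S \<in> M" "F facet_of S"
      and eq: "(0 < bary_slope T (opp T F) u) = (0 < bary_slope S (opp S F) u)"
    note vT = verts_facet[OF simplex_M[OF T(1)] T(2)] and vS = verts_facet[OF simplex_M[OF S(1)] S(2)]
    have ne: "verts F \<noteq> {}" using vT(2) by auto
    show "T = S"
    proof (cases "0 < bary_slope T (opp T F) u")
      case True
      show ?thesis
        by (rule enters_unique[OF T(1) vT(1) _ S(1) vS(1) _ ne, of u])
           (use True eq enters_facet[OF T] enters_facet[OF S] in simp_all)
    next
      case False
      then have "0 < bary_slope T (opp T F) (-u)" "0 < bary_slope S (opp S F) (-u)"
        using u[OF T(1) opp(1)[OF T]] u[OF S(1) opp(1)[OF S]] eq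
          bary_slope_minus[OF T(1) opp(1)[OF T], of u] bary_slope_minus[OF S(1) opp(1)[OF S], of u]
        by auto
      then show ?thesis
        by (intro enters_unique[OF T(1) vT(1) _ S(1) vS(1) _ ne, of "-u"])
           (simp_all add: enters_facet[OF T] enters_facet[OF S])
    qed
  qed
  then have "card {T\<in>M. F facet_of T} \<le> card (UNIV :: bool set)"
    by (rule card_inj_on_le) auto
  then show ?thesis by simp
qed

lemma facet_in_mesh_faces: "T \<in> M \<Longrightarrow> F facet_of T \<Longrightarrow> F \<in> mesh_faces M"
  by (auto simp: mesh_faces_def)

lemma facet_verts:
  assumes "T \<in> M" "F facet_of T"
  shows "verts F \<subseteq> verts T" "card (verts F) = 3" "finite (verts F)" "convex hull (verts F) = F"
  using verts_facet[OF simplex_M[OF assms(1)] assms(2)] by auto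

lemma verts_nonempty: "T \<in> M \<Longrightarrow> verts T \<noteq> {}"
  using card_verts[of T] by auto

lemma opp_notin: "T \<in> M \<Longrightarrow> F facet_of T \<Longrightarrow> opp T F \<notin> verts F"
  using opp(2)[of T F] by simp

lemma verts_insert_opp: "T \<in> M \<Longrightarrow> F facet_of T \<Longrightarrow> verts T = insert (opp T F) (verts F)"
  using opp[of T F] by auto

lemma facet_if_verts_subset:
  assumes "T \<in> M" "S \<in> M" "F facet_of S" "verts F \<subseteq> verts T"
  shows "F facet_of T"
proof -
  note v = facet_verts[OF assms(2,3)]
  have "card (verts T - verts F) = 1"
    using v assms card_verts by (simp add: card_Diff_subset)
  then obtain a where "verts T - verts F = {a}" using card_1_singletonE by blast
  then have "a \<in> verts T" "verts F = verts T - {a}" using assms(4) by auto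
  then show ?thesis using facet_of_simplex3[OF simplex_M[OF assms(1)]] v(4) by metis
qed

lemma mesh_face_verts:
  assumes "F \<in> mesh_faces M"
  shows "card (verts F) = 3" "finite (verts F)" "convex hull (verts F) = F" "verts F \<subseteq> mesh_vertices M"
proof -
  obtain T where T: "T \<in> M" "F facet_of T" using assms by (auto simp: mesh_faces_def)
  show "card (verts F) = 3" "finite (verts F)" "convex hull (verts F) = F" "verts F \<subseteq> mesh_vertices M"
    using facet_verts[OF T] T mesh_vertices_eq by auto
qed

end

section \<open>Hat functions of a Worsey--Farin split\<close>

lemma continuous_on_Min:
  fixes f :: "'i \<Rightarrow> 'a::topological_space \<Rightarrow> real"
  assumes "finite I" "I \<noteq> {}" "\<And>i. i \<in> I \<Longrightarrow> continuous_on S (f i)"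
  shows "continuous_on S (\<lambda>x. Min ((\<lambda>i. f i x) ` I))"
  using assms
proof (induction I rule: finite_ne_induct)
  case (insert i I)
  have "Min ((\<lambda>j. f j x) ` insert i I) = min (f i x) (Min ((\<lambda>j. f j x) ` I))" for x
    using insert by simp
  then show ?case using insert by (auto intro!: continuous_on_min)
qed simp

locale WF_complex = tet_complex +
  fixes z y :: "(real^3) set \<Rightarrow> real^3"
  assumes z_interior: "T \<in> M \<Longrightarrow> z T \<in> interior T"
    and y_rel_interior: "F \<in> mesh_faces M \<Longrightarrow> y F \<in> rel_interior F"
    and z_y_z: "T \<in> M \<Longrightarrow> S \<in> M \<Longrightarrow> T \<noteq> S \<Longrightarrow> F facet_of T \<Longrightarrow> F facet_of S \<Longrightarrow>
      closed_segment (z T) (z S) \<inter> F = {y F}"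
begin

lemma coord_z: "T \<in> M \<Longrightarrow> 0 < coord (z T) p \<longleftrightarrow> p \<in> verts T"
  using coord_rel_interior(2)[of T "verts T" "z T" p] z_interior[of T] hull_verts[of T]
    interior_subset_rel_interior by auto

lemma z_in: "T \<in> M \<Longrightarrow> z T \<in> T"
  using z_interior interior_subset by blast

lemma coord_y: "T \<in> M \<Longrightarrow> F facet_of T \<Longrightarrow> 0 < coord (y F) p \<longleftrightarrow> p \<in> verts F"
  using coord_rel_interior(2)[of T "verts F" "y F" p] y_rel_interior[of F] facet_verts[of T F]
    facet_in_mesh_faces by auto

lemma coord_y': "F \<in> mesh_faces M \<Longrightarrow> 0 < coord (y F) p \<longleftrightarrow> p \<in> verts F"
  using coord_y by (auto simp: mesh_faces_def)

lemma coord_y_eq_0: "F \<in> mesh_faces M \<Longrightarrow> p \<notin> verts F \<Longrightarrow> coord (y F) p = 0"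
  using coord_y'[of F p] coord_nonneg[of "y F" p] by auto

lemma coord_z_eq_0: "T \<in> M \<Longrightarrow> p \<notin> verts T \<Longrightarrow> coord (z T) p = 0"
  using coord_z[of T p] coord_nonneg[of "z T" p] by auto

lemma y_in: "F \<in> mesh_faces M \<Longrightarrow> y F \<in> F"
  using y_rel_interior rel_interior_subset by blast

definition hat_z :: "(real^3) set \<Rightarrow> real^3 \<Rightarrow> real" where
  "hat_z T x = Min ((\<lambda>p. coord x p / coord (z T) p) ` verts T)"

text \<open>The subtracted sum removes from the face coordinates the contribution of the interior point on
  either side of \<open>F\<close>; a point of a tetrahedron with facet \<open>F\<close> sees at most one nonzero summand.\<close>

definition hat_y :: "(real^3) set \<Rightarrow> real^3 \<Rightarrow> real" where
  "hat_y F x = max 0 (Min ((\<lambda>i. (coord x i - (\<Sum>T | T \<in> M \<and> F facet_of T.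
      coord x (opp T F) * (coord (z T) i / coord (z T) (opp T F)))) / coord (y F) i) ` verts F))"

text \<open>The piecewise linear hat function of the mesh, corrected so as to vanish at the new nodes.\<close>

definition hat_vertex :: "real^3 \<Rightarrow> real^3 \<Rightarrow> real" where
  "hat_vertex p x = coord x p - (\<Sum>T\<in>M. coord (z T) p * hat_z T x)
     - (\<Sum>F\<in>mesh_faces M. coord (y F) p * hat_y F x)"

definition split_nodes :: "(real^3) set" where
  "split_nodes = mesh_vertices M \<union> y ` mesh_faces M \<union> z ` M"

definition hat :: "real^3 \<Rightarrow> real^3 \<Rightarrow> real" where
  "hat q = (if q \<in> mesh_vertices M then hat_vertex q
            else if q \<in> y ` mesh_faces M then hat_y (inv_into (mesh_faces M) y q)
            else hat_z (inv_into M z q))"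

text \<open>A cell of the split is given by a tetrahedron \<open>T\<close>, a facet \<open>F\<close> of \<open>T\<close> and the vertex \<open>m\<close> of
  \<open>F\<close> opposite to the edge that the cell contains.\<close>

definition cells :: "((real^3) set \<times> (real^3) set \<times> (real^3)) set" where
  "cells = {(T, F, m). T \<in> M \<and> F facet_of T \<and> m \<in> verts F}"

definition cell_nodes :: "(real^3) set \<times> (real^3) set \<times> (real^3) \<Rightarrow> (real^3) set" where
  "cell_nodes K = (case K of (T, F, m) \<Rightarrow> insert (z T) (insert (y F) (verts F - {m})))"

abbreviation cell :: "(real^3) set \<times> (real^3) set \<times> (real^3) \<Rightarrow> (real^3) set" where
  "cell K \<equiv> convex hull (cell_nodes K)"

lemma cellsD: "(T, F, m) \<in> cells \<Longrightarrow> T \<in> M \<and> F facet_of T \<and> m \<in> verts F \<and> F \<in> mesh_faces M"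
  using facet_in_mesh_faces by (auto simp: cells_def)

lemma inj_z: "inj_on z M"
proof (rule inj_onI)
  fix T S assume TS: "T \<in> M" "S \<in> M" "z T = z S"
  have "p \<in> verts T \<longleftrightarrow> p \<in> verts S" for p
    using coord_z[OF TS(1), of p] coord_z[OF TS(2), of p] unfolding TS(3) by metis
  then have "verts T = verts S" by (rule set_eqI)
  then show "T = S" using TS verts_inj by auto
qed

lemma inj_y: "inj_on y (mesh_faces M)"
proof (rule inj_onI)
  fix F G assume FG: "F \<in> mesh_faces M" "G \<in> mesh_faces M" "y F = y G"
  have "p \<in> verts F \<longleftrightarrow> p \<in> verts G" for p
    using coord_y'[OF FG(1), of p] coord_y'[OF FG(2), of p] unfolding FG(3) by metis
  then have "verts F = verts G" by (rule set_eqI)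
  then show "F = G" using mesh_face_verts(3)[OF FG(1)] mesh_face_verts(3)[OF FG(2)] by metis
qed

lemma coord_support_card:
  shows "q \<in> mesh_vertices M \<Longrightarrow> card {p. 0 < coord q p} = 1"
    and "F \<in> mesh_faces M \<Longrightarrow> card {p. 0 < coord (y F) p} = 3"
    and "T \<in> M \<Longrightarrow> card {p. 0 < coord (z T) p} = 4"
proof -
  show "card {p. 0 < coord q p} = 1" if "q \<in> mesh_vertices M"
  proof -
    have "{p. 0 < coord q p} = {q}" using coord_vertex[OF that] by auto
    then show ?thesis by simp
  qed
  show "card {p. 0 < coord (y F) p} = 3" if "F \<in> mesh_faces M"
    using coord_y'[OF that] mesh_face_verts(1)[OF that] by simp
  show "card {p. 0 < coord (z T) p} = 4" if "T \<in> M"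
    using coord_z[OF that] card_verts[OF that] by simp
qed

lemma nodes_disjoint:
  shows "mesh_vertices M \<inter> y ` mesh_faces M = {}" "mesh_vertices M \<inter> z ` M = {}"
    "y ` mesh_faces M \<inter> z ` M = {}"
proof -
  have "False" if "q \<in> mesh_vertices M" "F \<in> mesh_faces M" "q = y F" for q F
    using coord_support_card(1)[OF that(1)] coord_support_card(2)[OF that(2)] that(3) by simp
  then show "mesh_vertices M \<inter> y ` mesh_faces M = {}" by auto
  have "False" if "q \<in> mesh_vertices M" "T \<in> M" "q = z T" for q T
    using coord_support_card(1)[OF that(1)] coord_support_card(3)[OF that(2)] that(3) by simp
  then show "mesh_vertices M \<inter> z ` M = {}" by auto
  have "False" if "F \<in> mesh_faces M" "T \<in> M" "y F = z T" for F T
    using coord_support_card(2)[OF that(1)] coord_support_card(3)[OF that(2)] that(3) by simp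
  then show "y ` mesh_faces M \<inter> z ` M = {}" by auto
qed

lemma hat_simps:
  shows "q \<in> mesh_vertices M \<Longrightarrow> hat q = hat_vertex q"
    and "F \<in> mesh_faces M \<Longrightarrow> hat (y F) = hat_y F"
    and "T \<in> M \<Longrightarrow> hat (z T) = hat_z T"
  using nodes_disjoint inv_into_f_f[OF inj_y] inv_into_f_f[OF inj_z] by (auto simp: hat_def)

lemma cell_nodes_distinct:
  assumes "(T, F, m) \<in> cells"
  shows "z T \<notin> verts F" "y F \<notin> verts F" "z T \<noteq> y F"
  using nodes_disjoint cellsD[OF assms] mesh_face_verts(4)[of F] by auto

lemma finite_cell_nodes: "K \<in> cells \<Longrightarrow> finite (cell_nodes K)"
  and card_cell_nodes: "K \<in> cells \<Longrightarrow> card (cell_nodes K) = 4"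
proof -
  have *: "finite (cell_nodes K) \<and> card (cell_nodes K) = 4" if K: "K \<in> cells"
  proof (cases K)
    case (fields T F m)
    note d = cell_nodes_distinct[OF K[unfolded fields]] and c = cellsD[OF K[unfolded fields]]
    have "card (verts F - {m}) = 2" "finite (verts F)"
      using c mesh_face_verts(1,2)[of F] by (auto simp: card_Diff_singleton)
    then show ?thesis using d by (auto simp: fields cell_nodes_def)
  qed
  then show "K \<in> cells \<Longrightarrow> finite (cell_nodes K)" "K \<in> cells \<Longrightarrow> card (cell_nodes K) = 4" by auto
qed

lemma cell_nodes_subset: "K \<in> cells \<Longrightarrow> cell_nodes K \<subseteq> split_nodes"
  using cellsD mesh_face_verts(4) by (cases K) (fastforce simp: cell_nodes_def split_nodes_def)

lemma cell_subset:
  assumes "(T, F, m) \<in> cells"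
  shows "cell (T, F, m) \<subseteq> T"
proof -
  note c = cellsD[OF assms]
  have "verts F \<subseteq> T" using facet_verts(1)[of T F] c hull_verts[of T] hull_subset[of "verts T" convex] by auto
  moreover have "y F \<in> T" using y_in c facet_of_imp_subset by blast
  ultimately have "cell_nodes (T, F, m) \<subseteq> T" using z_in c by (auto simp: cell_nodes_def)
  then show ?thesis using convex_simplex[OF simplex_M[of T]] c by (intro hull_minimal) auto
qed

lemma hat_z_nonneg: "T \<in> M \<Longrightarrow> 0 \<le> hat_z T x"
  unfolding hat_z_def using finite_verts[of T] verts_nonempty[of T] coord_nonneg
  by (subst Min_ge_iff) auto

lemma hat_z_other:
  assumes "T \<in> M" "S \<in> M" "S \<noteq> T" "x \<in> T"
  shows "hat_z S x = 0"
proof -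
  obtain p where p: "p \<in> verts S" "p \<notin> verts T" using verts_subset_eq assms by blast
  then have "coord x p = 0" using coord_zero_outside assms by blast
  then have "hat_z S x \<le> 0"
    unfolding hat_z_def using p by (intro Min_le finite_imageI finite_verts assms) force
  then show ?thesis using hat_z_nonneg[OF assms(2), of x] by simp
qed

lemma hat_y_eq_0:
  assumes "i \<in> verts F" "F \<in> mesh_faces M" "coord x i \<le> (\<Sum>T | T \<in> M \<and> F facet_of T.
      coord x (opp T F) * (coord (z T) i / coord (z T) (opp T F)))"
  shows "hat_y F x = 0"
proof -
  let ?f = "\<lambda>i. (coord x i - (\<Sum>T | T \<in> M \<and> F facet_of T.
      coord x (opp T F) * (coord (z T) i / coord (z T) (opp T F)))) / coord (y F) i"
  have "0 < coord (y F) i" using coord_y'[OF assms(2)] assms(1) by simp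
  then have "?f i \<le> 0" using assms(3) by (simp add: divide_nonpos_pos)
  moreover have "Min (?f ` verts F) \<le> ?f i"
    using assms(1) mesh_face_verts(2)[OF assms(2)] by (intro Min_le) auto
  ultimately show ?thesis by (simp add: hat_y_def)
qed

lemma hat_y_sum:
  assumes "T \<in> M" "F facet_of T" "x \<in> T"
  shows "(\<Sum>S | S \<in> M \<and> F facet_of S. coord x (opp S F) * (coord (z S) i / coord (z S) (opp S F)))
    = coord x (opp T F) * (coord (z T) i / coord (z T) (opp T F))"
proof -
  have "(\<Sum>S | S \<in> M \<and> F facet_of S. coord x (opp S F) * (coord (z S) i / coord (z S) (opp S F)))
    = (\<Sum>S\<in>{T}. coord x (opp S F) * (coord (z S) i / coord (z S) (opp S F)))"
  proof (rule sum.mono_neutral_right)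
    show "\<forall>S\<in>{S. S \<in> M \<and> F facet_of S} - {T}.
        coord x (opp S F) * (coord (z S) i / coord (z S) (opp S F)) = 0"
    proof
      fix S assume "S \<in> {S. S \<in> M \<and> F facet_of S} - {T}"
      then have S: "S \<in> M" "F facet_of S" "S \<noteq> T" by auto
      have "opp S F \<notin> verts T"
      proof
        assume "opp S F \<in> verts T"
        then have "verts S \<subseteq> verts T"
          using verts_insert_opp[OF S(1,2)] facet_verts(1)[OF assms(1,2)] by auto
        then show False using verts_subset_eq S assms(1) by blast
      qed
      then show "coord x (opp S F) * (coord (z S) i / coord (z S) (opp S F)) = 0"
        using coord_zero_outside[OF assms(1,3)] by simp
    qed
  qed (use assms finite_M in auto)
  then show ?thesis by simp
qed

text \<open>On a cell the hat functions of its nodes are its barycentric coordinates and all others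
  vanish. For \<open>hat_z\<close> the minimum is attained at the vertex opposite to \<open>F\<close>, for \<open>hat_y F\<close> at \<open>m\<close>.\<close>

lemma hat_combination:
  assumes K: "(T, F, m) \<in> cells"
    and w: "\<forall>q\<in>cell_nodes (T, F, m). 0 \<le> w q" "sum w (cell_nodes (T, F, m)) = 1"
    and x: "x = (\<Sum>q\<in>cell_nodes (T, F, m). w q *\<^sub>R q)"
    and q: "q \<in> split_nodes"
  shows "hat q x = (if q \<in> cell_nodes (T, F, m) then w q else 0)"
proof -
  note c = cellsD[OF K] and d = cell_nodes_distinct[OF K]
  have T: "T \<in> M" and F: "F facet_of T" and m: "m \<in> verts F" and FM: "F \<in> mesh_faces M"
    using c by auto
  note fv = facet_verts[OF T F]
  define E where "E = verts F - {m}"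
  have N: "cell_nodes (T, F, m) = insert (z T) (insert (y F) E)"
    by (simp add: cell_nodes_def E_def)
  have dE: "finite E" "z T \<notin> insert (y F) E" "y F \<notin> E" using d fv by (auto simp: E_def)
  define ov where "ov = opp T F"
  have ov: "ov \<in> verts T" "verts T = insert ov (verts F)" "ov \<notin> verts F"
    using opp(1)[OF T F] verts_insert_opp[OF T F] opp_notin[OF T F] by (auto simp: ov_def)
  define a b where "a = w (z T)" and "b = w (y F)"
  have ab: "0 \<le> a" "0 \<le> b" using w(1) by (auto simp: N a_def b_def)
  have xT: "x \<in> T"
  proof -
    have "x \<in> cell (T, F, m)"
      using w x convex_hull_finite[OF finite_cell_nodes[OF K]] by auto
    then show ?thesis using cell_subset[OF K] by auto
  qed
  have ET: "E \<subseteq> verts T" using fv by (auto simp: E_def)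
  define cc where "cc r = (if r \<in> E then w r else 0)" for r
  have cc: "0 \<le> cc r" for r using w(1) by (auto simp: N cc_def)
  have yT: "y F \<in> T" using y_in[OF FM] facet_of_imp_subset[OF F] by auto
  have cx: "coord x r = a * coord (z T) r + b * coord (y F) r + cc r" for r
  proof (cases "r \<in> verts T")
    case True
    have "bary (verts T) r x = (\<Sum>q\<in>cell_nodes (T, F, m). w q * bary (verts T) r q)"
      unfolding x using affine_functional_combination[OF affine_functional_bary[OF frame[OF T] True] w(2)]
      by simp
    also have "\<dots> = a * bary (verts T) r (z T) + (b * bary (verts T) r (y F) +
        (\<Sum>q\<in>E. w q * bary (verts T) r q))"
      using dE by (simp add: N a_def b_def)
    also have "(\<Sum>q\<in>E. w q * bary (verts T) r q) = (\<Sum>q\<in>E. if q = r then w q else 0)"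
      using ET by (intro sum.cong) (auto simp: bary_vertex[OF frame[OF T] True])
    also have "\<dots> = cc r" using dE by (simp add: cc_def)
    finally show ?thesis
      using True coord_eq[OF T xT] coord_eq[OF T z_in[OF T]] coord_eq[OF T yT] by simp
  next
    case False
    then show ?thesis
      using coord_zero_outside[OF T xT] coord_z_eq_0[OF T] coord_zero_outside[OF T yT] ET
      by (auto simp: cc_def)
  qed
  have zpos: "0 < coord (z T) p" if "p \<in> verts T" for p using coord_z[OF T] that by simp
  have yo: "coord (y F) ov = 0" using coord_y_eq_0[OF FM] ov by simp
  have cco: "cc ov = 0" "cc m = 0" using ov m by (auto simp: cc_def E_def)
  have hz: "hat_z T x = a"
    unfolding hat_z_def
  proof (rule Min_eqI)
    show "finite ((\<lambda>p. coord x p / coord (z T) p) ` verts T)" using finite_verts[OF T] by simp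
    show "a \<in> (\<lambda>p. coord x p / coord (z T) p) ` verts T"
    proof (rule image_eqI[of _ _ ov])
      show "a = coord x ov / coord (z T) ov" using zpos[OF ov(1)] by (simp add: cx yo cco)
    qed (rule ov)
    fix t assume "t \<in> (\<lambda>p. coord x p / coord (z T) p) ` verts T"
    then obtain p where p: "p \<in> verts T" "t = coord x p / coord (z T) p" by auto
    have "a * coord (z T) p \<le> coord x p"
      using ab cc[of p] coord_nonneg[of "y F" p] by (simp add: cx)
    then show "a \<le> t" using zpos[OF p(1)] p(2) by (simp add: pos_le_divide_eq)
  qed
  have hz': "hat_z S x = 0" if "S \<in> M" "S \<noteq> T" for S
    using hat_z_other[OF T that(1,2) xT] .
  have cxo: "coord x ov * (coord (z T) i / coord (z T) ov) = a * coord (z T) i" for i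
    using zpos[OF ov(1)] by (simp add: cx yo cco)
  have hy: "hat_y F x = b"
  proof -
    let ?f = "\<lambda>i. (coord x i - (\<Sum>S | S \<in> M \<and> F facet_of S.
      coord x (opp S F) * (coord (z S) i / coord (z S) (opp S F)))) / coord (y F) i"
    have f: "?f i = (b * coord (y F) i + cc i) / coord (y F) i" for i
      unfolding hat_y_sum[OF T F xT] ov_def[symmetric] cxo by (simp add: cx)
    have yp: "0 < coord (y F) i" if "i \<in> verts F" for i using coord_y[OF T F] that by simp
    have "Min (?f ` verts F) = b"
    proof (rule Min_eqI)
      show "finite (?f ` verts F)" using fv by simp
      show "b \<in> ?f ` verts F"
        by (rule image_eqI[of _ _ m]) (use m yp[OF m] in \<open>simp_all only: f cco, simp\<close>)
      fix t assume "t \<in> ?f ` verts F"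
      then obtain p where p: "p \<in> verts F" "t = (b * coord (y F) p + cc p) / coord (y F) p"
        unfolding f by auto
      then show "b \<le> t" using yp[OF p(1)] cc[of p] by (simp add: pos_le_divide_eq)
    qed
    then show ?thesis using ab by (simp add: hat_y_def)
  qed
  have hy': "hat_y G x = 0" if G: "G \<in> mesh_faces M" "G \<noteq> F" for G
  proof (cases "G facet_of T")
    case True
    have ne: "verts G \<noteq> verts F" using mesh_face_verts(3)[OF G(1)] mesh_face_verts(3)[OF FM] G(2) by metis
    let ?ov' = "opp T G"
    have vG: "verts G = verts T - {?ov'}" "?ov' \<in> verts T" using opp[OF T True] by auto
    have oG: "ov \<in> verts G" using ne vG ov by auto
    show ?thesis
    proof (rule hat_y_eq_0[OF oG G(1)])
      have "coord x ov = a * coord (z T) ov" by (simp add: cx yo cco)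
      also have "\<dots> = a * coord (z T) ?ov' * (coord (z T) ov / coord (z T) ?ov')"
        using zpos[OF vG(2)] by simp
      also have "\<dots> \<le> coord x ?ov' * (coord (z T) ov / coord (z T) ?ov')"
        using ab cc[of ?ov'] coord_nonneg[of "y F" ?ov'] zpos[OF vG(2)] zpos[OF ov(1)]
        by (intro mult_right_mono) (auto simp: cx)
      finally show "coord x ov \<le> (\<Sum>S | S \<in> M \<and> G facet_of S.
          coord x (opp S G) * (coord (z S) ov / coord (z S) (opp S G)))"
        unfolding hat_y_sum[OF T True xT] .
    qed
  next
    case False
    obtain S where S: "S \<in> M" "G facet_of S" using G by (auto simp: mesh_faces_def)
    obtain i where i: "i \<in> verts G" "i \<notin> verts T"
      using facet_if_verts_subset[OF T S] False by blast
    show ?thesis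
      by (rule hat_y_eq_0[OF i(1) G(1)])
         (use coord_zero_outside[OF T xT i(2)] in \<open>auto intro!: sum_nonneg coord_nonneg mult_nonneg_nonneg divide_nonneg_nonneg\<close>)
  qed
  have hv: "hat_vertex p x = cc p" for p
  proof -
    have "(\<Sum>S\<in>M. coord (z S) p * hat_z S x) = (\<Sum>S\<in>{T}. coord (z S) p * hat_z S x)"
      by (rule sum.mono_neutral_right) (use T hz' finite_M in auto)
    moreover have "(\<Sum>G\<in>mesh_faces M. coord (y G) p * hat_y G x) = (\<Sum>G\<in>{F}. coord (y G) p * hat_y G x)"
      by (rule sum.mono_neutral_right) (use FM hy' finite_mesh_faces in auto)
    ultimately show ?thesis by (simp add: hat_vertex_def hz hy cx)
  qed
  from q consider (v) "q \<in> mesh_vertices M" | (y) G where "G \<in> mesh_faces M" "q = y G"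
    | (z) S where "S \<in> M" "q = z S" by (auto simp: split_nodes_def)
  then show ?thesis
  proof cases
    case v
    have "q \<noteq> z T" "q \<noteq> y F" using v nodes_disjoint T FM by auto
    then show ?thesis by (simp add: hat_simps v hv N cc_def)
  next
    case y
    have "q \<notin> E" "q \<noteq> z T" "q = y F \<longleftrightarrow> G = F"
      using y nodes_disjoint T FM mesh_face_verts(4)[OF FM] inj_y by (auto simp: E_def inj_on_eq_iff)
    then show ?thesis using hy hy' y by (auto simp: hat_simps N b_def)
  next
    case z
    have "q \<notin> E" "q \<noteq> y F" "q = z T \<longleftrightarrow> S = T"
      using z nodes_disjoint T FM mesh_face_verts(4)[OF FM] inj_z by (auto simp: E_def inj_on_eq_iff)
    then show ?thesis using hz hz' z by (auto simp: hat_simps N a_def)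
  qed
qed

lemma continuous_on_hat: "q \<in> split_nodes \<Longrightarrow> continuous_on (closure \<Omega>) (hat q)"
proof -
  have z: "continuous_on (closure \<Omega>) (hat_z T)" if "T \<in> M" for T
    unfolding hat_z_def[abs_def] using card_verts[OF that] coord_z[OF that]
    by (intro continuous_on_Min continuous_intros continuous_on_coord finite_verts that) force+
  have y: "continuous_on (closure \<Omega>) (hat_y F)" if "F \<in> mesh_faces M" for F
    unfolding hat_y_def[abs_def] using mesh_face_verts[OF that] coord_y'[OF that]
    by (intro continuous_on_max continuous_on_Min continuous_intros continuous_on_coord) force+
  have v: "continuous_on (closure \<Omega>) (hat_vertex p)" for p
    unfolding hat_vertex_def[abs_def]
    by (intro continuous_intros continuous_on_coord z y)
  assume "q \<in> split_nodes"
  then show ?thesis unfolding split_nodes_def using v y z by (auto simp: hat_simps)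
qed

lemma hat_outside: "x \<notin> closure \<Omega> \<Longrightarrow> q \<in> split_nodes \<Longrightarrow> hat q x = 0"
proof -
  assume x: "x \<notin> closure \<Omega>" "q \<in> split_nodes"
  have z: "hat_z T x = 0" if "T \<in> M" for T
  proof -
    have "(\<lambda>p. coord x p / coord (z T) p) ` verts T = {0}"
      using coord_outside[OF x(1)] verts_nonempty[OF that] by auto
    then show ?thesis by (simp add: hat_z_def)
  qed
  have y: "hat_y F x = 0" if "F \<in> mesh_faces M" for F
  proof -
    have "verts F \<noteq> {}" using mesh_face_verts(1)[OF that] by auto
    then obtain i where "i \<in> verts F" by auto
    then show ?thesis by (rule hat_y_eq_0[OF _ that]) (simp add: coord_outside[OF x(1)])
  qed
  show ?thesis
    using x(2) z y coord_outside[OF x(1)] by (auto simp: split_nodes_def hat_simps hat_vertex_def)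
qed

text \<open>The hat functions read off the coefficients of a convex combination of the nodes of a cell, so
  these coefficients are unique.\<close>

lemma cell_frame: "K \<in> cells \<Longrightarrow> affine_frame (cell_nodes K)"
proof -
  assume K: "K \<in> cells"
  obtain T F m where Kf: "K = (T, F, m)" by (cases K)
  let ?N = "cell_nodes K"
  note fin = finite_cell_nodes[OF K] and c4 = card_cell_nodes[OF K]
  have "\<not> affine_dependent ?N"
  proof
    assume "affine_dependent ?N"
    then obtain U where U: "sum U ?N = 0" "\<exists>v\<in>?N. U v \<noteq> 0" "(\<Sum>v\<in>?N. U v *\<^sub>R v) = 0"
      using affine_dependent_explicit_finite[OF fin] by auto
    define \<mu> where "\<mu> = Max ((\<lambda>v. \<bar>U v\<bar>) ` ?N)"
    have \<mu>: "\<bar>U v\<bar> \<le> \<mu>" if "v \<in> ?N" for v unfolding \<mu>_def using fin that by simp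
    obtain v where v: "v \<in> ?N" "U v \<noteq> 0" using U by auto
    have \<mu>0: "0 < \<mu>" using \<mu>[OF v(1)] v(2) by linarith
    (* the centroid and the centroid perturbed by the affine relation are the same point *)
    define w where "w v = 1/4 + U v / (4 * \<mu>)" for v
    have "0 \<le> w q" if "q \<in> ?N" for q
      using \<mu>[OF that] \<mu>0 by (simp add: w_def field_simps abs_le_iff)
    moreover have "sum w ?N = 1"
      using c4 U(1) by (simp add: w_def sum.distrib sum_divide_distrib[symmetric])
    moreover have "(\<Sum>q\<in>?N. w q *\<^sub>R q) = (\<Sum>q\<in>?N. (1/4) *\<^sub>R q)"
    proof -
      have "(\<Sum>q\<in>?N. w q *\<^sub>R q) = (\<Sum>q\<in>?N. (1/4) *\<^sub>R q) + (1 / (4 * \<mu>)) *\<^sub>R (\<Sum>q\<in>?N. U q *\<^sub>R q)"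
        by (simp add: w_def scaleR_left_distrib sum.distrib scaleR_sum_right)
      then show ?thesis using U(3) by simp
    qed
    ultimately have "hat v (\<Sum>q\<in>?N. (1/4) *\<^sub>R q) = w v"
      using hat_combination[OF K[unfolded Kf], of w _ v] v(1) cell_nodes_subset[OF K] by (auto simp: Kf)
    moreover have "hat v (\<Sum>q\<in>?N. (1/4) *\<^sub>R q) = 1/4"
      using hat_combination[OF K[unfolded Kf], of "\<lambda>_. 1/4" _ v] v(1) c4 cell_nodes_subset[OF K]
      by (auto simp: Kf)
    ultimately show False using v(2) \<mu>0 by (simp add: w_def)
  qed
  then show ?thesis using c4 by (simp add: affine_frame_def)
qed

lemma hat_on_cell:
  assumes "K \<in> cells" "x \<in> cell K" "q \<in> split_nodes"
  shows "hat q x = (if q \<in> cell_nodes K then bary (cell_nodes K) q x else 0)"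
proof -
  obtain T F m where Kf: "K = (T, F, m)" by (cases K)
  note b = bary_sums[OF cell_frame[OF assms(1)], of x]
  have "\<forall>q\<in>cell_nodes K. 0 \<le> bary (cell_nodes K) q x"
    using convex_hull_subset_bary[OF cell_frame[OF assms(1)], of "cell_nodes K" x] assms(2) by auto
  then show ?thesis
    using hat_combination[OF assms(1)[unfolded Kf], of "\<lambda>q. bary (cell_nodes K) q x" x q] assms(3) b
    by (simp add: Kf)
qed

end

section \<open>Piecewise quadratic fields on the split\<close>

lemma has_derivative_componentwise_vec:
  fixes f :: "'a::real_normed_vector \<Rightarrow> real^'n"
  assumes "\<And>i. ((\<lambda>x. f x $ i) has_derivative (\<lambda>h. f' h $ i)) (at x within S)"
  shows "(f has_derivative f') (at x within S)"
proof (rule iffD2[OF has_derivative_componentwise_within], rule ballI)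
  fix b :: "real^'n" assume "b \<in> Basis"
  then obtain i where b: "b = axis i 1" by (auto simp: Basis_vec_def)
  show "((\<lambda>x. f x \<bullet> b) has_derivative (\<lambda>h. f' h \<bullet> b)) (at x within S)"
    using assms[of i] by (simp add: b inner_axis)
qed

context WF_complex begin

definition split_simplices :: "(real^3) set set" where
  "split_simplices = {s. s \<noteq> {} \<and> card s \<le> 2 \<and> (\<exists>K\<in>cells. s \<subseteq> cell_nodes K)}"

definition basis_function :: "(real^3) set \<Rightarrow> real^3 \<Rightarrow> real" where
  "basis_function s x = (\<Prod>q\<in>s. hat q x)"

definition field :: "((real^3) set \<times> 3 \<Rightarrow> real) \<Rightarrow> real^3 \<Rightarrow> real^3" where
  "field c x = (\<chi> i. \<Sum>s\<in>split_simplices. c (s, i) * basis_function s x)"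

lemma finite_split_nodes: "finite split_nodes"
  unfolding split_nodes_def using finite_mesh_vertices finite_mesh_faces finite_M by auto

lemma split_simplices_subset: "s \<in> split_simplices \<Longrightarrow> s \<subseteq> split_nodes"
  using cell_nodes_subset unfolding split_simplices_def by blast

lemma finite_split_simplices: "finite split_simplices"
  by (rule finite_subset[of _ "Pow split_nodes"]) (use split_simplices_subset finite_split_nodes in auto)

lemma finite_in_split_simplices: "s \<in> split_simplices \<Longrightarrow> finite s"
  using split_simplices_subset finite_split_nodes finite_subset by blast

definition hat_ext :: "(real^3) set \<times> (real^3) set \<times> (real^3) \<Rightarrow> real^3 \<Rightarrow> real^3 \<Rightarrow> real" where
  "hat_ext K q x = (if q \<in> cell_nodes K then bary (cell_nodes K) q x else 0)"

lemma hat_ext_eq: "K \<in> cells \<Longrightarrow> x \<in> cell K \<Longrightarrow> q \<in> split_nodes \<Longrightarrow> hat q x = hat_ext K q x"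
  by (simp add: hat_on_cell hat_ext_def)

lemma affine_hat_ext: "K \<in> cells \<Longrightarrow> affine_functional (hat_ext K q)"
  unfolding hat_ext_def using affine_functional_bary[OF cell_frame]
  by (cases "q \<in> cell_nodes K") auto

lemma hat_ext_node: "K \<in> cells \<Longrightarrow> a \<in> cell_nodes K \<Longrightarrow> hat_ext K q a = (if q = a then 1 else 0)"
  using bary_vertex[OF cell_frame[of K], of q a] by (auto simp: hat_ext_def)

definition basis_ext :: "(real^3) set \<times> (real^3) set \<times> (real^3) \<Rightarrow> (real^3) set \<Rightarrow> real^3 \<Rightarrow> real" where
  "basis_ext K s x = (\<Prod>q\<in>s. hat_ext K q x)"

definition basis_slope ::
    "(real^3) set \<times> (real^3) set \<times> (real^3) \<Rightarrow> (real^3) set \<Rightarrow> real^3 \<Rightarrow> real^3 \<Rightarrow> real" where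
  "basis_slope K s x h = (\<Sum>q\<in>s. (hat_ext K q h - hat_ext K q 0) * (\<Prod>r\<in>s - {q}. hat_ext K r x))"

lemma basis_ext_eq:
  "K \<in> cells \<Longrightarrow> x \<in> cell K \<Longrightarrow> s \<in> split_simplices \<Longrightarrow> basis_function s x = basis_ext K s x"
  unfolding basis_function_def basis_ext_def using split_simplices_subset[of s]
  by (intro prod.cong) (auto simp: hat_ext_eq[of K x])

lemma basis_ext_has_derivative:
  "K \<in> cells \<Longrightarrow> (basis_ext K s has_derivative basis_slope K s x) (at x)"
  unfolding basis_ext_def[abs_def] basis_slope_def[abs_def]
  by (intro has_derivative_prod affine_functional_has_derivative affine_hat_ext)

lemma split_simplices_cases:
  assumes "s \<in> split_simplices"
  obtains q where "s = {q}" | q r where "s = {q, r}" "q \<noteq> r"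
proof -
  have "finite s" "s \<noteq> {}" "card s \<le> 2"
    using assms finite_in_split_simplices[OF assms] by (auto simp: split_simplices_def)
  then consider "card s = 1" | "card s = 2" using card_gt_0_iff[of s] by linarith
  then show ?thesis
  proof cases
    case 1
    then show ?thesis using that(1) card_1_singletonE by blast
  next
    case 2
    then obtain q r where "s = {q, r}" "q \<noteq> r" unfolding card_2_iff by blast
    then show ?thesis by (rule that(2))
  qed
qed

lemma polynomial_basis_ext:
  assumes "K \<in> cells" "s \<in> split_simplices"
  shows "polynomial_of_degree_le 2 (basis_ext K s)"
  using assms(2)
proof (cases rule: split_simplices_cases)
  case (1 q)
  then show ?thesis
    using polynomial_of_degree_le_affine[OF affine_hat_ext[OF assms(1)], of 2]
    by (simp add: basis_ext_def[abs_def])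
next
  case (2 q r)
  then show ?thesis
    using polynomial_of_degree_le_affine_product[OF affine_hat_ext[OF assms(1)] affine_hat_ext[OF assms(1)]]
    by (simp add: basis_ext_def[abs_def])
qed

lemma affine_basis_slope_point:
  assumes "K \<in> cells" "s \<in> split_simplices"
  shows "affine_functional (\<lambda>x. basis_slope K s x h)"
  using assms(2)
proof (cases rule: split_simplices_cases)
  case (1 q)
  then show ?thesis by (simp add: basis_slope_def affine_functional_const)
next
  case (2 q r)
  then have "{q, r} - {q} = {r}" "{q, r} - {r} = {q}" by auto
  then show ?thesis using 2
    by (simp add: basis_slope_def)
       (intro affine_functional_add affine_functional_cmult affine_hat_ext assms)
qed

lemma affine_basis_slope_direction:
  assumes "K \<in> cells"
  shows "affine_functional (\<lambda>w. basis_slope K s x (w - x))"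
proof -
  have "affine_functional (basis_slope K s x)"
    unfolding basis_slope_def[abs_def]
    by (intro affine_functional_sum affine_functional_multc affine_functional_diff
        affine_hat_ext assms affine_functional_const)
  then show ?thesis by (rule affine_functional_translate)
qed

text \<open>In the direction from one node of a cell to another the derivative does not depend on the
  cell, because the basis functions are continuous across the cells.\<close>

lemma basis_slope_node:
  assumes "K \<in> cells" "a \<in> cell_nodes K" "x \<in> cell_nodes K"
  shows "basis_slope K s x (a - x) =
    (\<Sum>q\<in>s. ((if q = a then 1 else 0) - (if q = x then 1 else 0)) * (\<Prod>r\<in>s - {q}. if r = x then 1 else 0))"
proof -
  have "hat_ext K q (a - x) - hat_ext K q 0 = hat_ext K q a - hat_ext K q x" for q
    using affine_functional_line[OF affine_hat_ext[OF assms(1), of q], of x 1 "a - x"] by simp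
  then show ?thesis
    unfolding basis_slope_def by (simp add: hat_ext_node assms cong: prod.cong)
qed

definition cell_divergence ::
    "((real^3) set \<times> 3 \<Rightarrow> real) \<Rightarrow> (real^3) set \<times> (real^3) set \<times> (real^3) \<Rightarrow> real^3 \<Rightarrow> real" where
  "cell_divergence c K x = (\<Sum>a\<in>split_simplices \<times> UNIV. c a * basis_slope K (fst a) x (axis (snd a) 1))"

lemma affine_cell_divergence:
  assumes "K \<in> cells"
  shows "affine_functional (cell_divergence c K)"
  unfolding cell_divergence_def[abs_def]
  by (intro affine_functional_sum affine_functional_cmult affine_basis_slope_point assms) auto

lemma divergence_field:
  assumes "K \<in> cells" "x \<in> interior (cell K)"
  shows "divergence (field c) x = cell_divergence c K x"
proof -
  define D where "D h = (\<chi> i. \<Sum>s\<in>split_simplices. c (s, i) * basis_slope K s x h)" for h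
  have "((\<lambda>x. \<chi> i. \<Sum>s\<in>split_simplices. c (s, i) * basis_ext K s x) has_derivative D) (at x)"
    by (rule has_derivative_componentwise_vec)
       (auto simp: D_def intro!: has_derivative_sum has_derivative_mult_right
         basis_ext_has_derivative[OF assms(1)])
  then have "(field c has_derivative D) (at x)"
  proof (rule has_derivative_transform_within_open[OF _ open_interior assms(2)])
    fix v assume "v \<in> interior (cell K)"
    then have "v \<in> cell K" using interior_subset by blast
    then show "(\<chi> i. \<Sum>s\<in>split_simplices. c (s, i) * basis_ext K s v) = field c v"
      by (simp add: field_def basis_ext_eq[OF assms(1)])
  qed
  then have "frechet_derivative (field c) (at x) = D"
    using frechet_derivative_at by metis
  then have "divergence (field c) x = (\<Sum>i\<in>UNIV. \<Sum>s\<in>split_simplices. c (s, i) * basis_slope K s x (axis i 1))"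
    by (simp add: divergence_def D_def)
  also have "\<dots> = (\<Sum>s\<in>split_simplices. \<Sum>i\<in>UNIV. c (s, i) * basis_slope K s x (axis i 1))"
    by (rule sum.swap)
  also have "\<dots> = cell_divergence c K x"
    by (simp add: cell_divergence_def sum.cartesian_product case_prod_beta)
  finally show ?thesis .
qed

lemma field_in_Z_space:
  assumes "\<forall>K\<in>cells. \<forall>q\<in>cell_nodes K. cell_divergence c K q = 0"
  shows "field c \<in> Z_space \<Omega> 2 (cell ` cells)"
proof -
  have "field c x = 0" if "x \<notin> closure \<Omega>" for x
  proof -
    have "basis_function s x = 0" if s: "s \<in> split_simplices" for s
    proof -
      obtain q where "q \<in> s" using s by (auto simp: split_simplices_def)
      then show ?thesis
        unfolding basis_function_def
        using hat_outside[OF \<open>x \<notin> closure \<Omega>\<close>] split_simplices_subset[OF s] finite_in_split_simplices[OF s]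
        by (subst prod_zero_iff) auto
    qed
    then show ?thesis by (simp add: field_def vec_eq_iff)
  qed
  moreover have "continuous_on (closure \<Omega>) (field c)"
    unfolding field_def[abs_def] basis_function_def
    by (intro continuous_intros continuous_on_hat) (use split_simplices_subset in auto)
  moreover have "\<exists>p. polynomial_of_degree_le 2 p \<and> (\<forall>x\<in>cell K. field c x $ i = p x)"
    if "K \<in> cells" for K i
    by (intro exI[of _ "\<lambda>x. \<Sum>s\<in>split_simplices. c (s, i) * basis_ext K s x"] conjI
        polynomial_of_degree_le_sum polynomial_of_degree_le_cmult polynomial_basis_ext that)
       (simp_all add: field_def basis_ext_eq[OF that])
  moreover have "divergence (field c) x = 0" if K: "K \<in> cells" and x: "x \<in> interior (cell K)" for K x
  proof -
    have "cell_divergence c K x = (\<Sum>p\<in>cell_nodes K. bary (cell_nodes K) p x * cell_divergence c K p)"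
      by (rule affine_functional_bary_expansion[OF affine_cell_divergence[OF K] cell_frame[OF K]])
    then show ?thesis using assms K by (simp add: divergence_field[OF K x])
  qed
  ultimately show ?thesis by (auto simp: Z_space_def V_space_def)
qed

lemma hat_node:
  assumes "a \<in> cell_nodes K" "K \<in> cells" "q \<in> split_nodes"
  shows "hat q a = (if q = a then 1 else 0)"
proof -
  have "a \<in> cell K" using assms hull_inc by metis
  then show ?thesis using hat_ext_eq[OF assms(2) _ assms(3)] hat_ext_node[OF assms(2,1)] by simp
qed

text \<open>At a node of the split all basis functions vanish but its own; at the midpoint of an edge the only
  others that do not vanish are those of its ends.\<close>

lemma field_coefficients_0:
  assumes "\<forall>K\<in>cells. \<forall>x\<in>cell K. field c x = 0" "s \<in> split_simplices"
  shows "c (s, i) = 0"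
proof -
  have eq: "(\<Sum>s\<in>split_simplices. c (s, i) * basis_function s x) = 0" if "K \<in> cells" "x \<in> cell K" for K x
  proof -
    have "field c x $ i = 0" using assms(1) that by simp
    then show ?thesis by (simp add: field_def)
  qed
  have single: "c ({q}, i) = 0" if q: "{q} \<in> split_simplices" for q
  proof -
    obtain K where K: "K \<in> cells" "q \<in> cell_nodes K" using q by (auto simp: split_simplices_def)
    have b: "basis_function s q = (if s = {q} then 1 else 0)" if s: "s \<in> split_simplices" for s
    proof (cases "s = {q}")
      case True
      then show ?thesis using hat_node[OF K(2,1)] cell_nodes_subset[OF K(1)] K(2)
        by (auto simp: basis_function_def)
    next
      case False
      then obtain r where r: "r \<in> s" "r \<noteq> q" using s by (auto simp: split_simplices_def)
      then have "hat r q = 0" using hat_node[OF K(2,1)] split_simplices_subset[OF s] by auto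
      then show ?thesis using False r finite_in_split_simplices[OF s]
        by (auto simp: basis_function_def)
    qed
    have "q \<in> cell K" using K hull_inc by metis
    from eq[OF K(1) this] have "(\<Sum>s\<in>split_simplices. if s = {q} then c (s, i) else 0) = 0"
      by (simp add: b if_distrib[of "\<lambda>t. _ * t"] cong: sum.cong if_cong)
    then show ?thesis using q finite_split_simplices by simp
  qed
  show ?thesis
    using assms(2)
  proof (cases rule: split_simplices_cases)
    case (1 q)
    then show ?thesis using single assms(2) by simp
  next
    case (2 q r)
    obtain K where K: "K \<in> cells" "q \<in> cell_nodes K" "r \<in> cell_nodes K"
      using assms(2) 2 by (auto simp: split_simplices_def)
    let ?x = "midpoint q r"
    have x: "?x \<in> cell K"
      using K hull_inc[of _ "cell_nodes K" convex] midpoint_in_closed_segment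
        closed_segment_subset[OF _ _ convex_convex_hull] by blast
    have h: "hat u ?x = (if u = q \<or> u = r then 1/2 else 0)" if "u \<in> split_nodes" for u
      using affine_functional_midpoint[OF affine_hat_ext[OF K(1), of u], of q r] 2(2)
      by (auto simp: hat_ext_eq[OF K(1) x that] hat_ext_node[OF K(1)] K)
    have b: "c (t, i) * basis_function t ?x = (if t = s then c (t, i) / 4 else 0)"
      if t: "t \<in> split_simplices" for t
      using t
    proof (cases rule: split_simplices_cases)
      case (1 v)
      then show ?thesis using single[of v] t 2 by auto
    next
      case t': (2 u v)
      have uv: "u \<in> split_nodes" "v \<in> split_nodes" using split_simplices_subset[OF t] t' by auto
      have "t = s \<longleftrightarrow> (u = q \<or> u = r) \<and> (v = q \<or> v = r)"
        using t' 2 by (auto simp: doubleton_eq_iff)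
      then show ?thesis using t' h[OF uv(1)] h[OF uv(2)] by (auto simp: basis_function_def)
    qed
    have "(\<Sum>t\<in>split_simplices. if t = s then c (t, i) / 4 else 0) = 0"
      using eq[OF K(1) x] by (simp add: b cong: sum.cong)
    then show ?thesis using assms(2) finite_split_simplices by simp
  qed
qed


end

section \<open>Counting the nodes and edges of the split\<close>

context WF_complex begin

lemma in_some_cell:
  assumes "T \<in> M" "c \<subseteq> verts T" "card c \<le> 2"
  shows "\<exists>F m. (T, F, m) \<in> cells \<and> c \<subseteq> cell_nodes (T, F, m)"
proof -
  have fc: "finite c" using assms finite_verts finite_subset by blast
  have "\<not> verts T \<subseteq> c"
    using card_mono[OF fc, of "verts T"] card_verts[OF assms(1)] assms(3) by auto
  then obtain a where a: "a \<in> verts T" "a \<notin> c" by blast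
  define F where "F = convex hull (verts T - {a})"
  have F: "F facet_of T" using facet_of_simplex3[OF simplex_M[OF assms(1)]] a F_def by auto
  have vF: "verts F = verts T - {a}"
    unfolding F_def using verts_convex_hull_frame[OF frame[OF assms(1)]] by auto
  have "\<not> verts F \<subseteq> c"
    using card_mono[OF fc, of "verts F"] facet_verts(2)[OF assms(1) F] assms(3) by auto
  then obtain m where m: "m \<in> verts F" "m \<notin> c" by blast
  have "(T, F, m) \<in> cells" using assms F m by (simp add: cells_def)
  moreover have "c \<subseteq> cell_nodes (T, F, m)" using vF a m assms(2) by (auto simp: cell_nodes_def)
  ultimately show ?thesis by blast
qed

lemma card_facets:
  assumes "T \<in> M" shows "card {F. F facet_of T} = 4"
proof -
  have "{F. F facet_of T} = (\<lambda>a. convex hull (verts T - {a})) ` verts T"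
    by (auto simp: facet_of_simplex3[OF simplex_M[OF assms]])
  moreover have "inj_on (\<lambda>a. convex hull (verts T - {a})) (verts T)"
  proof (rule inj_onI)
    fix a b assume ab: "a \<in> verts T" "b \<in> verts T"
      "convex hull (verts T - {a}) = convex hull (verts T - {b})"
    have "verts T - {a} = verts T - {b}"
      using arg_cong[OF ab(3), of verts] verts_convex_hull_frame[OF frame[OF assms]] by simp
    then show "a = b" using ab by blast
  qed
  ultimately show ?thesis using card_image card_verts[OF assms] by metis
qed

text \<open>The simplices are sorted by the numbers of mesh vertices, face points and interior points among
  their nodes.\<close>

lemma card_split_simplices:
  "card (mesh_vertices M) + card (mesh_edges M) + 4 * card (mesh_faces M) + 9 * card M
    \<le> card split_simplices"
proof -
  let ?V = "mesh_vertices M" and ?Y = "y ` mesh_faces M" and ?Z = "z ` M"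
  note fin = finite_mesh_vertices finite_mesh_edges finite_mesh_faces finite_M
  define S where "S k =
    (if k = 0 then (\<lambda>p. {p}) ` ?V
     else if k = 1 then verts ` mesh_edges M
     else if k = 2 then (\<lambda>F. {y F}) ` mesh_faces M
     else if k = 3 then (\<lambda>(F, p). {y F, p}) ` (SIGMA F:mesh_faces M. verts F)
     else if k = 4 then (\<lambda>T. {z T}) ` M
     else if k = 5 then (\<lambda>(T, p). {z T, p}) ` (SIGMA T:M. verts T)
     else (\<lambda>(T, F). {z T, y F}) ` (SIGMA T:M. {F. F facet_of T}))" for k :: nat
  \<comment> \<open>the signature of a simplex tells which of the seven families it belongs to\<close>
  define sig where "sig s = (card (s \<inter> ?V), card (s \<inter> ?Y), card (s \<inter> ?Z))" for s
  define f where "f k = (if k = 0 then (1,0,0) else if k = 1 then (2,0,0) else if k = 2 then (0,1,0)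
     else if k = 3 then (1,1,0) else if k = 4 then (0,0,1) else if k = 5 then (1,0,1)
     else (0::nat, 1::nat, 1::nat))" for k :: nat
  have edge_verts: "card (verts e) = 2" "verts e \<subseteq> ?V" "convex hull (verts e) = e"
      "\<exists>T\<in>M. verts e \<subseteq> verts T" if e: "e \<in> mesh_edges M" for e
  proof -
    obtain T where T: "T \<in> M" "e edge_of T" using e by (auto simp: mesh_edges_def)
    note ve = verts_edge[OF simplex_M[OF T(1)] T(2)]
    show "card (verts e) = 2" "verts e \<subseteq> ?V" "convex hull (verts e) = e" "\<exists>T\<in>M. verts e \<subseteq> verts T"
      using ve T mesh_vertices_eq by auto
  qed
  note dis = nodes_disjoint
  have disE: "p \<in> ?V \<Longrightarrow> p \<notin> ?Y" "p \<in> ?V \<Longrightarrow> p \<notin> ?Z" "p \<in> ?Y \<Longrightarrow> p \<notin> ?V" "p \<in> ?Y \<Longrightarrow> p \<notin> ?Z"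
    "p \<in> ?Z \<Longrightarrow> p \<notin> ?V" "p \<in> ?Z \<Longrightarrow> p \<notin> ?Y" for p using dis by auto
  have yM: "F \<in> mesh_faces M \<Longrightarrow> y F \<in> ?Y" and zM: "T \<in> M \<Longrightarrow> z T \<in> ?Z" for F T by auto
  have vV: "F \<in> mesh_faces M \<Longrightarrow> p \<in> verts F \<Longrightarrow> p \<in> ?V" and tV: "T \<in> M \<Longrightarrow> p \<in> verts T \<Longrightarrow> p \<in> ?V" for F T p
    by (use mesh_face_verts(4) in blast, unfold mesh_vertices_eq, blast)
  have sigf: "sig s = f k" if sk: "s \<in> S k" "k < 7" for s k
  proof -
    have "k \<in> {0,1,2,3,4,5,6}" using sk(2) by auto
    then consider "k = 0" | "k = 1" | "k = 2" | "k = 3" | "k = 4" | "k = 5" | "k = 6" by auto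
    then show ?thesis
    proof cases
      assume k: "k = 0"
      then obtain p where p: "p \<in> ?V" "s = {p}" using sk by (auto simp: S_def)
      then have "s \<inter> ?V = {p}" "s \<inter> ?Y = {}" "s \<inter> ?Z = {}"
        using disE(1,2)[OF p(1)] by auto
      then show ?thesis using k by (simp add: f_def sig_def)
    next
      assume k: "k = 1"
      then obtain e where e: "e \<in> mesh_edges M" "s = verts e" using sk by (auto simp: S_def)
      then have "s \<inter> ?V = s" "s \<inter> ?Y = {}" "s \<inter> ?Z = {}" using edge_verts(2)[OF e(1)] dis by auto
      then show ?thesis using edge_verts(1)[OF e(1)] k e by (simp add: f_def sig_def)
    next
      assume k: "k = 2"
      then obtain F where F: "F \<in> mesh_faces M" "s = {y F}" using sk by (auto simp: S_def)
      then have "s \<inter> ?V = {}" "s \<inter> ?Y = {y F}" "s \<inter> ?Z = {}"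
        using disE(3,4)[OF yM[OF F(1)]] by auto
      then show ?thesis using k by (simp add: f_def sig_def)
    next
      assume k: "k = 3"
      then obtain F p where F: "F \<in> mesh_faces M" "p \<in> verts F" "s = {y F, p}" using sk by (auto simp: S_def)
      then have "s \<inter> ?V = {p}" "s \<inter> ?Y = {y F}" "s \<inter> ?Z = {}"
        using disE(3,4)[OF yM[OF F(1)]] disE(1,2)[OF vV[OF F(1,2)]] yM[OF F(1)] vV[OF F(1,2)] by auto
      then show ?thesis using k by (simp add: f_def sig_def)
    next
      assume k: "k = 4"
      then obtain T where T: "T \<in> M" "s = {z T}" using sk by (auto simp: S_def)
      then have "s \<inter> ?V = {}" "s \<inter> ?Y = {}" "s \<inter> ?Z = {z T}"
        using disE(5,6)[OF zM[OF T(1)]] by auto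
      then show ?thesis using k by (simp add: f_def sig_def)
    next
      assume k: "k = 5"
      then obtain T p where T: "T \<in> M" "p \<in> verts T" "s = {z T, p}" using sk by (auto simp: S_def)
      then have "s \<inter> ?V = {p}" "s \<inter> ?Z = {z T}" "s \<inter> ?Y = {}"
        using disE(5,6)[OF zM[OF T(1)]] disE(1,2)[OF tV[OF T(1,2)]] zM[OF T(1)] tV[OF T(1,2)] by auto
      then show ?thesis using k by (simp add: f_def sig_def)
    next
      assume k: "k = 6"
      then obtain T F where T: "T \<in> M" "F facet_of T" "s = {z T, y F}" using sk by (auto simp: S_def)
      then have "s \<inter> ?Y = {y F}" "s \<inter> ?Z = {z T}" "s \<inter> ?V = {}"
        using disE(5,6)[OF zM[OF T(1)]] disE(3,4)[OF yM[OF facet_in_mesh_faces[OF T(1,2)]]]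
          zM[OF T(1)] yM[OF facet_in_mesh_faces[OF T(1,2)]] by auto
      then show ?thesis using k by (simp add: f_def sig_def)
    qed
  qed
  have disj: "S j \<inter> S k = {}" if "j < 7" "k < 7" "j \<noteq> k" for j k
  proof -
    have "f j \<noteq> f k"
      using that by (auto simp: f_def; arith)
    moreover have "f j = f k" if s: "s \<in> S j" "s \<in> S k" for s
      using sigf[OF s(1)] sigf[OF s(2)] \<open>j < 7\<close> \<open>k < 7\<close> by simp
    ultimately show ?thesis by blast
  qed
  have injy: "y F = y G \<longleftrightarrow> F = G" if "F \<in> mesh_faces M" "G \<in> mesh_faces M" for F G
    using inj_y that by (simp add: inj_on_eq_iff)
  have injz: "z T = z U \<longleftrightarrow> T = U" if "T \<in> M" "U \<in> M" for T U
    using inj_z that by (simp add: inj_on_eq_iff)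
  have yv: "y F \<noteq> p" if "F \<in> mesh_faces M" "p \<in> ?V" for F p using disE(1)[OF that(2)] yM[OF that(1)] by auto
  have zv: "z T \<noteq> p" if "T \<in> M" "p \<in> ?V" for T p using disE(2)[OF that(2)] zM[OF that(1)] by auto
  have zy: "z T \<noteq> y F" if "T \<in> M" "F \<in> mesh_faces M" for T F using disE(4)[OF yM[OF that(2)]] zM[OF that(1)] by auto
  have c0: "card (S 0) = card ?V" by (simp add: S_def card_image)
  have "inj_on verts (mesh_edges M)" using edge_verts(3) by (metis inj_onI)
  then have c1: "card (S 1) = card (mesh_edges M)" by (simp add: S_def card_image)
  have "inj_on (\<lambda>F. {y F}) (mesh_faces M)" by (auto simp: inj_on_def injy)
  then have c2: "card (S 2) = card (mesh_faces M)" by (simp add: S_def card_image)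
  have "inj_on (\<lambda>(F, p). {y F, p}) (SIGMA F:mesh_faces M. verts F)"
  proof (rule inj_onI, clarify)
    fix F p G q assume "F \<in> mesh_faces M" "p \<in> verts F" "G \<in> mesh_faces M" "q \<in> verts G" "{y F, p} = {y G, q}"
    then show "F = G \<and> p = q"
      using yv[of F q] yv[of G p] vV[of F p] vV[of G q] injy[of F G] by (auto simp: doubleton_eq_iff)
  qed
  then have c3: "card (S 3) = 3 * card (mesh_faces M)"
    using fin mesh_face_verts by (simp add: S_def card_image)
  have "inj_on (\<lambda>T. {z T}) M" by (auto simp: inj_on_def injz)
  then have c4: "card (S 4) = card M" by (simp add: S_def card_image)
  have "inj_on (\<lambda>(T, p). {z T, p}) (SIGMA T:M. verts T)"
  proof (rule inj_onI, clarify)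
    fix T p U q assume "T \<in> M" "p \<in> verts T" "U \<in> M" "q \<in> verts U" "{z T, p} = {z U, q}"
    then show "T = U \<and> p = q"
      using zv[of T q] zv[of U p] tV[of T p] tV[of U q] injz[of T U] by (auto simp: doubleton_eq_iff)
  qed
  then have c5: "card (S 5) = 4 * card M"
    using fin card_verts finite_verts by (simp add: S_def card_image)
  have "inj_on (\<lambda>(T, F). {z T, y F}) (SIGMA T:M. {F. F facet_of T})"
  proof (rule inj_onI, clarify)
    fix T F U G assume *: "T \<in> M" "F facet_of T" "U \<in> M" "G facet_of U" "{z T, y F} = {z U, y G}"
    note FG = facet_in_mesh_faces[OF *(1,2)] facet_in_mesh_faces[OF *(3,4)]
    show "T = U \<and> F = G"
      using * zy[OF *(1) FG(2)] zy[OF *(3) FG(1)] injz[OF *(1,3)] injy[OF FG] by (auto simp: doubleton_eq_iff)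
  qed
  moreover have "finite {F. F facet_of T}" if "T \<in> M" for T
    using card_facets[OF that] by (metis card.infinite zero_neq_numeral)
  ultimately have c6: "card (S 6) = 4 * card M"
    using fin card_facets by (simp add: S_def card_image)
  have sub: "S k \<subseteq> split_simplices" if "k < 7" for k
  proof
    fix s assume s: "s \<in> S k"
    have pair: "{a, b} \<in> split_simplices" if "K \<in> cells" "a \<in> cell_nodes K" "b \<in> cell_nodes K" for a b K
      using that by (auto simp: split_simplices_def card_insert_if)
    have vcell: "\<exists>F m. (T, F, m) \<in> cells \<and> p \<in> cell_nodes (T, F, m) \<and> z T \<in> cell_nodes (T, F, m)"
      if "T \<in> M" "p \<in> verts T" for T p
      using in_some_cell[OF that(1), of "{p}"] that(2) by (auto simp: cell_nodes_def)
    have fcell: "\<exists>m. (T, F, m) \<in> cells \<and> p \<in> cell_nodes (T, F, m) \<and> y F \<in> cell_nodes (T, F, m) \<and>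
        z T \<in> cell_nodes (T, F, m)" if TFp: "T \<in> M" "F facet_of T" "p \<in> verts F" for T F p
    proof -
      have "verts F \<noteq> {p}" using facet_verts(2)[OF TFp(1,2)] by auto
      then obtain m where "m \<in> verts F" "m \<noteq> p" using TFp(3) by auto
      then show ?thesis using TFp by (intro exI[of _ m]) (auto simp: cells_def cell_nodes_def)
    qed
    have neF: "\<exists>p. p \<in> verts F" if "F \<in> mesh_faces M" for F
      using mesh_face_verts(1)[OF that] by (metis card.empty ex_in_conv zero_neq_numeral)
    have "k \<in> {0,1,2,3,4,5,6}" using that by auto
    then consider "k = 0" | "k = 1" | "k = 2" | "k = 3" | "k = 4" | "k = 5" | "k = 6" by auto
    then show "s \<in> split_simplices"
    proof cases
      assume "k = 0"
      then obtain p T where "T \<in> M" "p \<in> verts T" "s = {p, p}" using s by (auto simp: S_def mesh_vertices_eq)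
      then show ?thesis using vcell pair by blast
    next
      assume "k = 1"
      then obtain e where e: "e \<in> mesh_edges M" "s = verts e" using s by (auto simp: S_def)
      then obtain T where "T \<in> M" "verts e \<subseteq> verts T" using edge_verts(4) by blast
      then show ?thesis using in_some_cell[of T "verts e"] e edge_verts(1)[OF e(1)]
        by (auto simp: split_simplices_def)
    next
      assume "k = 2"
      then obtain F where F: "F \<in> mesh_faces M" "s = {y F, y F}" using s by (auto simp: S_def)
      then obtain T where "T \<in> M" "F facet_of T" by (auto simp: mesh_faces_def)
      then show ?thesis using F neF[OF F(1)] fcell pair by blast
    next
      assume "k = 3"
      then obtain F p where F: "F \<in> mesh_faces M" "p \<in> verts F" "s = {y F, p}" using s by (auto simp: S_def)
      then obtain T where "T \<in> M" "F facet_of T" by (auto simp: mesh_faces_def)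
      then show ?thesis using F fcell pair by blast
    next
      assume "k = 4"
      then obtain T where T: "T \<in> M" "s = {z T, z T}" using s by (auto simp: S_def)
      then show ?thesis using vcell verts_nonempty[OF T(1)] pair by blast
    next
      assume "k = 5"
      then obtain T p where "T \<in> M" "p \<in> verts T" "s = {z T, p}" using s by (auto simp: S_def)
      then show ?thesis using vcell pair by blast
    next
      assume "k = 6"
      then obtain T F where T: "T \<in> M" "F facet_of T" "s = {z T, y F}" using s by (auto simp: S_def)
      then show ?thesis using fcell neF[OF facet_in_mesh_faces[OF T(1,2)]] pair by blast
    qed
  qed
  have finS: "finite (S k)" if "k < 7" for k
    using sub[OF that] finite_split_simplices finite_subset by blast
  have "card (\<Union>k\<in>{..<7}. S k) = (\<Sum>k<7. card (S k))"
    by (rule card_UN_disjoint) (use finS disj in auto)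
  also have "\<dots> = card (S 0) + card (S 1) + card (S 2) + card (S 3) + card (S 4) + card (S 5) + card (S 6)"
    by (simp add: eval_nat_numeral)
  finally have "card (\<Union>k\<in>{..<7}. S k) = card ?V + card (mesh_edges M) + 4 * card (mesh_faces M) + 9 * card M"
    using c0 c1 c2 c3 c4 c5 c6 by simp
  moreover have "card (\<Union>k\<in>{..<7}. S k) \<le> card split_simplices"
    using sub finite_split_simplices by (intro card_mono) auto
  ultimately show ?thesis by simp
qed

end

section \<open>Redundant divergence equations at singular edges\<close>

context WF_complex begin

text \<open>The face point is a combination of the vertices of its face with positive weights.\<close>

lemma affine_functional_y_vertex_0:
  assumes "affine_functional f" "F \<in> mesh_faces M" "m \<in> verts F" "f (y F) = 0"
    "\<And>p. p \<in> verts F - {m} \<Longrightarrow> f p = 0"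
  shows "f m = 0"
proof -
  obtain T where T: "T \<in> M" "F facet_of T" using assms(2) by (auto simp: mesh_faces_def)
  have yT: "y F \<in> T" using y_in[OF assms(2)] facet_of_imp_subset[OF T(2)] by auto
  have mT: "m \<in> verts T" using facet_verts(1)[OF T] assms(3) by auto
  have "f (y F) = (\<Sum>p\<in>verts T. bary (verts T) p (y F) * f p)"
    by (rule affine_functional_bary_expansion[OF assms(1) frame[OF T(1)]])
  also have "\<dots> = (\<Sum>p\<in>{m}. bary (verts T) p (y F) * f p)"
  proof (rule sum.mono_neutral_right)
    show "\<forall>p\<in>verts T - {m}. bary (verts T) p (y F) * f p = 0"
    proof
      fix p assume p: "p \<in> verts T - {m}"
      show "bary (verts T) p (y F) * f p = 0"
      proof (cases "p \<in> verts F")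
        case True
        then show ?thesis using assms(5)[of p] p by simp
      next
        case False
        then show ?thesis
          using coord_y_eq_0[OF assms(2), of p] coord_eq[OF T(1) yT, of p] p by simp
      qed
    qed
  qed (use mT finite_verts[OF T(1)] in auto)
  finally have "bary (verts T) m (y F) * f m = 0" using assms(4) by simp
  moreover have "0 < bary (verts T) m (y F)"
    using coord_y'[OF assms(2), of m] assms(3) coord_eq[OF T(1) yT, of m] mT by simp
  ultimately show ?thesis by simp
qed

text \<open>The defining property of the split enters here: the face point is collinear with the two interior
  points and different from both.\<close>

lemma affine_functional_opposite_z_0:
  assumes "affine_functional f" "T \<in> M" "S \<in> M" "T \<noteq> S" "F facet_of T" "F facet_of S"
    "f (y F) = 0" "f (z S) = 0"
  shows "f (z T) = 0"
proof -
  have F: "F \<in> mesh_faces M" using facet_in_mesh_faces assms by blast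
  have "y F \<in> closed_segment (z T) (z S)" using z_y_z[OF assms(2-6)] by blast
  then obtain t where t: "y F = (1 - t) *\<^sub>R z T + t *\<^sub>R z S" by (auto simp: in_segment)
  have "t \<noteq> 1"
  proof
    assume "t = 1"
    then have "y F = z S" using t by simp
    then show False using nodes_disjoint(3) F assms(3) by auto
  qed
  obtain a b where f: "\<And>x. f x = a \<bullet> x + b" using assms(1) unfolding affine_functional_def by metis
  have "f (y F) = (1 - t) * f (z T) + t * f (z S)"
    by (simp add: f t inner_add_right algebra_simps)
  then show ?thesis using assms(7,8) \<open>t \<noteq> 1\<close> by simp
qed

text \<open>Around the edge from \<open>y F\<close> to the vertex \<open>p\<close> of an interior face the four cells are cut out by
  two planes: the plane of \<open>F\<close> and the plane through \<open>p\<close> and the two interior points. The alternating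
  sum of the four gradients at a point of this edge vanishes along the edge, along the line of the
  interior points and in the plane of \<open>F\<close>, so it is zero.\<close>

lemma singular_edge_slope:
  assumes T: "T \<in> M" "F facet_of T" and S: "S \<in> M" "F facet_of S" and "T \<noteq> S"
    and m: "m \<in> verts F" "m' \<in> verts F" "m \<noteq> m'" and x: "x \<in> insert (y F) (verts F - {m, m'})"
  shows "basis_slope (T, F, m) s x h - basis_slope (T, F, m') s x h
       - basis_slope (S, F, m) s x h + basis_slope (S, F, m') s x h = 0"
proof -
  have FM: "F \<in> mesh_faces M" using facet_in_mesh_faces T by blast
  define A where "A K w = basis_slope K s x (w - x)" for K w
  define g where "g a = (\<Sum>q\<in>s. ((if q = a then 1 else 0) - (if q = x then 1 else 0)) *
    (\<Prod>r\<in>s - {q}. if r = x then 1 else (0::real)))" for a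
  have K: "(T, F, m) \<in> cells" "(T, F, m') \<in> cells" "(S, F, m) \<in> cells" "(S, F, m') \<in> cells"
    using T S m by (auto simp: cells_def)
  have xK: "x \<in> cell_nodes (T, F, m)" "x \<in> cell_nodes (T, F, m')" "x \<in> cell_nodes (S, F, m)"
    "x \<in> cell_nodes (S, F, m')"
    using x by (auto simp: cell_nodes_def)
  have A: "A K a = g a" if "K \<in> cells" "a \<in> cell_nodes K" "x \<in> cell_nodes K" for K a
    unfolding A_def g_def by (rule basis_slope_node[OF that])
  have aff: "affine_functional (A K)" if "K \<in> cells" for K
    unfolding A_def[abs_def] by (rule affine_basis_slope_direction[OF that])
  have common: "A K a = g a" if "K \<in> {(T, F, m), (T, F, m'), (S, F, m), (S, F, m')}"
      "a \<in> insert (y F) (verts F - {m, m'})" for K a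
    using that K xK by (intro A) (auto simp: cell_nodes_def)
  define \<Lambda> where "\<Lambda> w = (A (T, F, m) w - A (T, F, m') w) - (A (S, F, m) w - A (S, F, m') w)" for w
  have "\<Lambda> w = 0" for w
  proof (rule affine_functional_eq_0[of \<Lambda>, OF _ cell_frame[OF K(1)]])
    show "affine_functional \<Lambda>"
      unfolding \<Lambda>_def[abs_def] by (intro affine_functional_diff aff K)
    have z: "\<Lambda> (z T) = 0"
    proof -
      have "A (T, F, m) (z T) = g (z T)" "A (T, F, m') (z T) = g (z T)"
        using A[OF K(1) _ xK(1), of "z T"] A[OF K(2) _ xK(2), of "z T"] by (auto simp: cell_nodes_def)
      moreover have "A (S, F, m) (z T) - A (S, F, m') (z T) = 0"
      proof (rule affine_functional_opposite_z_0[of "\<lambda>w. A (S, F, m) w - A (S, F, m') w" T S F])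
        show "affine_functional (\<lambda>w. A (S, F, m) w - A (S, F, m') w)"
          by (intro affine_functional_diff aff K)
        show "A (S, F, m) (y F) - A (S, F, m') (y F) = 0" using common by simp
        show "A (S, F, m) (z S) - A (S, F, m') (z S) = 0"
          using A[OF K(3) _ xK(3), of "z S"] A[OF K(4) _ xK(4), of "z S"] by (auto simp: cell_nodes_def)
      qed (use assms in auto)
      ultimately show ?thesis by (simp add: \<Lambda>_def)
    qed
    have m'0: "\<Lambda> m' = 0"
    proof -
      have "A (T, F, m) m' = g m'" "A (S, F, m) m' = g m'"
        using A[OF K(1) _ xK(1), of m'] A[OF K(3) _ xK(3), of m'] m by (auto simp: cell_nodes_def)
      moreover have "A (T, F, m') m' - A (S, F, m') m' = 0"
      proof (rule affine_functional_y_vertex_0[of "\<lambda>w. A (T, F, m') w - A (S, F, m') w" F m'])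
        show "affine_functional (\<lambda>w. A (T, F, m') w - A (S, F, m') w)"
          by (intro affine_functional_diff aff K)
        show "A (T, F, m') (y F) - A (S, F, m') (y F) = 0" using common by simp
        fix p assume p: "p \<in> verts F - {m'}"
        then show "A (T, F, m') p - A (S, F, m') p = 0"
          using A[OF K(2) _ xK(2), of p] A[OF K(4) _ xK(4), of p] by (auto simp: cell_nodes_def)
      qed (use FM m in auto)
      ultimately show ?thesis by (simp add: \<Lambda>_def)
    qed
    fix p assume "p \<in> cell_nodes (T, F, m)"
    then consider "p = z T" | "p = m'" | "p \<in> insert (y F) (verts F - {m, m'})"
      by (auto simp: cell_nodes_def)
    then show "\<Lambda> p = 0"
    proof cases
      case 3
      then show ?thesis using common by (simp add: \<Lambda>_def)
    qed (use z m'0 in auto)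
  qed
  from this[of "x + h"] show ?thesis by (simp add: \<Lambda>_def A_def)
qed

lemma singular_edge_divergence:
  assumes "T \<in> M" "F facet_of T" "S \<in> M" "F facet_of S" "T \<noteq> S"
    "m \<in> verts F" "m' \<in> verts F" "m \<noteq> m'" "x \<in> insert (y F) (verts F - {m, m'})"
  shows "cell_divergence c (T, F, m) x - cell_divergence c (T, F, m') x =
    cell_divergence c (S, F, m) x - cell_divergence c (S, F, m') x"
proof -
  have "cell_divergence c (T, F, m) x - cell_divergence c (T, F, m') x -
     cell_divergence c (S, F, m) x + cell_divergence c (S, F, m') x =
    (\<Sum>a\<in>split_simplices \<times> UNIV. c a * (basis_slope (T, F, m) (fst a) x (axis (snd a) 1)
       - basis_slope (T, F, m') (fst a) x (axis (snd a) 1)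
       - basis_slope (S, F, m) (fst a) x (axis (snd a) 1)
       + basis_slope (S, F, m') (fst a) x (axis (snd a) 1)))"
    by (simp add: cell_divergence_def sum.distrib sum_subtractf algebra_simps)
  also have "\<dots> = 0" by (simp add: singular_edge_slope[OF assms])
  finally show ?thesis by simp
qed

definition face_equations ::
    "(real^3) set \<Rightarrow> (((real^3) set \<times> (real^3) set \<times> (real^3)) \<times> (real^3)) set" where
  "face_equations F = {(K, q). K \<in> cells \<and> fst (snd K) = F \<and> q \<in> cell_nodes K}"

lemma face_equations_eq:
  "face_equations F = (\<lambda>((T, m), q). ((T, F, m), q)) `
     (SIGMA (T, m):{T\<in>M. F facet_of T} \<times> verts F. cell_nodes (T, F, m))"
  by (force simp: face_equations_def cells_def)

lemma card_face_equations:
  assumes "F \<in> mesh_faces M"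
  shows "finite (face_equations F)" "card (face_equations F) \<le> 12 * card {T\<in>M. F facet_of T}"
proof -
  let ?A = "{T\<in>M. F facet_of T} \<times> verts F"
  let ?S = "SIGMA (T, m):?A. cell_nodes (T, F, m)"
  have fin: "finite ?A" using finite_M mesh_face_verts(2)[OF assms] by simp
  have K: "(T, F, m) \<in> cells" if "(T, m) \<in> ?A" for T m using that by (auto simp: cells_def)
  have f: "\<forall>a\<in>?A. finite (case a of (T, m) \<Rightarrow> cell_nodes (T, F, m))"
    using K finite_cell_nodes by auto
  show "finite (face_equations F)"
    unfolding face_equations_eq by (intro finite_imageI finite_SigmaI fin) (use f in auto)
  have "card ?S = (\<Sum>a\<in>?A. card (case a of (T, m) \<Rightarrow> cell_nodes (T, F, m)))"
    by (rule card_SigmaI[OF fin f])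
  also have "\<dots> = (\<Sum>a\<in>?A. 4)"
    using K card_cell_nodes by (intro sum.cong) auto
  also have "\<dots> = 12 * card {T\<in>M. F facet_of T}"
    using mesh_face_verts(1)[OF assms] by (simp add: card_cartesian_product)
  finally have cS: "card ?S = 12 * card {T\<in>M. F facet_of T}" .
  have "finite ?S" by (intro finite_SigmaI fin) (use f in auto)
  then show "card (face_equations F) \<le> 12 * card {T\<in>M. F facet_of T}"
    unfolding face_equations_eq cS[symmetric] by (rule card_image_le)
qed

text \<open>Of the 24 equations at the cells of an interior face, five follow from the others: on one side
  of the face two of the three equations at the face point, and one of the two equations at each
  vertex of the face.\<close>

lemma reduced_face_equations:
  assumes FM: "F \<in> mesh_faces M"
  shows "\<exists>B\<subseteq>face_equations F. card B \<le> 7 * card {T\<in>M. F facet_of T} + 5 \<and>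
    (\<forall>c. (\<forall>(K, q)\<in>B. cell_divergence c K q = 0) \<longrightarrow>
         (\<forall>(K, q)\<in>face_equations F. cell_divergence c K q = 0))"
proof (cases "card {T\<in>M. F facet_of T} = 2")
  case False
  have "{T\<in>M. F facet_of T} \<noteq> {}" using FM by (auto simp: mesh_faces_def)
  then have "card {T\<in>M. F facet_of T} = 1"
    using False card_facet_le_2[of F] finite_M card_gt_0_iff[of "{T\<in>M. F facet_of T}"] by auto
  then show ?thesis using card_face_equations[OF FM] by (intro exI[of _ "face_equations F"]) auto
next
  case True
  then obtain T S where TS: "{T\<in>M. F facet_of T} = {T, S}" "T \<noteq> S"
    by (auto simp: card_2_iff)
  then have T: "T \<in> M" "F facet_of T" and S: "S \<in> M" "F facet_of S" by blast+
  obtain m0 m1 m2 where m: "verts F = {m0, m1, m2}" "m0 \<noteq> m1" "m0 \<noteq> m2" "m1 \<noteq> m2"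
    using mesh_face_verts(1)[OF FM] by (auto simp: card_3_iff)
  have ym: "y F \<noteq> m0" "y F \<noteq> m1" "y F \<noteq> m2"
    using cell_nodes_distinct(2)[of T F m0] T m by (auto simp: cells_def)
  \<comment> \<open>equations on the side of \<open>S\<close> that follow from those of \<open>T\<close> and the remaining ones of \<open>S\<close>\<close>
  define Dr where "Dr = {((S, F, m1), y F), ((S, F, m2), y F), ((S, F, m1), m0), ((S, F, m2), m1), ((S, F, m0), m2)}"
  have Dr: "Dr \<subseteq> face_equations F" "card Dr = 5"
    using S m ym by (auto simp: Dr_def face_equations_def cells_def cell_nodes_def)
  have "card (face_equations F - Dr) = card (face_equations F) - 5"
    using Dr finite_subset[OF Dr(1) card_face_equations(1)[OF FM]] by (simp add: card_Diff_subset)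
  then have "card (face_equations F - Dr) \<le> 7 * card {T\<in>M. F facet_of T} + 5"
    using card_face_equations(2)[OF FM] True by simp
  moreover have "\<forall>(K, q)\<in>face_equations F. cell_divergence c K q = 0"
    if c: "\<forall>(K, q)\<in>face_equations F - Dr. cell_divergence c K q = 0" for c
  proof -
    have R: "cell_divergence c (T, F, m) x - cell_divergence c (T, F, m') x =
      cell_divergence c (S, F, m) x - cell_divergence c (S, F, m') x"
      if "m \<in> verts F" "m' \<in> verts F" "m \<noteq> m'" "x \<in> insert (y F) (verts F - {m, m'})" for m m' x
      using singular_edge_divergence[OF T S TS(2) that] .
    have zero: "cell_divergence c (X, F, m) q = 0"
      if "X \<in> {T, S}" "m \<in> verts F" "q \<in> insert (y F) (verts F - {m})" "((X, F, m), q) \<notin> Dr" for X m q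
    proof -
      have "((X, F, m), q) \<in> face_equations F - Dr"
        using that T S by (auto simp: face_equations_def cells_def cell_nodes_def)
      then show ?thesis using c by blast
    qed
    have T0: "cell_divergence c (T, F, m) q = 0" if "m \<in> verts F" "q \<in> insert (y F) (verts F - {m})" for m q
      using zero[of T m q] that TS(2) by (auto simp: Dr_def)
    have y1: "cell_divergence c (S, F, m1) (y F) = 0"
      using R[of m1 m0 "y F"] T0[of m1 "y F"] T0[of m0 "y F"] zero[of S m0 "y F"] m ym
      by (auto simp: Dr_def)
    have y2: "cell_divergence c (S, F, m2) (y F) = 0"
      using R[of m2 m0 "y F"] T0[of m2 "y F"] T0[of m0 "y F"] zero[of S m0 "y F"] m ym
      by (auto simp: Dr_def)
    have v0: "cell_divergence c (S, F, m1) m0 = 0"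
      using R[of m1 m2 m0] T0[of m1 m0] T0[of m2 m0] zero[of S m2 m0] m ym by (auto simp: Dr_def)
    have v1: "cell_divergence c (S, F, m2) m1 = 0"
      using R[of m2 m0 m1] T0[of m2 m1] T0[of m0 m1] zero[of S m0 m1] m ym by (auto simp: Dr_def)
    have v2: "cell_divergence c (S, F, m0) m2 = 0"
      using R[of m0 m1 m2] T0[of m0 m2] T0[of m1 m2] zero[of S m1 m2] m ym by (auto simp: Dr_def)
    show ?thesis
    proof (intro ballI, clarify)
      fix X G m' q assume a: "((X, G, m'), q) \<in> face_equations F"
      show "cell_divergence c (X, G, m') q = 0"
      proof (cases "((X, G, m'), q) \<in> Dr")
        case True
        then show ?thesis using y1 y2 v0 v1 v2 by (auto simp: Dr_def)
      next
        case False
        then show ?thesis using c a by blast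
      qed
    qed
  qed
  ultimately show ?thesis by (intro exI[of _ "face_equations F - Dr"]) auto
qed

lemma sum_card_facets: "(\<Sum>F\<in>mesh_faces M. card {T\<in>M. F facet_of T}) = 4 * card M"
proof -
  have "(\<Sum>F\<in>mesh_faces M. card {T\<in>M. F facet_of T}) = (\<Sum>T\<in>M. card {F\<in>mesh_faces M. F facet_of T})"
    by (rule sum_multicount_gen) (use finite_mesh_faces finite_M in auto)
  also have "\<dots> = (\<Sum>T\<in>M. 4)"
  proof (rule sum.cong)
    fix T assume T: "T \<in> M"
    then have "{F\<in>mesh_faces M. F facet_of T} = {F. F facet_of T}" by (auto simp: mesh_faces_def)
    then show "card {F\<in>mesh_faces M. F facet_of T} = 4" using card_facets[OF T] by simp
  qed simp
  finally show ?thesis by simp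
qed

lemma card_M_le_faces: "2 * card M \<le> card (mesh_faces M)"
proof -
  have "4 * card M \<le> (\<Sum>F\<in>mesh_faces M. 2)"
    unfolding sum_card_facets[symmetric] by (intro sum_mono card_facet_le_2)
  then show ?thesis by simp
qed

text \<open>The \<open>n\<close> tetrahedra at a face contribute at most \<open>7 n + 5\<close> equations, hence \<open>28 T + 5 F\<close> equations suffice
  for the \<open>3 (V + E + 4 F + 9 T)\<close> coefficients; \<open>2 T \<le> F\<close> eliminates \<open>F\<close> from the difference.\<close>

lemma independent_Z_space_family:
  obtains I :: "((real^3) set \<times> 3) set" and v where "finite I"
    "3 * card (mesh_vertices M) + 3 * card (mesh_edges M) + 13 * card M \<le> card I"
    "\<And>k. k \<in> I \<Longrightarrow> v k \<in> Z_space \<Omega> 2 (cell ` cells)"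
    "\<And>d. (\<forall>K\<in>cells. \<forall>x\<in>cell K. (\<Sum>k\<in>I. d k *\<^sub>R v k x) = 0) \<Longrightarrow> \<forall>k\<in>I. d k = 0"
proof -
  let ?n = "\<lambda>F. card {T\<in>M. F facet_of T}"
  have "\<forall>F\<in>mesh_faces M. \<exists>B. B \<subseteq> face_equations F \<and> card B \<le> 7 * ?n F + 5 \<and>
    (\<forall>c. (\<forall>(K, q)\<in>B. cell_divergence c K q = 0) \<longrightarrow>
         (\<forall>(K, q)\<in>face_equations F. cell_divergence c K q = 0))"
    by (intro ballI reduced_face_equations)
  from bchoice[OF this] obtain B where
    "\<forall>F\<in>mesh_faces M. B F \<subseteq> face_equations F \<and> card (B F) \<le> 7 * ?n F + 5 \<and>
    (\<forall>c. (\<forall>(K, q)\<in>B F. cell_divergence c K q = 0) \<longrightarrow>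
         (\<forall>(K, q)\<in>face_equations F. cell_divergence c K q = 0))" ..
  note B' = bspec[OF this]
  have B: "\<And>F. F \<in> mesh_faces M \<Longrightarrow> B F \<subseteq> face_equations F"
      "\<And>F. F \<in> mesh_faces M \<Longrightarrow> card (B F) \<le> 7 * ?n F + 5"
    using B' by simp_all
  have B3: "\<forall>(K, q)\<in>face_equations F. cell_divergence c K q = 0"
    if "F \<in> mesh_faces M" "\<forall>(K, q)\<in>B F. cell_divergence c K q = 0" for F c
    using B'[OF that(1)] that(2) by simp
  let ?B = "\<Union>F\<in>mesh_faces M. B F" and ?A = "split_simplices \<times> (UNIV :: 3 set)"
  have finB: "finite ?B"
    using finite_mesh_faces B(1) card_face_equations(1) finite_subset by blast
  have "card ?B \<le> (\<Sum>F\<in>mesh_faces M. card (B F))"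
    by (rule card_UN_le[OF finite_mesh_faces])
  also have "\<dots> \<le> (\<Sum>F\<in>mesh_faces M. 7 * ?n F + 5)" by (rule sum_mono) (rule B(2))
  also have "\<dots> = 28 * card M + 5 * card (mesh_faces M)"
    using sum_card_facets by (simp add: sum.distrib sum_distrib_left[symmetric])
  finally have cB: "card ?B \<le> 28 * card M + 5 * card (mesh_faces M)" .
  have finA: "finite ?A" using finite_split_simplices by simp
  have cA: "card ?A = 3 * card split_simplices" by (simp add: card_cartesian_product)
  obtain I c where I: "finite I" "card ?A \<le> card I + card ?B"
    and ker: "\<forall>k\<in>I. \<forall>b\<in>?B. (\<Sum>a\<in>?A. c k a * basis_slope (fst b) (fst a) (snd b) (axis (snd a) 1)) = 0"
    and ind: "\<forall>d :: (real^3) set \<times> 3 \<Rightarrow> real. (\<forall>a\<in>?A. (\<Sum>k\<in>I. d k * c k a) = 0) \<longrightarrow> (\<forall>k\<in>I. d k = 0)"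
    using kernel_family[OF finB finA, of "\<lambda>a b. basis_slope (fst b) (fst a) (snd b) (axis (snd a) 1)"]
    by blast
  show ?thesis
  proof (rule that[of I "\<lambda>k. field (c k)"])
    show "finite I" by fact
    show "3 * card (mesh_vertices M) + 3 * card (mesh_edges M) + 13 * card M \<le> card I"
      using I(2) cB cA card_split_simplices card_M_le_faces by linarith
    show "field (c k) \<in> Z_space \<Omega> 2 (cell ` cells)" if k: "k \<in> I" for k
    proof (rule field_in_Z_space, intro ballI)
      fix K q assume K: "K \<in> cells" "q \<in> cell_nodes K"
      define F where "F = fst (snd K)"
      have F: "F \<in> mesh_faces M" using K(1) cellsD by (cases K) (auto simp: F_def)
      have "\<forall>(K, q)\<in>B F. cell_divergence (c k) K q = 0"
      proof (intro ballI, clarify)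
        fix X G m p assume "((X, G, m), p) \<in> B F"
        then have "((X, G, m), p) \<in> ?B" using F by blast
        then show "cell_divergence (c k) (X, G, m) p = 0"
          using bspec[OF bspec[OF ker k], of "((X, G, m), p)"] by (simp add: cell_divergence_def)
      qed
      from bspec[OF B3[OF F this], of "(K, q)"] show "cell_divergence (c k) K q = 0"
        using K by (simp add: face_equations_def F_def)
    qed
    show "\<forall>k\<in>I. d k = 0" if d: "\<forall>K\<in>cells. \<forall>x\<in>cell K. (\<Sum>k\<in>I. d k *\<^sub>R field (c k) x) = 0"
      for d :: "(real^3) set \<times> 3 \<Rightarrow> real"
    proof -
      have "(\<Sum>k\<in>I. d k *\<^sub>R field (c k) x) = field (\<lambda>a. \<Sum>k\<in>I. d k * c k a) x" for x
      proof -
        have "(\<Sum>k\<in>I. d k * (\<Sum>s\<in>split_simplices. c k (s, i) * basis_function s x)) =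
          (\<Sum>s\<in>split_simplices. (\<Sum>k\<in>I. d k * c k (s, i)) * basis_function s x)" for i
          by (simp add: sum_distrib_left sum_distrib_right mult.assoc sum.swap[of _ I])
        then show ?thesis by (simp add: field_def vec_eq_iff)
      qed
      then have "\<forall>K\<in>cells. \<forall>x\<in>cell K. field (\<lambda>a. \<Sum>k\<in>I. d k * c k a) x = 0" using d by simp
      from field_coefficients_0[OF this] have "\<forall>a\<in>?A. (\<Sum>k\<in>I. d k * c k a) = 0" by auto
      then show ?thesis using ind by blast
    qed
  qed
qed

end

section \<open>Unisolvence of Hermite data for smooth cubic fields\<close>

context WF_complex begin

lemma cell_subset_closure: "K \<in> cells \<Longrightarrow> cell K \<subseteq> closure \<Omega>"
  using cell_subset cellsD M_subset_closure by (cases K) blast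

lemma cell_subset_closure_interior:
  assumes "K \<in> cells"
  shows "cell K \<subseteq> closure (interior (cell K) \<inter> \<Omega>)"
proof -
  have "closure (interior (cell K)) = closure (cell K)"
    using affine_frame_interior_nonempty[OF cell_frame[OF assms]] by (intro convex_closure_interior) auto
  then have "cell K \<subseteq> closure (interior (cell K))" using closure_subset by simp
  also have "interior (cell K) \<subseteq> closure (interior (cell K) \<inter> \<Omega>)"
    using open_Int_closure_subset[of "interior (cell K)" \<Omega>] cell_subset_closure[OF assms] interior_subset
    by blast
  then have "closure (interior (cell K)) \<subseteq> closure (interior (cell K) \<inter> \<Omega>)"
    by (rule closure_minimal) simp
  finally show ?thesis .
qed

text \<open>The interior of a cell need not lie in the domain, but the domain is dense in it, and both the Jacobian
  and the gradient of the polynomial are continuous up to the boundary of the cell.\<close>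

lemma jacobian_on_cell:
  fixes g :: "3 \<Rightarrow> real^3 \<Rightarrow> real"
  assumes J: "has_jacobian_on_closure \<Omega> s J" and K: "K \<in> cells" "x \<in> cell K"
    and p: "\<And>x. (p has_derivative (\<lambda>h. \<Sum>j\<in>UNIV. g j x * h $ j)) (at x)"
    and g: "\<And>j. continuous_on UNIV (g j)" and s: "\<And>x. x \<in> cell K \<Longrightarrow> s x $ i = p x"
  shows "J x $ i $ j = g j x"
proof -
  let ?S = "interior (cell K) \<inter> \<Omega>"
  have "J x $ i $ j - g j x = 0"
  proof (rule continuous_constant_on_closure[of ?S "\<lambda>x. J x $ i $ j - g j x"])
    have "closure ?S \<subseteq> closure \<Omega>" by (intro closure_mono) auto
    then have "continuous_on (closure ?S) J"
      using J continuous_on_subset unfolding has_jacobian_on_closure_def by blast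
    then show "continuous_on (closure ?S) (\<lambda>x. J x $ i $ j - g j x)"
      by (intro continuous_on_diff continuous_on_component) (use continuous_on_subset[OF g] in auto)
    show "x \<in> closure ?S" using cell_subset_closure_interior[OF K(1)] K(2) by auto
    fix u assume u: "u \<in> ?S"
    have "(s has_derivative (\<lambda>h. J u *v h)) (at u)"
      using J u unfolding has_jacobian_on_closure_def by blast
    then have "((\<lambda>x. s x $ i) has_derivative (\<lambda>h. (J u *v h) $ i)) (at u)"
      by (rule bounded_linear.has_derivative[OF bounded_linear_vec_nth])
    moreover have "((\<lambda>x. s x $ i) has_derivative (\<lambda>h. \<Sum>j\<in>UNIV. g j u * h $ j)) (at u)"
    proof (rule has_derivative_transform_within_open[OF p open_interior])
      show "u \<in> interior (cell K)" using u by blast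
      fix v assume "v \<in> interior (cell K)"
      then show "p v = s v $ i" using s[of v] interior_subset by fastforce
    qed
    ultimately have "(\<lambda>h. (J u *v h) $ i) = (\<lambda>h. \<Sum>j\<in>UNIV. g j u * h $ j)"
      by (rule has_derivative_unique)
    from fun_cong[OF this, of "axis j 1"]
    have "(J u *v axis j 1) $ i = (\<Sum>l\<in>UNIV. g l u * axis j 1 $ l)" .
    moreover have "(\<Sum>l\<in>UNIV. g l u * axis j 1 $ l) = g j u"
      by (simp add: axis_def if_distrib[of "\<lambda>t. _ * t"] cong: if_cong)
    ultimately show "J u $ i $ j - g j u = 0" by (simp add: matrix_vector_mult_basis column_def)
  qed
  then show ?thesis by simp
qed

lemma V_space_cell_polynomial:
  assumes "s \<in> V_space \<Omega> k (cell ` cells)" "K \<in> cells"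
  shows "\<exists>p. polynomial_of_degree_le k p \<and> (\<forall>x\<in>cell K. s x $ i = p x)"
  using assms unfolding V_space_def by simp

lemma cubic_cell_jacobian:
  assumes "s \<in> V_space \<Omega> 3 (cell ` cells)" "has_jacobian_on_closure \<Omega> s J" "K \<in> cells"
  shows "\<exists>p g H. quadratic_gradient p g H \<and> (\<forall>x\<in>cell K. \<forall>j. J x $ i $ j = g j x)"
proof -
  obtain p where p: "polynomial_of_degree_le 3 p" "\<forall>x\<in>cell K. s x $ i = p x"
    using V_space_cell_polynomial[OF assms(1,3), of i] by auto
  obtain g H where g: "quadratic_gradient p g H" using cubic_quadratic_gradient[OF p(1)] by blast
  have "J x $ i $ j = g j x" if "x \<in> cell K" for x j
    by (rule jacobian_on_cell[OF assms(2,3) that quadratic_gradientD(2,5)[OF g] bspec[OF p(2)]])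
  then show ?thesis using g by blast
qed

text \<open>The value of the polar form at two equal points of a cell and an arbitrary third point,
  expressed by the value and the gradient of the field.\<close>

definition hermite_value ::
    "(real^3 \<Rightarrow> real^3) \<Rightarrow> (real^3 \<Rightarrow> real^3^3) \<Rightarrow> real^3 \<Rightarrow> real^3 \<Rightarrow> real^3" where
  "hermite_value s J x w = s x + (1/3) *\<^sub>R (J x *v (w - x))"

lemma affine_hermite_value: "affine_functional (\<lambda>w. hermite_value s J x w $ i)"
proof -
  have "affine_functional (\<lambda>w :: real^3. w $ j)" for j
    using affine_functional_inner[of "axis j 1 :: real^3"] by (simp add: inner_axis')
  then have "affine_functional (\<lambda>w. \<Sum>j\<in>UNIV. J x $ i $ j * (w $ j - x $ j))"
    by (intro affine_functional_sum affine_functional_cmult affine_functional_diff affine_functional_const)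
  then have "affine_functional (\<lambda>w. s x $ i + 1/3 * (\<Sum>j\<in>UNIV. J x $ i $ j * (w $ j - x $ j)))"
    by (intro affine_functional_add affine_functional_cmult affine_functional_const)
  then show ?thesis by (simp add: hermite_value_def matrix_vector_mult_def)
qed

lemma cell_polar_form:
  assumes "s \<in> V_space \<Omega> 3 (cell ` cells)" "has_jacobian_on_closure \<Omega> s J" "K \<in> cells"
  shows "\<exists>p B. polar_form p B \<and> (\<forall>x\<in>cell K. \<forall>w. B x x w = hermite_value s J x w $ i)"
proof -
  obtain p where p: "polynomial_of_degree_le 3 p" "\<forall>x\<in>cell K. s x $ i = p x"
    using V_space_cell_polynomial[OF assms(1,3), of i] by auto
  obtain B where B: "polar_form p B" using cubic_polar_form[OF p(1)] ..
  obtain g H where g: "quadratic_gradient p g H" using cubic_quadratic_gradient[OF p(1)] by blast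
  have "B x x w = hermite_value s J x w $ i" if x: "x \<in> cell K" for x w
  proof -
    have "(p has_derivative (\<lambda>h. 3 * (B x x (x + h) - B x x x))) (at x)"
      using B unfolding polar_form_def by simp
    from has_derivative_unique[OF this quadratic_gradientD(2)[OF g]]
    have "3 * (B x x (x + (w - x)) - B x x x) = (\<Sum>j\<in>UNIV. g j x * (w - x) $ j)" by (rule fun_cong)
    also have "\<dots> = (J x *v (w - x)) $ i"
      using jacobian_on_cell[OF assms(2,3) x quadratic_gradientD(2,5)[OF g] bspec[OF p(2)]]
      by (simp add: matrix_vector_mult_def)
    finally have "B x x w = B x x x + (J x *v (w - x)) $ i / 3" by simp
    moreover have "B x x x = s x $ i" using B bspec[OF p(2) x] unfolding polar_form_def by simp
    ultimately show ?thesis by (simp add: hermite_value_def)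
  qed
  then show ?thesis using B by blast
qed

text \<open>Value and gradient at the vertices of the mesh and two transversal derivatives at each edge
  midpoint, encoded as values at four, respectively two, vertices of a tetrahedron. Together with
  the data at its end points the two values at an edge midpoint determine the gradient there,
  since they complete the edge to a tetrahedron.\<close>

definition dof_points :: "((real^3) \<times> (real^3)) set" where
  "dof_points = (SIGMA p:mesh_vertices M. verts (SOME T. T \<in> M \<and> p \<in> verts T)) \<union>
     (\<Union>e\<in>mesh_edges M. {\<Sum>p\<in>verts e. (1/2) *\<^sub>R p} \<times> (verts (SOME T. T \<in> M \<and> e edge_of T) - verts e))"

lemma vertex_tet: "p \<in> mesh_vertices M \<Longrightarrow> (SOME T. T \<in> M \<and> p \<in> verts T) \<in> M \<and> p \<in> verts (SOME T. T \<in> M \<and> p \<in> verts T)"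
  by (rule someI_ex) (auto simp: mesh_vertices_eq)

lemma edge_tet: "e \<in> mesh_edges M \<Longrightarrow> (SOME T. T \<in> M \<and> e edge_of T) \<in> M \<and> e edge_of (SOME T. T \<in> M \<and> e edge_of T)"
  by (rule someI_ex) (auto simp: mesh_edges_def)

lemma card_dof_points:
  "finite dof_points" "card dof_points \<le> 4 * card (mesh_vertices M) + 2 * card (mesh_edges M)"
proof -
  let ?A = "SIGMA p:mesh_vertices M. verts (SOME T. T \<in> M \<and> p \<in> verts T)"
  let ?b = "\<lambda>e. {\<Sum>p\<in>verts e. (1/2) *\<^sub>R p} \<times> (verts (SOME T. T \<in> M \<and> e edge_of T) - verts e)"
  have fA: "\<forall>p\<in>mesh_vertices M. finite (verts (SOME T. T \<in> M \<and> p \<in> verts T))"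
    using vertex_tet finite_verts by blast
  have "card ?A = (\<Sum>p\<in>mesh_vertices M. card (verts (SOME T. T \<in> M \<and> p \<in> verts T)))"
    by (rule card_SigmaI[OF finite_mesh_vertices fA])
  also have "\<dots> = (\<Sum>p\<in>mesh_vertices M. 4)"
    using vertex_tet card_verts by (intro sum.cong) blast+
  finally have cA: "card ?A = 4 * card (mesh_vertices M)" by simp
  have finA: "finite ?A" by (intro finite_SigmaI finite_mesh_vertices) (use fA in auto)
  have b: "finite (?b e) \<and> card (?b e) = 2" if e: "e \<in> mesh_edges M" for e
  proof -
    let ?T = "SOME T. T \<in> M \<and> e edge_of T"
    have T: "?T \<in> M" "e edge_of ?T" using edge_tet[OF e] by auto
    note ve = verts_edge[OF simplex_M[OF T(1)] T(2)]
    have "finite (verts e)" using finite_subset[OF ve(1) finite_verts[OF T(1)]] .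
    then have "card (verts ?T - verts e) = 2"
      using ve card_verts[OF T(1)] by (simp add: card_Diff_subset)
    then show ?thesis using finite_verts[OF T(1)] by (simp add: card_cartesian_product)
  qed
  have "card (\<Union>e\<in>mesh_edges M. ?b e) \<le> (\<Sum>e\<in>mesh_edges M. card (?b e))"
    by (rule card_UN_le[OF finite_mesh_edges])
  also have "\<dots> = 2 * card (mesh_edges M)" using b by simp
  finally have cB: "card (\<Union>e\<in>mesh_edges M. ?b e) \<le> 2 * card (mesh_edges M)" .
  show "finite dof_points" unfolding dof_points_def using finA b finite_mesh_edges by blast
  show "card dof_points \<le> 4 * card (mesh_vertices M) + 2 * card (mesh_edges M)"
    unfolding dof_points_def
    using card_Un_le[of ?A "\<Union>e\<in>mesh_edges M. ?b e"] cA cB by linarith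
qed

lemma affine_functional_eq_0_facet:
  assumes "affine_functional f" "T \<in> M" "F facet_of T" "f (z T) = 0" "\<And>p. p \<in> verts F \<Longrightarrow> f p = 0"
  shows "f w = 0"
proof -
  have FM: "F \<in> mesh_faces M" using facet_in_mesh_faces assms by blast
  have "verts F \<noteq> {}" using facet_verts(2)[OF assms(2,3)] by auto
  then obtain m where m: "m \<in> verts F" by blast
  have K: "(T, F, m) \<in> cells" using assms m by (simp add: cells_def)
  have yT: "y F \<in> T" using y_in[OF FM] facet_of_imp_subset[OF assms(3)] by auto
  have "f (y F) = (\<Sum>p\<in>verts T. bary (verts T) p (y F) * f p)"
    by (rule affine_functional_bary_expansion[OF assms(1) frame[OF assms(2)]])
  also have "\<dots> = 0"
  proof (rule sum.neutral, rule ballI)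
    fix p assume p: "p \<in> verts T"
    show "bary (verts T) p (y F) * f p = 0"
      using assms(5)[of p] coord_y_eq_0[OF FM, of p] coord_eq[OF assms(2) yT, of p] p
      by (cases "p \<in> verts F") auto
  qed
  finally have "f (y F) = 0" .
  then show ?thesis
    using affine_functional_eq_0[OF assms(1) cell_frame[OF K], of w] assms(4,5)
    by (auto simp: cell_nodes_def)
qed

text \<open>The third argument of the polar form at two nodes is unrestricted, because the gradient along
  the segment between the nodes is that of a differentiable field. Each step below shows that it
  vanishes at four affinely independent nodes, by symmetry and the previous steps.\<close>

lemma unisolvence:
  assumes s: "s \<in> V_space \<Omega> 3 (cell ` cells)" and J: "has_jacobian_on_closure \<Omega> s J"
    and dof: "\<And>x w. (x, w) \<in> dof_points \<Longrightarrow> hermite_value s J x w = 0"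
    and x: "K \<in> cells" "x \<in> cell K"
  shows "J x = 0"
proof -
  have main: "hermite_value s J x w $ i = 0" if x: "K \<in> cells" "x \<in> cell K" for i K x w
  proof -
    define G where "G x w = hermite_value s J x w $ i" for x w
    have affG: "affine_functional (G x)" for x
      unfolding G_def[abs_def] by (rule affine_hermite_value)
    define H where "H a b w = 2 * G (midpoint a b) w - G a w / 2 - G b w / 2" for a b w
    have affH: "affine_functional (H a b)" for a b
      unfolding H_def[abs_def]
      by (intro affine_functional_diff affine_functional_cmult affine_functional_divide affG)
    have H1: "H a b w = H b a w" for a b w by (simp add: H_def midpoint_sym)
    have polar: "\<exists>B. (\<forall>u v. affine_functional (B u v)) \<and> (\<forall>u v w. B u v w = B u w v) \<and>
        (\<forall>x\<in>cell K. \<forall>w. B x x w = G x w) \<and> (\<forall>a\<in>cell K. \<forall>b\<in>cell K. \<forall>w. B a b w = H a b w)"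
      if K: "K \<in> cells" for K
    proof -
      from cell_polar_form[OF s J K, of i]
      obtain p B where pB: "polar_form p B" and B': "\<forall>x\<in>cell K. \<forall>w. B x x w = G x w"
        unfolding G_def[symmetric] by blast
      have B: "affine_functional (B u v)" "B u v w = B v u w" "B u v w = B u w v" for u v w
        using pB unfolding polar_form_def by blast+
      have B4: "B x x w = G x w" if "x \<in> cell K" for x w using B' that by blast
      have "B a b w = H a b w" if ab: "a \<in> cell K" "b \<in> cell K" for a b w
      proof -
        have m: "midpoint a b \<in> cell K"
          using ab midpoint_in_closed_segment closed_segment_subset[OF _ _ convex_convex_hull] by blast
        let ?m = "midpoint a b"
        have mid: "B u v ?m = (B u v a + B u v b) / 2" for u v
          by (rule affine_functional_midpoint[OF B(1)])
        have cyc: "B w u v = B u v w" for u v using B(2)[of w u v] B(3)[of u w v] by simp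
        have "B w ?m ?m = (B w a ?m + B w b ?m) / 2"
          using mid[of w ?m] B(3)[of w ?m a] B(3)[of w ?m b] by simp
        also have "\<dots> = (B w a a + B w a b + B w b a + B w b b) / 4"
          unfolding mid[of w a] mid[of w b] by (simp add: add_divide_distrib)
        finally have "B ?m ?m w = (B a a w + 2 * B a b w + B b b w) / 4"
          unfolding cyc B(2)[of b a] by simp
        then show ?thesis
          using B4[OF m] B4[OF ab(1)] B4[OF ab(2)] by (simp add: H_def)
      qed
      then show ?thesis using B' B by (intro exI[of _ B]) blast
    qed
    have perm: "H a b c = H a c b" if Kabc: "K \<in> cells" "a \<in> cell_nodes K" "b \<in> cell_nodes K" "c \<in> cell_nodes K"
      for K a b c
    proof -
      obtain B where B: "\<forall>u v w. B u v w = B u w v" "\<forall>a\<in>cell K. \<forall>b\<in>cell K. \<forall>w. B a b w = H a b w"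
        using polar[OF Kabc(1)] by blast
      have abc: "a \<in> cell K" "b \<in> cell K" "c \<in> cell K" using Kabc(2-4) hull_inc by metis+
      have "H a b c = B a b c" "H a c b = B a c b" using B(2) abc by simp_all
      then show ?thesis using B(1) by simp
    qed
    have Gv: "G p w = 0" if p: "p \<in> mesh_vertices M" for p w
    proof -
      let ?T = "SOME T. T \<in> M \<and> p \<in> verts T"
      have "G p q = 0" if "q \<in> verts ?T" for q
        using dof[of p q] that p by (auto simp: dof_points_def G_def)
      then show ?thesis using affine_functional_eq_0[OF affG frame] vertex_tet[OF p] by blast
    qed
    have Hpp: "H p p w = 0" if "p \<in> mesh_vertices M" for p w
      using Gv[OF that] by (simp add: H_def)
    have vM: "p \<in> mesh_vertices M" if "T \<in> M" "p \<in> verts T" for T p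
      using that by (auto simp: mesh_vertices_eq)
    have Hpq: "H p q w = 0" if T: "T \<in> M" and p: "p \<in> verts T" and q: "q \<in> verts T" for T p q w
    proof (cases "p = q")
      case True
      then show ?thesis using Hpp vM T p by blast
    next
      case False
      define e where "e = convex hull {p, q}"
      have e: "e edge_of T"
        unfolding edge_of_simplex3[OF simplex_M[OF T]] e_def using p q False by (intro exI[of _ "{p, q}"]) auto
      have ve: "verts e = {p, q}"
        unfolding e_def using verts_convex_hull_frame[OF frame[OF T], of "{p, q}"] p q by auto
      have eM: "e \<in> mesh_edges M" using e T by (auto simp: mesh_edges_def)
      let ?S = "SOME T. T \<in> M \<and> e edge_of T"
      have S: "?S \<in> M" "e edge_of ?S" using edge_tet[OF eM] by auto
      have pqM: "p \<in> mesh_vertices M" "q \<in> mesh_vertices M" using vM T p q by auto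
      have mid: "(\<Sum>p\<in>verts e. (1/2) *\<^sub>R p) = midpoint p q"
        using False by (simp add: ve midpoint_def scaleR_right_distrib)
      obtain F m where K: "(T, F, m) \<in> cells" "{p, q} \<subseteq> cell_nodes (T, F, m)"
        using in_some_cell[OF T, of "{p, q}"] p q False by auto
      have "H p q v = 0" if v: "v \<in> verts ?S" for v
      proof -
        consider "v = p" | "v = q" | "v \<notin> verts e" using ve by blast
        then show ?thesis
        proof cases
          case 1
          then show ?thesis using perm[OF K(1), of p q p] K(2) Hpp[OF pqM(1)] by auto
        next
          case 2
          then show ?thesis using perm[OF K(1), of q p q] H1[of p q q] K(2) Hpp[OF pqM(2)] by auto
        next
          case 3
          then have "(midpoint p q, v) \<in> dof_points"
            unfolding dof_points_def mid[symmetric] using v eM by blast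
          then have "G (midpoint p q) v = 0" using dof by (simp add: G_def)
          then show ?thesis using Gv pqM by (simp add: H_def)
        qed
      qed
      then show ?thesis using affine_functional_eq_0[OF affH frame[OF S(1)]] by blast
    qed
    have card2: "card {p, q} \<le> 2" for p q :: "real^3" by (simp add: card_insert_if)
    have Hzp: "H (z T) p w = 0" if T: "T \<in> M" "p \<in> verts T" for T p w
    proof (rule affine_functional_eq_0[OF affH frame[OF T(1)]])
      fix q assume q: "q \<in> verts T"
      obtain F m where K: "(T, F, m) \<in> cells" "{p, q} \<subseteq> cell_nodes (T, F, m)"
        using in_some_cell[OF T(1) _ card2, of p q] T(2) q by auto
      have zK: "z T \<in> cell_nodes (T, F, m)" by (simp add: cell_nodes_def)
      have "H (z T) p q = H p q (z T)"
        using perm[OF K(1), of p "z T" q] H1[of "z T" p q] zK K(2) by auto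
      then show "H (z T) p q = 0" using Hpq T q by simp
    qed
    have Hzz: "H (z T) (z T) w = 0" if T: "T \<in> M" for T w
    proof (rule affine_functional_eq_0[OF affH frame[OF T]])
      fix p assume p: "p \<in> verts T"
      obtain F m where K: "(T, F, m) \<in> cells" "{p} \<subseteq> cell_nodes (T, F, m)"
        using in_some_cell[OF T, of "{p}"] p by auto
      have zK: "z T \<in> cell_nodes (T, F, m)" by (simp add: cell_nodes_def)
      show "H (z T) (z T) p = 0"
        using perm[OF K(1), of "z T" "z T" p] zK K(2) Hzp[OF T p] by auto
    qed
    have fcell: "\<exists>m. (T, F, m) \<in> cells \<and> p \<in> cell_nodes (T, F, m) \<and> q \<in> cell_nodes (T, F, m) \<and>
        z T \<in> cell_nodes (T, F, m) \<and> y F \<in> cell_nodes (T, F, m)"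
      if "T \<in> M" "F facet_of T" "p \<in> verts F" "q \<in> verts F" for T F p q
    proof -
      have "\<not> verts F \<subseteq> {p, q}"
        using facet_verts(2)[OF that(1,2)] card_mono[of "{p, q}" "verts F"] card2[of p q] by auto
      then obtain m where "m \<in> verts F" "m \<notin> {p, q}" by blast
      then show ?thesis using \<open>T \<in> M\<close> \<open>F facet_of T\<close> \<open>p \<in> verts F\<close> \<open>q \<in> verts F\<close>
        by (intro exI[of _ m]) (auto simp: cells_def cell_nodes_def)
    qed
    have Hyp: "H (y F) p w = 0" if T: "T \<in> M" "F facet_of T" and p: "p \<in> verts F" for T F p w
    proof (rule affine_functional_eq_0_facet[OF affH T])
      have pT: "p \<in> verts T" using facet_verts(1)[OF T] p by auto
      obtain m where K: "(T, F, m) \<in> cells" "p \<in> cell_nodes (T, F, m)" "z T \<in> cell_nodes (T, F, m)"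
          "y F \<in> cell_nodes (T, F, m)" using fcell[OF T p p] by blast
      show "H (y F) p (z T) = 0"
        using perm[OF K(1), of p "y F" "z T"] H1[of "y F" p "z T"] H1[of p "z T" "y F"] K Hzp[OF T(1) pT]
        by simp
      fix q assume q: "q \<in> verts F"
      have qT: "q \<in> verts T" using facet_verts(1)[OF T] q by auto
      obtain m where K: "(T, F, m) \<in> cells" "p \<in> cell_nodes (T, F, m)" "q \<in> cell_nodes (T, F, m)"
          "y F \<in> cell_nodes (T, F, m)" using fcell[OF T p q] by blast
      show "H (y F) p q = 0"
        using perm[OF K(1), of p "y F" q] H1[of "y F" p q] K Hpq[OF T(1) pT qT] by simp
    qed
    have Hzy: "H (z T) (y F) w = 0" if T: "T \<in> M" "F facet_of T" for T F w
    proof (rule affine_functional_eq_0_facet[OF affH T])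
      have "verts F \<noteq> {}" using facet_verts(2)[OF T] by auto
      then obtain p where p: "p \<in> verts F" by blast
      obtain m where K: "(T, F, m) \<in> cells" "z T \<in> cell_nodes (T, F, m)"
          "y F \<in> cell_nodes (T, F, m)" using fcell[OF T p p] by blast
      show "H (z T) (y F) (z T) = 0"
        using perm[OF K(1), of "z T" "y F" "z T"] K Hzz[OF T(1)] by simp
      fix q assume q: "q \<in> verts F"
      have qT: "q \<in> verts T" using facet_verts(1)[OF T] q by auto
      obtain m where K: "(T, F, m) \<in> cells" "q \<in> cell_nodes (T, F, m)" "z T \<in> cell_nodes (T, F, m)"
          "y F \<in> cell_nodes (T, F, m)" using fcell[OF T q q] by blast
      show "H (z T) (y F) q = 0"
        using perm[OF K(1), of "z T" "y F" q] K Hzp[OF T(1) qT] by simp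
    qed
    have Hyy: "H (y F) (y F) w = 0" if T: "T \<in> M" "F facet_of T" for T F w
    proof (rule affine_functional_eq_0_facet[OF affH T])
      have "verts F \<noteq> {}" using facet_verts(2)[OF T] by auto
      then obtain p where p: "p \<in> verts F" by blast
      obtain m where K: "(T, F, m) \<in> cells" "z T \<in> cell_nodes (T, F, m)"
          "y F \<in> cell_nodes (T, F, m)" using fcell[OF T p p] by blast
      show "H (y F) (y F) (z T) = 0"
        using perm[OF K(1), of "y F" "y F" "z T"] H1[of "y F" "z T" "y F"] K Hzy[OF T] by simp
      fix q assume q: "q \<in> verts F"
      obtain m where K: "(T, F, m) \<in> cells" "q \<in> cell_nodes (T, F, m)" "y F \<in> cell_nodes (T, F, m)"
        using fcell[OF T q q] by blast
      show "H (y F) (y F) q = 0"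
        using perm[OF K(1), of "y F" "y F" q] K Hyp[OF T q] by simp
    qed
    have Hab: "H a b w = 0" if ab: "a \<in> cell_nodes K" "b \<in> cell_nodes K" for a b w
    proof -
      obtain T F m where Kf: "K = (T, F, m)" by (cases K)
      have T: "T \<in> M" "F facet_of T" using cellsD[OF x(1)[unfolded Kf]] by auto
      note vT = facet_verts(1)[OF T]
      have "a = z T \<or> a = y F \<or> a \<in> verts F" "b = z T \<or> b = y F \<or> b \<in> verts F"
        using ab by (auto simp: Kf cell_nodes_def)
      moreover have "H a b w = 0" if "a \<in> verts F" "b \<in> verts F" using Hpq[OF T(1)] that vT by blast
      moreover have "H (z T) b w = 0" if "b \<in> verts F" using Hzp[OF T(1)] that vT by blast
      moreover have "H a (z T) w = 0" if "a \<in> verts F" using Hzp[OF T(1)] that vT H1 by (metis subsetD)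
      moreover have "H (y F) b w = 0" if "b \<in> verts F" using Hyp[OF T that] .
      moreover have "H a (y F) w = 0" if "a \<in> verts F" using Hyp[OF T that] H1 by metis
      moreover have "H (z T) (y F) w = 0" "H (y F) (z T) w = 0" using Hzy[OF T] H1 by metis+
      ultimately show ?thesis using Hyy[OF T] Hzz[OF T(1)] by blast
    qed
    obtain C where C: "\<forall>u v. affine_functional (C u v)" "\<forall>u v w. C u v w = C u w v"
       "\<forall>x\<in>cell K. \<forall>w. C x x w = G x w" "\<forall>a\<in>cell K. \<forall>b\<in>cell K. \<forall>w. C a b w = H a b w"
      using polar[OF x(1)] by blast
    show ?thesis
    proof -
      let ?N = "cell_nodes K"
      have C0: "C a b w = 0" if "a \<in> ?N" "b \<in> ?N" for a b w
        using C(4) Hab[OF that] that hull_inc[of _ ?N convex] by metis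
      have Cx: "C a x w = 0" if a: "a \<in> ?N" for a w
      proof -
        have "C a w x = (\<Sum>b\<in>?N. bary ?N b x * C a w b)"
          using affine_functional_bary_expansion[of "C a w", OF _ cell_frame[OF x(1)]] C(1) by blast
        also have "\<dots> = 0"
          using C(2) C0[OF a] by (metis (no_types, lifting) mult_zero_right sum.neutral)
        finally show ?thesis using C(2) by metis
      qed
      have "C x a w = 0" if a: "a \<in> ?N" for a w
      proof -
        have aK: "a \<in> cell K" using a hull_inc by metis
        then show ?thesis using C(4) x(2) Cx[OF a] H1 by metis
      qed
      then have "C x w a = 0" if "a \<in> ?N" for a w using C(2) that by metis
      then have "C x w x = 0" for w
        using affine_functional_eq_0[of "C x w", OF _ cell_frame[OF x(1)]] C(1) by blast
      then have "C x x w = 0" for w using C(2) by metis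
      then show ?thesis using C(3) x(2) by (simp add: G_def)
    qed
  qed
  show ?thesis
  proof (rule vec_eq_iff[THEN iffD2], rule allI, rule vec_eq_iff[THEN iffD2], rule allI)
    fix i j
    have "hermite_value s J x x $ i = 0" "hermite_value s J x (x + axis j 1) $ i = 0"
      using main[OF x] by blast+
    then have "(J x *v axis j 1) $ i = 0" by (simp add: hermite_value_def)
    then show "J x $ i $ j = 0 $ i $ j" by (simp add: matrix_vector_mult_basis column_def)
  qed
qed

end

section \<open>The dimension gap\<close>

lemma sum_scaleR_matrix_vector_mult:
  fixes A :: "'k \<Rightarrow> real^3^3"
  shows "(\<Sum>k\<in>I. d k *\<^sub>R A k) *v h = (\<Sum>k\<in>I. d k *\<^sub>R (A k *v h))"
  by (induction I rule: infinite_finite_induct)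
     (auto simp: matrix_vector_mult_add_rdistrib scaleR_matrix_vector_assoc)

lemma curl_of_jacobian_eq:
  "curl_of_jacobian A = (A$3$2 - A$2$3) *\<^sub>R axis 1 1 + (A$1$3 - A$3$1) *\<^sub>R axis 2 1 + (A$2$1 - A$1$2) *\<^sub>R axis 3 1"
  by (simp add: curl_of_jacobian_def vec_eq_iff forall_3 axis_def)

lemma curl_of_jacobian_sum:
  "curl_of_jacobian (\<Sum>k\<in>I. d k *\<^sub>R A k) = (\<Sum>k\<in>I. d k *\<^sub>R curl_of_jacobian (A k))"
  by (simp add: curl_of_jacobian_def vec_eq_iff forall_3 sum_subtractf[symmetric] algebra_simps)

lemma has_jacobian_on_closure_sum:
  assumes "\<And>k. k \<in> I \<Longrightarrow> has_jacobian_on_closure \<Omega> (s k) (J k)"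
  shows "has_jacobian_on_closure \<Omega> (\<lambda>x. \<Sum>k\<in>I. d k *\<^sub>R s k x) (\<lambda>x. \<Sum>k\<in>I. d k *\<^sub>R J k x)"
proof -
  have c: "continuous_on (closure \<Omega>) (\<lambda>x. \<Sum>k\<in>I. d k *\<^sub>R J k x)"
    using assms unfolding has_jacobian_on_closure_def by (intro continuous_intros) auto
  have "((\<lambda>x. \<Sum>k\<in>I. d k *\<^sub>R s k x) has_derivative (\<lambda>h. (\<Sum>k\<in>I. d k *\<^sub>R J k x) *v h)) (at x)"
    if "x \<in> \<Omega>" for x
    unfolding sum_scaleR_matrix_vector_mult
    by (intro has_derivative_sum has_derivative_scaleR_right)
       (use assms that in \<open>auto simp: has_jacobian_on_closure_def\<close>)
  then show ?thesis using c unfolding has_jacobian_on_closure_def by blast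
qed

lemma V_space_sum:
  assumes "\<And>k. k \<in> I \<Longrightarrow> s k \<in> V_space \<Omega> r W"
  shows "(\<lambda>x. \<Sum>k\<in>I. d k *\<^sub>R s k x) \<in> V_space \<Omega> r W"
  unfolding V_space_def
proof (intro CollectI conjI allI ballI impI)
  fix x assume "x \<notin> closure \<Omega>"
  then show "(\<Sum>k\<in>I. d k *\<^sub>R s k x) = 0" using assms unfolding V_space_def by (intro sum.neutral) auto
next
  show "continuous_on (closure \<Omega>) (\<lambda>x. \<Sum>k\<in>I. d k *\<^sub>R s k x)"
    using assms unfolding V_space_def by (intro continuous_intros) auto
next
  fix T i assume T: "T \<in> W"
  have "\<forall>k\<in>I. \<exists>p. polynomial_of_degree_le r p \<and> (\<forall>x\<in>T. s k x $ i = p x)"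
  proof
    fix k assume "k \<in> I"
    from assms[OF this] show "\<exists>p. polynomial_of_degree_le r p \<and> (\<forall>x\<in>T. s k x $ i = p x)"
      using T unfolding V_space_def by simp
  qed
  from bchoice[OF this] obtain p where
    p: "\<forall>k\<in>I. polynomial_of_degree_le r (p k) \<and> (\<forall>x\<in>T. s k x $ i = p k x)" ..
  show "\<exists>p. polynomial_of_degree_le r p \<and> (\<forall>x\<in>T. (\<Sum>k\<in>I. d k *\<^sub>R s k x) $ i = p x)"
    by (intro exI[of _ "\<lambda>x. \<Sum>k\<in>I. d k * p k x"] conjI polynomial_of_degree_le_sum
        polynomial_of_degree_le_cmult) (use p in auto)
qed

context WF_complex begin

text \<open>On each cell the divergence of the curl is a difference of equal mixed second derivatives.\<close>

lemma curl_in_Z_space: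
  assumes s: "s \<in> V_space \<Omega> 3 (cell ` cells)" and J: "has_jacobian_on_closure \<Omega> s J"
  shows "(\<lambda>x. if x \<in> closure \<Omega> then curl_of_jacobian (J x) else 0) \<in> Z_space \<Omega> 2 (cell ` cells)"
    (is "?w \<in> _")
proof -
  have cont: "continuous_on (closure \<Omega>) ?w"
  proof -
    have "continuous_on (closure \<Omega>) J" using J by (simp add: has_jacobian_on_closure_def)
    then have "continuous_on (closure \<Omega>) (\<lambda>x. curl_of_jacobian (J x))"
      unfolding curl_of_jacobian_eq by (intro continuous_intros)
    then show ?thesis by (rule continuous_on_eq) simp
  qed
  have cell: "(\<forall>i. \<exists>p. polynomial_of_degree_le 2 p \<and> (\<forall>x\<in>cell K. ?w x $ i = p x)) \<and>
      (\<forall>x\<in>interior (cell K). divergence ?w x = 0)" if K: "K \<in> cells" for K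
  proof -
    obtain p1 g1 H1 where p1: "quadratic_gradient p1 g1 H1" "\<forall>x\<in>cell K. \<forall>j. J x $ 1 $ j = g1 j x"
      using cubic_cell_jacobian[OF s J K, of 1] by blast
    note 1 = quadratic_gradientD(1)[OF p1(1)] bspec[OF p1(2), THEN spec] quadratic_gradientD(3,4)[OF p1(1)]
    obtain p2 g2 H2 where p2: "quadratic_gradient p2 g2 H2" "\<forall>x\<in>cell K. \<forall>j. J x $ 2 $ j = g2 j x"
      using cubic_cell_jacobian[OF s J K, of 2] by blast
    note 2 = quadratic_gradientD(1)[OF p2(1)] bspec[OF p2(2), THEN spec] quadratic_gradientD(3,4)[OF p2(1)]
    obtain p3 g3 H3 where p3: "quadratic_gradient p3 g3 H3" "\<forall>x\<in>cell K. \<forall>j. J x $ 3 $ j = g3 j x"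
      using cubic_cell_jacobian[OF s J K, of 3] by blast
    note 3 = quadratic_gradientD(1)[OF p3(1)] bspec[OF p3(2), THEN spec] quadratic_gradientD(3,4)[OF p3(1)]
    define q :: "3 \<Rightarrow> real^3 \<Rightarrow> real" where "q i x = (if i = 1 then g3 2 x - g2 3 x
      else if i = 2 then g1 3 x - g3 1 x else g2 1 x - g1 2 x)" for i x
    have w: "?w x = (\<chi> i. q i x)" if "x \<in> cell K" for x
      using that cell_subset_closure[OF K]
      by (auto simp: curl_of_jacobian_def vec_eq_iff forall_3 q_def 1(2)[OF that] 2(2)[OF that] 3(2)[OF that])
    have q: "polynomial_of_degree_le 2 (q i)" for i
      using exhaust_3[of i] polynomial_of_degree_le_diff[OF 1(1) 2(1)] polynomial_of_degree_le_diff[OF 2(1) 1(1)]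
        polynomial_of_degree_le_diff[OF 3(1) 2(1)] polynomial_of_degree_le_diff[OF 1(1) 3(1)]
      by (auto simp: q_def[abs_def])
    have "divergence ?w x = 0" if x: "x \<in> interior (cell K)" for x
    proof -
      define D where "D h = (\<chi> i. if i = 1 then (\<Sum>l\<in>UNIV. H3 2 l x * h $ l) - (\<Sum>l\<in>UNIV. H2 3 l x * h $ l)
        else if i = 2 then (\<Sum>l\<in>UNIV. H1 3 l x * h $ l) - (\<Sum>l\<in>UNIV. H3 1 l x * h $ l)
        else (\<Sum>l\<in>UNIV. H2 1 l x * h $ l) - (\<Sum>l\<in>UNIV. H1 2 l x * h $ l) :: real^3)" for h :: "real^3"
      have "((\<lambda>x. \<chi> i. q i x) has_derivative D) (at x)"
      proof (rule has_derivative_componentwise_vec)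
        fix i :: 3
        show "((\<lambda>x. (\<chi> i. q i x) $ i) has_derivative (\<lambda>h. D h $ i)) (at x)"
          using exhaust_3[of i] has_derivative_diff[OF 3(3) 2(3)] has_derivative_diff[OF 1(3) 3(3)]
            has_derivative_diff[OF 2(3) 1(3)]
          by (auto simp: q_def D_def)
      qed
      then have "(?w has_derivative D) (at x)"
      proof (rule has_derivative_transform_within_open[OF _ open_interior x])
        fix v assume "v \<in> interior (cell K)"
        then show "(\<chi> i. q i v) = ?w v" using w[of v] interior_subset[of "cell K"] by auto
      qed
      then have "frechet_derivative ?w (at x) = D" by (rule frechet_derivative_at[symmetric])
      then show ?thesis
        using 1(4)[of 2 3 x] 2(4)[of 1 3 x] 3(4)[of 1 2 x]
        by (simp add: divergence_def D_def sum_3 axis_def)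
    qed
    then show ?thesis using w q by (intro conjI allI exI[of _ "q i" for i]) auto
  qed
  then show ?thesis using cont unfolding Z_space_def V_space_def by auto
qed

text \<open>If every divergence-free field were a curl, a family of independent such fields that is larger
  than the number of degrees of freedom of the cubic potentials would contain a nontrivial
  combination whose potential has zero data, and this combination would vanish.\<close>

theorem curl_image_proper_subset:
  assumes "9 * card (mesh_vertices M) + 3 * card (mesh_edges M) < 13 * card M"
  shows "curl_image \<Omega> (S_space \<Omega> 3 (cell ` cells)) \<subset> Z_space \<Omega> 2 (cell ` cells)"
proof -
  let ?C = "curl_image \<Omega> (S_space \<Omega> 3 (cell ` cells))" and ?Z = "Z_space \<Omega> 2 (cell ` cells)"
  have "?C \<subseteq> ?Z"
    unfolding curl_image_def S_space_def using curl_in_Z_space by auto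
  moreover have "?C \<noteq> ?Z"
  proof
    assume eq: "?C = ?Z"
    show False
    proof (rule independent_Z_space_family)
      fix I :: "((real^3) set \<times> 3) set" and v
      assume I: "finite I"
        "3 * card (mesh_vertices M) + 3 * card (mesh_edges M) + 13 * card M \<le> card I"
        and vZ: "\<And>k. k \<in> I \<Longrightarrow> v k \<in> ?Z"
        and ind: "\<And>d. (\<forall>K\<in>cells. \<forall>x\<in>cell K. (\<Sum>k\<in>I. d k *\<^sub>R v k x) = 0) \<Longrightarrow> \<forall>k\<in>I. d k = 0"
      have "\<forall>k\<in>I. \<exists>sJ. fst sJ \<in> V_space \<Omega> 3 (cell ` cells) \<and> has_jacobian_on_closure \<Omega> (fst sJ) (snd sJ) \<and>
          v k = (\<lambda>x. if x \<in> closure \<Omega> then curl_of_jacobian (snd sJ x) else 0)"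
      proof
        fix k assume "k \<in> I"
        then have "v k \<in> ?C" using vZ eq by simp
        then obtain s J where "s \<in> S_space \<Omega> 3 (cell ` cells)" "has_jacobian_on_closure \<Omega> s J"
            "v k = (\<lambda>x. if x \<in> closure \<Omega> then curl_of_jacobian (J x) else 0)"
          unfolding curl_image_def by blast
        then show "\<exists>sJ. fst sJ \<in> V_space \<Omega> 3 (cell ` cells) \<and> has_jacobian_on_closure \<Omega> (fst sJ) (snd sJ) \<and>
          v k = (\<lambda>x. if x \<in> closure \<Omega> then curl_of_jacobian (snd sJ x) else 0)"
          by (intro exI[of _ "(s, J)"]) (simp add: S_space_def cong: if_cong)
      qed
      from bchoice[OF this] obtain sJ where
        sJ: "\<forall>k\<in>I. fst (sJ k) \<in> V_space \<Omega> 3 (cell ` cells) \<and> has_jacobian_on_closure \<Omega> (fst (sJ k)) (snd (sJ k)) \<and>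
          v k = (\<lambda>x. if x \<in> closure \<Omega> then curl_of_jacobian (snd (sJ k) x) else 0)" ..
      define s J where "s k = fst (sJ k)" and "J k = snd (sJ k)" for k
      have s: "s k \<in> V_space \<Omega> 3 (cell ` cells)" and J: "has_jacobian_on_closure \<Omega> (s k) (J k)"
        and v: "v k x = (if x \<in> closure \<Omega> then curl_of_jacobian (J k x) else 0)" if "k \<in> I" for k x
        using bspec[OF sJ that] by (simp_all add: s_def J_def)
      let ?B = "dof_points \<times> (UNIV :: 3 set)"
      have "card ?B \<le> 12 * card (mesh_vertices M) + 6 * card (mesh_edges M)"
        using card_dof_points(2) by (simp add: card_cartesian_product)
      also have "\<dots> < card I" using assms I(2) by linarith
      finally have less: "card ?B < card I" .
      have finB: "finite ?B" using card_dof_points(1) by simp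
      obtain d where d: "\<exists>k\<in>I. d k \<noteq> 0"
        "\<forall>b\<in>?B. (\<Sum>k\<in>I. d k * hermite_value (s k) (J k) (fst (fst b)) (snd (fst b)) $ snd b) = 0"
        using underdetermined_system[OF finB I(1) less,
            of "\<lambda>k b. hermite_value (s k) (J k) (fst (fst b)) (snd (fst b)) $ snd b"] by blast
      define s' where "s' x = (\<Sum>k\<in>I. d k *\<^sub>R s k x)" for x
      define J' where "J' x = (\<Sum>k\<in>I. d k *\<^sub>R J k x)" for x
      have s': "s' \<in> V_space \<Omega> 3 (cell ` cells)"
        unfolding s'_def by (rule V_space_sum) (rule s)
      have J': "has_jacobian_on_closure \<Omega> s' J'"
        unfolding s'_def J'_def by (rule has_jacobian_on_closure_sum) (rule J)
      have "hermite_value s' J' x w = 0" if "(x, w) \<in> dof_points" for x w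
      proof -
        have "hermite_value s' J' x w = (\<Sum>k\<in>I. d k *\<^sub>R hermite_value (s k) (J k) x w)"
          by (simp add: hermite_value_def s'_def J'_def sum_scaleR_matrix_vector_mult scaleR_add_right
              sum.distrib scaleR_sum_right mult.commute)
        moreover have "(\<Sum>k\<in>I. d k *\<^sub>R hermite_value (s k) (J k) x w) $ i = 0" for i
          using bspec[OF d(2), of "((x, w), i)"] that by simp
        ultimately show ?thesis by (simp add: vec_eq_iff)
      qed
      from unisolvence[OF s' J' this] have J0: "J' x = 0" if "K \<in> cells" "x \<in> cell K" for K x
        using that by blast
      have "\<forall>K\<in>cells. \<forall>x\<in>cell K. (\<Sum>k\<in>I. d k *\<^sub>R v k x) = 0"
      proof (intro ballI)
        fix K x assume K: "K \<in> cells" "x \<in> cell K"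
        have "x \<in> closure \<Omega>" using cell_subset_closure K by blast
        then have "(\<Sum>k\<in>I. d k *\<^sub>R v k x) = (\<Sum>k\<in>I. d k *\<^sub>R curl_of_jacobian (J k x))"
          using v by (intro sum.cong) auto
        also have "\<dots> = curl_of_jacobian (J' x)" by (simp add: curl_of_jacobian_sum J'_def)
        also have "\<dots> = 0" by (simp add: J0[OF K] curl_of_jacobian_eq)
        finally show "(\<Sum>k\<in>I. d k *\<^sub>R v k x) = 0" .
      qed
      from ind[OF this] show False using d(1) by blast
    qed
  qed
  ultimately show ?thesis by blast
qed

end

lemma Worsey_Farin_split_complex:
  assumes M: "tet_complex \<Omega> M" and W: "Worsey_Farin_split M W"
  obtains z y where "WF_complex \<Omega> M z y"
    "W = (\<lambda>K. convex hull (WF_complex.cell_nodes z y K)) ` WF_complex.cells M"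
proof -
  interpret tet_complex \<Omega> M by fact
  obtain z y where zy: "\<forall>T\<in>M. z T \<in> interior T" "\<forall>F\<in>mesh_faces M. y F \<in> rel_interior F"
    "\<forall>T\<in>M. \<forall>T'\<in>M. \<forall>F. T \<noteq> T' \<and> F facet_of T \<and> F facet_of T' \<longrightarrow> closed_segment (z T) (z T') \<inter> F = {y F}"
    and Weq: "W = {convex hull (insert (z T) (insert (y F) e)) | T F e. T \<in> M \<and> F facet_of T \<and> e edge_of F}"
    using W unfolding Worsey_Farin_split_def by blast
  have wf: "WF_complex \<Omega> M z y"
    by unfold_locales (use zy in auto)
  interpret WF_complex \<Omega> M z y by fact
  have hull: "convex hull (insert a (insert b (convex hull c))) = convex hull (insert a (insert b c))"
    for a b :: "real^3" and c
    using hull_Un_right[of convex "{a, b}" c] by simp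
  have "W = cell ` cells"
  proof (rule set_eqI, rule iffI)
    fix X assume "X \<in> W"
    then obtain T F e where T: "T \<in> M" "F facet_of T" "e edge_of F"
      "X = convex hull (insert (z T) (insert (y F) e))" unfolding Weq by blast
    then obtain m where m: "m \<in> verts F" "e = convex hull (verts F - {m})"
      using edge_of_facet[OF simplex_M[OF T(1)] T(2)] by blast
    have "X = cell (T, F, m)" using T(4) m(2) hull by (simp add: cell_nodes_def)
    moreover have "(T, F, m) \<in> cells" using T m by (simp add: cells_def)
    ultimately show "X \<in> cell ` cells" by blast
  next
    fix X assume "X \<in> cell ` cells"
    then obtain K' where K': "K' \<in> cells" "X = cell K'" by blast
    obtain T F m where "K' = (T, F, m)" by (cases K')
    then have K: "(T, F, m) \<in> cells" "X = cell (T, F, m)" using K' by simp_all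
    note c = cellsD[OF K(1)]
    have "(convex hull (verts F - {m})) edge_of F"
      using edge_of_facet[OF simplex_M, of T F] c by blast
    moreover have "X = convex hull (insert (z T) (insert (y F) (convex hull (verts F - {m}))))"
      using K(2) hull by (simp add: cell_nodes_def)
    ultimately show "X \<in> W" unfolding Weq using c by blast
  qed
  then show ?thesis by (rule that[OF wf])
qed

theorem Worsey_Farin_curl_proper_subset:
  assumes "tet_complex \<Omega> M" "Worsey_Farin_split M W"
    "9 * card (mesh_vertices M) + 3 * card (mesh_edges M) < 13 * card M"
  shows "curl_image \<Omega> (S_space \<Omega> 3 W) \<subset> Z_space \<Omega> 2 W"
proof -
  obtain z y where *: "WF_complex \<Omega> M z y"
    "W = (\<lambda>K. convex hull (WF_complex.cell_nodes z y K)) ` WF_complex.cells M"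
    by (rule Worsey_Farin_split_complex[OF assms(1,2)])
  show ?thesis unfolding *(2) by (rule WF_complex.curl_image_proper_subset[OF *(1) assms(3)])
qed

section \<open>Counting edges with a generic direction\<close>

context tet_complex begin

lemma face_verts_subset:
  assumes "T \<in> M" "c \<subseteq> verts T" "x \<in> rel_interior (convex hull c)" "S \<in> M" "x \<in> S"
  shows "c \<subseteq> verts S"
proof
  fix p assume "p \<in> c"
  then have "0 < coord x p" using coord_rel_interior(2)[OF assms(1-3)] by simp
  then show "p \<in> verts S" using coord_zero_outside[OF assms(4,5), of p] by fastforce
qed

text \<open>A short segment that starts at \<open>x\<close> in direction \<open>u\<close> stays in the domain, so one of the finitely many
  tetrahedra contains points of it that are arbitrarily close to \<open>x\<close>. Since \<open>u\<close> is generic, it points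
  strictly into that tetrahedron.\<close>

lemma enters_exists:
  assumes u: "\<And>T p. T \<in> M \<Longrightarrow> p \<in> verts T \<Longrightarrow> bary_slope T p u \<noteq> 0"
    and T0: "T0 \<in> M" "c \<subseteq> verts T0" "x \<in> rel_interior (convex hull c)" "x \<in> \<Omega>"
  obtains T where "T \<in> M" "c \<subseteq> verts T" "enters u T c"
proof -
  have lim: "((\<lambda>t. x + t *\<^sub>R u) \<longlongrightarrow> x + 0 *\<^sub>R u) (at_right 0)" by (intro tendsto_intros)
  then have "\<forall>\<^sub>F t in at_right 0. x + t *\<^sub>R u \<in> \<Omega>"
    using topological_tendstoD[OF _ open_\<Omega>, of "\<lambda>t. x + t *\<^sub>R u" x] T0(4) by simp
  then have "\<forall>\<^sub>F t in at_right 0. \<exists>T\<in>M. x + t *\<^sub>R u \<in> T"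
    by eventually_elim (use cover closure_subset in blast)
  then have "\<exists>\<^sub>F t in at_right 0. \<exists>T\<in>M. x + t *\<^sub>R u \<in> T"
    by (rule eventually_frequently[OF trivial_limit_at_right_real])
  from frequently_bex_finite[OF finite_M this]
  obtain T where T: "T \<in> M" "\<exists>\<^sub>F t in at_right 0. x + t *\<^sub>R u \<in> T" by blast
  have xT: "x \<in> T"
  proof (rule ccontr)
    assume "x \<notin> T"
    moreover have "open (- T)" using closed_simplex[OF simplex_M[OF T(1)]] by (rule open_Compl)
    ultimately have "\<forall>\<^sub>F t in at_right 0. x + t *\<^sub>R u \<in> - T"
      by (intro topological_tendstoD[OF lim]) simp_all
    then have "\<not> (\<exists>\<^sub>F t in at_right 0. x + t *\<^sub>R u \<in> T)" by (simp add: frequently_def)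
    then show False using T(2) by blast
  qed
  have cT: "c \<subseteq> verts T" using face_verts_subset[OF T0(1,2,3) T(1) xT] .
  have "0 < bary_slope T p u" if p: "p \<in> verts T - c" for p
  proof -
    have pT: "p \<in> verts T" using p by blast
    have "\<exists>t>0. x + t *\<^sub>R u \<in> T"
    proof (rule ccontr)
      assume "\<not> ?thesis"
      then have "\<forall>\<^sub>F t in at_right 0. \<not> x + t *\<^sub>R u \<in> T"
        using eventually_at_right_less[of "0::real"] by (auto elim!: eventually_mono)
      then show False using T(2) by (simp add: frequently_def)
    qed
    then obtain t where t: "0 < t" "x + t *\<^sub>R u \<in> T" by blast
    have "bary (verts T) p x = 0"
      using rel_interior_convex_hull_bary[OF frame[OF T(1)] cT, of x] T0(3) p by simp
    moreover have "0 \<le> bary (verts T) p (x + t *\<^sub>R u)"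
      using coord_nonneg[of "x + t *\<^sub>R u" p] coord_eq[OF T(1) t(2), of p] pT by simp
    ultimately have "0 \<le> t * bary_slope T p u" using bary_line[OF T(1) pT, of x t u] by simp
    then have "0 \<le> bary_slope T p u" using t(1) by (simp add: zero_le_mult_iff)
    then show ?thesis using u[OF T(1) pT] by simp
  qed
  then have "enters u T c" by (simp add: enters_def)
  then show ?thesis using that T(1) cT by blast
qed

lemma mesh_edge_verts:
  assumes "e \<in> mesh_edges M"
  shows "card (verts e) = 2" "convex hull (verts e) = e" "\<exists>T\<in>M. verts e \<subseteq> verts T"
proof -
  obtain T where T: "T \<in> M" "e edge_of T" using assms by (auto simp: mesh_edges_def)
  show "card (verts e) = 2" "convex hull (verts e) = e" "\<exists>T\<in>M. verts e \<subseteq> verts T"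
    using verts_edge[OF simplex_M[OF T(1)] T(2)] T(1) by auto
qed

text \<open>For a generic direction \<open>u\<close> let a tetrahedron have type \<open>k\<close> if \<open>k\<close> of its four barycentric
  coordinates decrease along \<open>u\<close>. Type 1 tetrahedra are entered through a vertex along \<open>u\<close>, type 3
  tetrahedra through a vertex along \<open>- u\<close>, and the edges through which a tetrahedron is entered
  number 3, 1 and 0 for the types 1, 2 and 3. This yields a one-sided form of Euler's relation in
  which the boundary enters only through the numbers of its vertices and edges.\<close>

lemma card_edges_le:
  shows "card (mesh_edges M) \<le> card M + card (mesh_vertices M) + card (boundary_vertices \<Omega> M)
      + card {e\<in>mesh_edges M. e \<subseteq> frontier \<Omega>}" (is ?A)
    and "card (mesh_edges M) \<le> card M + 2 * card (mesh_vertices M)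
      + card {e\<in>mesh_edges M. e \<subseteq> frontier \<Omega>}" (is ?B)
proof -
  obtain u where u: "\<And>T p. T \<in> M \<Longrightarrow> p \<in> verts T \<Longrightarrow> bary_slope T p u \<noteq> 0"
    using generic_slopes by blast
  define N where "N T = {p\<in>verts T. bary_slope T p u < 0}" for T
  define n where "n k = card {T\<in>M. card (N T) = k}" for k
  have finN: "finite (N T)" "N T \<subseteq> verts T" if "T \<in> M" for T
    using finite_verts[OF that] by (auto simp: N_def)
  have sgn: "p \<in> N T \<or> 0 < bary_slope T p u" if "T \<in> M" "p \<in> verts T" for T p
    using u[OF that] that by (auto simp: N_def not_less_iff_gr_or_eq)
  have types: "card (N T) \<in> {1, 2, 3}" if T: "T \<in> M" for T
  proof -
    have "N T \<noteq> {}"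
    proof
      assume "N T = {}"
      then have "0 < (\<Sum>p\<in>verts T. bary_slope T p u)"
        using sgn[OF T] finite_verts[OF T] verts_nonempty[OF T] by (intro sum_pos) auto
      then show False using sum_bary_slope[OF T] by simp
    qed
    moreover have "N T \<noteq> verts T"
    proof
      assume "N T = verts T"
      then have "(\<Sum>p\<in>verts T. bary_slope T p u) < (\<Sum>p\<in>verts T. 0)"
        using finite_verts[OF T] verts_nonempty[OF T] by (intro sum_strict_mono) (auto simp: N_def)
      then show False using sum_bary_slope[OF T] by simp
    qed
    ultimately have "0 < card (N T)" "card (N T) < 4"
      using finN[OF T] psubset_card_mono[OF finite_verts[OF T], of "N T"] card_verts[OF T]
      by (auto simp: card_gt_0_iff)
    then show ?thesis by auto
  qed
  have M_split: "card M = n 1 + n 2 + n 3"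
  proof -
    have "card M = (\<Sum>T\<in>M. 1)" by simp
    also have "\<dots> = (\<Sum>T\<in>M. (if card (N T) = 1 then 1 else 0) + (if card (N T) = 2 then 1 else 0) +
        (if card (N T) = 3 then 1 else 0))"
    proof (rule sum.cong)
      fix T assume "T \<in> M"
      then show "1 = (if card (N T) = 1 then 1 else 0) + (if card (N T) = 2 then 1 else 0) +
        (if card (N T) = 3 then 1 else (0::nat))" using types[of T] by auto
    qed simp
    also have "\<dots> = n 1 + n 2 + n 3"
      using finite_M by (simp add: sum.distrib n_def sum.If_cases Int_def conj_commute)
    finally show ?thesis .
  qed
  have enters_N: "enters u T c \<longleftrightarrow> N T \<subseteq> c" if "T \<in> M" for T c
    using sgn[OF that] by (force simp: enters_def N_def)
  have n1: "n 1 \<le> card (mesh_vertices M)"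
    unfolding n_def
  proof (rule card_inj_on_le[of "\<lambda>T. the_elem (N T)"])
    show "(\<lambda>T. the_elem (N T)) ` {T\<in>M. card (N T) = 1} \<subseteq> mesh_vertices M"
      using finN by (force simp: mesh_vertices_eq card_1_singleton_iff)
    show "inj_on (\<lambda>T. the_elem (N T)) {T\<in>M. card (N T) = 1}"
    proof (rule inj_onI, clarify)
      fix T S assume T: "T \<in> M" "card (N T) = 1" and S: "S \<in> M" "card (N S) = 1"
        and eq: "the_elem (N T) = the_elem (N S)"
      obtain p q where pq: "N T = {p}" "N S = {q}" using T(2) S(2) by (auto simp: card_1_singleton_iff)
      then have "q = p" using eq by simp
      show "T = S"
        by (rule enters_unique[OF T(1) _ _ S(1), of "{p}" u])
           (use finN(2)[OF T(1)] finN(2)[OF S(1)] enters_N[OF T(1)] enters_N[OF S(1)] pq \<open>q = p\<close> in auto)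
    qed
  qed (rule finite_mesh_vertices)
  have n3: "card (mesh_vertices M) \<le> n 3 + card (boundary_vertices \<Omega> M)"
  proof -
    have "\<forall>p\<in>mesh_vertices M - frontier \<Omega>. \<exists>T. T \<in> M \<and> card (N T) = 3 \<and> verts T - N T = {p}"
    proof
      fix p assume p: "p \<in> mesh_vertices M - frontier \<Omega>"
      then obtain T0 where T0: "T0 \<in> M" "p \<in> verts T0" by (auto simp: mesh_vertices_eq)
      have "p \<in> T0" using hull_verts[OF T0(1)] hull_inc[OF T0(2), of convex] by simp
      then have p\<Omega>: "p \<in> \<Omega>" using M_subset_closure[OF T0(1)] p open_\<Omega> by (auto simp: frontier_def interior_open)
      have u': "bary_slope T q (- u) \<noteq> 0" if "T \<in> M" "q \<in> verts T" for T q
        using u[OF that] bary_slope_minus[OF that, of u] by simp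
      obtain T where T: "T \<in> M" "{p} \<subseteq> verts T" "enters (- u) T {p}"
        using enters_exists[OF u' T0(1), of "{p}" p] T0(2) p\<Omega> by auto
      have sl: "bary_slope T q u < 0" if "q \<in> verts T - {p}" for q
      proof -
        have "0 < bary_slope T q (- u)" using T(3) that unfolding enters_def by blast
        then show ?thesis using bary_slope_minus[OF T(1), of q u] that by simp
      qed
      then have sub: "verts T - {p} \<subseteq> N T" by (auto simp: N_def)
      have "p \<notin> N T"
      proof
        assume "p \<in> N T"
        then have "N T = verts T" using sub finN(2)[OF T(1)] by blast
        then show False using types[OF T(1)] card_verts[OF T(1)] by simp
      qed
      then have "N T = verts T - {p}" using sub finN(2)[OF T(1)] by blast
      then have "card (N T) = 3" "verts T - N T = {p}"
        using T(2) card_verts[OF T(1)] finite_verts[OF T(1)] by (auto simp: card_Diff_singleton)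
      then show "\<exists>T. T \<in> M \<and> card (N T) = 3 \<and> verts T - N T = {p}" using T(1) by blast
    qed
    from bchoice[OF this] obtain f where
      f: "\<forall>p\<in>mesh_vertices M - frontier \<Omega>. f p \<in> M \<and> card (N (f p)) = 3 \<and> verts (f p) - N (f p) = {p}" ..
    have "inj_on f (mesh_vertices M - frontier \<Omega>)"
    proof (rule inj_onI)
      fix p q assume pq: "p \<in> mesh_vertices M - frontier \<Omega>" "q \<in> mesh_vertices M - frontier \<Omega>" "f p = f q"
      have 1: "verts (f p) - N (f p) = {p}" using bspec[OF f pq(1)] by blast
      have 2: "verts (f q) - N (f q) = {q}" using bspec[OF f pq(2)] by blast
      have "{p} = {q}" using 1 2 unfolding pq(3) by metis
      then show "p = q" by simp
    qed
    then have "card (mesh_vertices M - frontier \<Omega>) \<le> n 3"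
      unfolding n_def by (rule card_inj_on_le) (use f finite_M in auto)
    moreover have "card ((mesh_vertices M - frontier \<Omega>) \<union> (mesh_vertices M \<inter> frontier \<Omega>)) =
        card (mesh_vertices M - frontier \<Omega>) + card (mesh_vertices M \<inter> frontier \<Omega>)"
      using finite_mesh_vertices by (intro card_Un_disjoint) auto
    moreover have "(mesh_vertices M - frontier \<Omega>) \<union> (mesh_vertices M \<inter> frontier \<Omega>) = mesh_vertices M"
      by blast
    ultimately have "card (mesh_vertices M) \<le> n 3 + card (mesh_vertices M \<inter> frontier \<Omega>)" by simp
    then show ?thesis by (simp add: boundary_vertices_def)
  qed
  have Ei: "card {e\<in>mesh_edges M. \<not> e \<subseteq> frontier \<Omega>} \<le> 3 * n 1 + n 2"
  proof -
    let ?E = "{e\<in>mesh_edges M. \<not> e \<subseteq> frontier \<Omega>}"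
    have "\<forall>e\<in>?E. \<exists>T. T \<in> M \<and> verts e \<subseteq> verts T \<and> N T \<subseteq> verts e"
    proof
      fix e assume e: "e \<in> ?E"
      then have eM: "e \<in> mesh_edges M" by blast
      note ve = mesh_edge_verts[OF eM]
      obtain T0 where T0: "T0 \<in> M" "verts e \<subseteq> verts T0" using ve(3) by blast
      have "e \<subseteq> T0" using hull_mono[OF T0(2), of convex] ve(2) hull_verts[OF T0(1)] by simp
      then have "e \<subseteq> closure \<Omega>" using M_subset_closure[OF T0(1)] by blast
      then have "\<Omega> \<inter> e \<noteq> {}" using e open_\<Omega> by (auto simp: frontier_def interior_open)
      moreover have "e \<subseteq> closure (rel_interior e)"
        using convex_closure_rel_interior[of e] ve(2) closure_subset[of e] convex_convex_hull[of "verts e"] by simp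
      ultimately have "\<Omega> \<inter> rel_interior e \<noteq> {}"
        using open_Int_closure_eq_empty[OF open_\<Omega>, of "rel_interior e"] by blast
      then obtain x where x: "x \<in> \<Omega>" "x \<in> rel_interior (convex hull verts e)" using ve(2) by auto
      obtain T where "T \<in> M" "verts e \<subseteq> verts T" "enters u T (verts e)"
        using enters_exists[OF u T0 x(2,1)] by blast
      then show "\<exists>T. T \<in> M \<and> verts e \<subseteq> verts T \<and> N T \<subseteq> verts e" using enters_N by blast
    qed
    from bchoice[OF this] obtain f where
      f: "\<forall>e\<in>?E. f e \<in> M \<and> verts e \<subseteq> verts (f e) \<and> N (f e) \<subseteq> verts e" ..
    let ?C = "\<lambda>T. {c. c \<subseteq> verts T \<and> card c = 2 \<and> N T \<subseteq> c}"
    have finC: "finite (?C T)" if "T \<in> M" for T using finite_verts[OF that] by simp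
    have "inj_on (\<lambda>e. (f e, verts e)) ?E"
    proof (rule inj_onI)
      fix e e' assume e: "e \<in> ?E" "e' \<in> ?E" "(f e, verts e) = (f e', verts e')"
      have "convex hull (verts e) = e" "convex hull (verts e') = e'"
        using mesh_edge_verts(2) e(1,2) by blast+
      moreover have "verts e = verts e'" using e(3) by blast
      ultimately show "e = e'" by metis
    qed
    then have "card ?E \<le> card (SIGMA T:M. ?C T)"
      by (rule card_inj_on_le) (use f mesh_edge_verts(1) finC finite_M in auto)
    also have "\<dots> = (\<Sum>T\<in>M. card (?C T))"
      using finC finite_M by (intro card_SigmaI) auto
    also have "\<dots> \<le> (\<Sum>T\<in>M. (if card (N T) = 1 then 3 else 0) + (if card (N T) = 2 then 1 else 0))"
    proof (rule sum_mono)
      fix T assume T: "T \<in> M"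
      note fN = finN[OF T]
      consider "card (N T) = 1" | "card (N T) = 2" | "card (N T) = 3" using types[OF T] by auto
      then show "card (?C T) \<le> (if card (N T) = 1 then 3 else 0) + (if card (N T) = 2 then 1 else 0)"
      proof cases
        case 1
        then obtain p where p: "N T = {p}" by (auto simp: card_1_singleton_iff)
        have "?C T \<subseteq> (\<lambda>q. {p, q}) ` (verts T - {p})"
        proof
          fix c assume c: "c \<in> ?C T"
          then obtain a b where "c = {a, b}" "a \<noteq> b" by (auto simp: card_2_iff)
          then show "c \<in> (\<lambda>q. {p, q}) ` (verts T - {p})" using c p by auto
        qed
        then have "card (?C T) \<le> card (verts T - {p})"
          using finite_verts[OF T] by (meson card_image_le card_mono finite_Diff finite_imageI le_trans)
        also have "\<dots> = 3" using p fN(2) card_verts[OF T] finite_verts[OF T] by (simp add: card_Diff_singleton)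
        finally show ?thesis using 1 by simp
      next
        case 2
        have "?C T \<subseteq> {N T}"
        proof
          fix c assume c: "c \<in> ?C T"
          then have "finite c" using finite_verts[OF T] finite_subset by blast
          then have "N T = c" using c 2 by (intro card_subset_eq) auto
          then show "c \<in> {N T}" by simp
        qed
        then have "card (?C T) \<le> 1" using card_mono[of "{N T}" "?C T"] by simp
        then show ?thesis using 2 by simp
      next
        case 3
        have "?C T = {}"
        proof (rule ccontr)
          assume "?C T \<noteq> {}"
          then obtain c where c: "c \<subseteq> verts T" "card c = 2" "N T \<subseteq> c" by blast
          then have "card (N T) \<le> 2"
            using card_mono[of c "N T"] finite_subset[OF c(1) finite_verts[OF T]] by simp
          then show False using 3 by simp
        qed
        then have "card (?C T) = 0" by (simp only: card.empty)
        then show ?thesis by linarith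
      qed
    qed
    also have "\<dots> = 3 * n 1 + n 2"
      using finite_M by (simp add: sum.distrib n_def sum.If_cases Int_def conj_commute)
    finally show ?thesis .
  qed
  have E: "card (mesh_edges M) = card {e\<in>mesh_edges M. \<not> e \<subseteq> frontier \<Omega>} + card {e\<in>mesh_edges M. e \<subseteq> frontier \<Omega>}"
  proof -
    have "card ({e\<in>mesh_edges M. \<not> e \<subseteq> frontier \<Omega>} \<union> {e\<in>mesh_edges M. e \<subseteq> frontier \<Omega>}) =
        card {e\<in>mesh_edges M. \<not> e \<subseteq> frontier \<Omega>} + card {e\<in>mesh_edges M. e \<subseteq> frontier \<Omega>}"
      using finite_mesh_edges by (intro card_Un_disjoint) auto
    moreover have "{e\<in>mesh_edges M. \<not> e \<subseteq> frontier \<Omega>} \<union> {e\<in>mesh_edges M. e \<subseteq> frontier \<Omega>} = mesh_edges M"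
      by blast
    ultimately show ?thesis by simp
  qed
  show ?A ?B using E Ei M_split n1 n3 by linarith+
qed

end


section \<open>Conforming meshes\<close>

lemma face_of_common:
  assumes "3 simplex T" "3 simplex S" "G face_of T" "G face_of S"
  shows "G \<subseteq> convex hull (verts T \<inter> verts S)"
proof -
  obtain c where c: "c \<subseteq> verts T" "G = convex hull c" using assms face_of_simplex3 by blast
  obtain d where d: "d \<subseteq> verts S" "G = convex hull d" using assms face_of_simplex3 by blast
  have "verts G = c" using verts_convex_hull_frame[OF simplex3_verts(1)[OF assms(1)] c(1)] c(2) by simp
  moreover have "verts G = d" using verts_convex_hull_frame[OF simplex3_verts(1)[OF assms(2)] d(1)] d(2) by simp
  ultimately show ?thesis using c d hull_mono[of c "verts T \<inter> verts S" convex] by simp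
qed

lemma conforming_mesh_complex:
  assumes "conforming_mesh \<Omega> M" "open \<Omega>"
  shows "tet_complex \<Omega> M"
proof
  show "open \<Omega>" by fact
  show "3 simplex T" if "T \<in> M" for T
    using assms(1) that unfolding conforming_mesh_def by auto
  show "finite M" "\<Union>M = closure \<Omega>" using assms(1) unfolding conforming_mesh_def by auto
  fix T S assume TS: "T \<in> M" "S \<in> M"
  have s: "3 simplex T" "3 simplex S" using assms(1) TS unfolding conforming_mesh_def by auto
  show "T \<inter> S \<subseteq> convex hull (verts T \<inter> verts S)"
  proof (cases "T = S")
    case True
    then show ?thesis using simplex3_verts(2)[OF s(1)] by simp
  next
    case False
    then have "T \<inter> S = {} \<or> (\<exists>v. T \<inter> S = {v} \<and> v extreme_point_of T \<and> v extreme_point_of S) \<or>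
      (T \<inter> S) edge_of T \<and> (T \<inter> S) edge_of S \<or> (T \<inter> S) facet_of T \<and> (T \<inter> S) facet_of S"
      using assms(1) TS unfolding conforming_mesh_def by simp
    then have "T \<inter> S = {} \<or> (T \<inter> S) face_of T \<and> (T \<inter> S) face_of S"
      by (auto simp: edge_of_def facet_of_def face_of_singleton)
    then show ?thesis using face_of_common[OF s] by auto
  qed
qed

definition boundary_faces :: "(real^3) set \<Rightarrow> (real^3) set set \<Rightarrow> (real^3) set set" where
  "boundary_faces \<Omega> M = {F\<in>mesh_faces M. F \<subseteq> frontier \<Omega>}"

lemma card_boundary_edges_le:
  assumes M: "conforming_mesh \<Omega> M" "open \<Omega>"
  shows "card {e\<in>mesh_edges M. e \<subseteq> frontier \<Omega>} \<le> 3 * card (boundary_faces \<Omega> M)"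
proof -
  interpret tet_complex \<Omega> M by (rule conforming_mesh_complex[OF M])
  let ?E = "\<lambda>F. (\<lambda>m. convex hull (verts F - {m})) ` verts F"
  have edges: "{e. e edge_of F} = ?E F" if F: "F \<in> boundary_faces \<Omega> M" for F
  proof -
    obtain T where "T \<in> M" "F facet_of T" using F by (auto simp: boundary_faces_def mesh_faces_def)
    then show ?thesis using edge_of_facet[OF simplex_M, of T F] by auto
  qed
  have fin: "finite (boundary_faces \<Omega> M)" using finite_mesh_faces by (simp add: boundary_faces_def)
  have "{e\<in>mesh_edges M. e \<subseteq> frontier \<Omega>} \<subseteq> (\<Union>F\<in>boundary_faces \<Omega> M. ?E F)"
  proof
    fix e assume e: "e \<in> {e\<in>mesh_edges M. e \<subseteq> frontier \<Omega>}"
    then have "card {F\<in>mesh_faces M. F \<subseteq> frontier \<Omega> \<and> e edge_of F} = 2"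
      using M(1) unfolding conforming_mesh_def by blast
    then have "{F\<in>mesh_faces M. F \<subseteq> frontier \<Omega> \<and> e edge_of F} \<noteq> {}" by (metis card.empty zero_neq_numeral)
    then obtain F where F: "F \<in> boundary_faces \<Omega> M" "e edge_of F" by (auto simp: boundary_faces_def)
    then show "e \<in> (\<Union>F\<in>boundary_faces \<Omega> M. ?E F)" using edges by blast
  qed
  moreover have finE: "finite (?E F) \<and> card (?E F) \<le> 3" if "F \<in> boundary_faces \<Omega> M" for F
    using mesh_face_verts(1,2)[of F] that card_image_le[of "verts F"] by (auto simp: boundary_faces_def)
  ultimately have "card {e\<in>mesh_edges M. e \<subseteq> frontier \<Omega>} \<le> card (\<Union>F\<in>boundary_faces \<Omega> M. ?E F)"
    using fin by (intro card_mono) auto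
  also have "\<dots> \<le> (\<Sum>F\<in>boundary_faces \<Omega> M. card (?E F))" by (rule card_UN_le[OF fin])
  also have "\<dots> \<le> (\<Sum>F\<in>boundary_faces \<Omega> M. 3)" by (rule sum_mono) (use finE in blast)
  finally show ?thesis by simp
qed

section \<open>The boundary faces of a mesh of a polytopal domain\<close>

lemma polytopal_frontier_hyperplanes:
  assumes "polytopal_domain \<Omega>"
  obtains HH :: "((real^3) \<times> real) set" where "finite HH" "\<forall>h\<in>HH. fst h \<noteq> 0"
    "frontier \<Omega> \<subseteq> (\<Union>h\<in>HH. {x. fst h \<bullet> x = snd h})"
proof -
  obtain PP where P: "finite PP" "\<forall>P\<in>PP. polytope P" "frontier \<Omega> = \<Union>PP" and op: "open \<Omega>"
    using assms unfolding polytopal_domain_def by blast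
  have "\<forall>P\<in>PP. \<exists>h. fst h \<noteq> 0 \<and> P \<subseteq> {x. fst h \<bullet> x = snd h}"
  proof
    fix P assume PPP: "P \<in> PP"
    have "interior (frontier \<Omega>) = {}"
    proof -
      have "interior (frontier \<Omega>) \<inter> closure \<Omega> \<subseteq> closure (interior (frontier \<Omega>) \<inter> \<Omega>)"
        by (rule open_Int_closure_subset) simp
      moreover have "interior (frontier \<Omega>) \<inter> \<Omega> = {}"
        using interior_subset[of "frontier \<Omega>"] op by (auto simp: frontier_def interior_open)
      moreover have "interior (frontier \<Omega>) \<subseteq> closure \<Omega>"
        using interior_subset[of "frontier \<Omega>"] by (auto simp: frontier_def)
      ultimately show ?thesis by auto
    qed
    then have "interior P = {}" using interior_mono[of P "frontier \<Omega>"] PPP P(3) by blast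
    moreover have "convex P" using P(2) PPP polytope_imp_convex by blast
    ultimately obtain a b where "a \<noteq> 0" "P \<subseteq> {x. a \<bullet> x = b}"
      using empty_interior_subset_hyperplane by metis
    then show "\<exists>h. fst h \<noteq> 0 \<and> P \<subseteq> {x. fst h \<bullet> x = snd h}" by (intro exI[of _ "(a, b)"]) simp
  qed
  from bchoice[OF this] obtain h where h: "\<forall>P\<in>PP. fst (h P) \<noteq> 0 \<and> P \<subseteq> {x. fst (h P) \<bullet> x = snd (h P)}" ..
  show ?thesis
  proof (rule that[of "h ` PP"])
    show "frontier \<Omega> \<subseteq> (\<Union>h\<in>h ` PP. {x. fst h \<bullet> x = snd h})" unfolding P(3) using h by blast
  qed (use P h in auto)
qed

text \<open>If \<open>C\<close> is not contained in one of the hyperplanes, a segment from a point of \<open>C\<close> off the hyperplane meets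
  it at most once; so the points of \<open>C\<close> on it are limits of points in the remaining hyperplanes, whose
  union is closed.\<close>

lemma convex_subset_Union_hyperplanes:
  fixes C :: "'a::euclidean_space set"
  assumes "finite HH" "convex C" "C \<noteq> {}" "C \<subseteq> (\<Union>h\<in>HH. {x. fst h \<bullet> x = (snd h :: real)})"
  shows "\<exists>h\<in>HH. C \<subseteq> {x. fst h \<bullet> x = snd h}"
  using assms(1,4)
proof (induction HH rule: finite_induct)
  case empty
  then show ?case using assms(3) by simp
next
  case (insert h HH)
  let ?R = "\<Union>h\<in>HH. {x. fst h \<bullet> x = snd h}"
  show ?case
  proof (cases "C \<subseteq> {x. fst h \<bullet> x = snd h}")
    case False
    then obtain x where x: "x \<in> C" "fst h \<bullet> x \<noteq> snd h" by blast
    have closed: "closed ?R"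
      using insert(1) by (intro closed_UN) (auto intro: closed_hyperplane)
    have "C \<subseteq> ?R"
    proof
      fix v assume v: "v \<in> C"
      show "v \<in> ?R"
      proof (cases "fst h \<bullet> v = snd h")
        case False
        then show ?thesis using v insert(4) by auto
      next
        case True
        have "\<forall>\<^sub>F t in at_right 0. v + t *\<^sub>R (x - v) \<in> ?R"
          using eventually_at_right_real[of 0 1]
        proof (rule eventually_mono)
          fix t :: real assume t: "t \<in> {0<..<1}"
          have "(1 - t) *\<^sub>R v + t *\<^sub>R x \<in> C"
            using t v x(1) assms(2) by (simp add: convex_alt)
          then have "v + t *\<^sub>R (x - v) \<in> C" by (simp add: algebra_simps)
          moreover have "fst h \<bullet> (v + t *\<^sub>R (x - v)) \<noteq> snd h"
            using t x(2) True by (simp add: inner_add_right inner_diff_right)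
          ultimately show "v + t *\<^sub>R (x - v) \<in> ?R" using insert(4) by auto
        qed simp
        moreover have "((\<lambda>t. v + t *\<^sub>R (x - v)) \<longlongrightarrow> v + 0 *\<^sub>R (x - v)) (at_right 0)"
          by (intro tendsto_intros)
        ultimately show ?thesis
          using Lim_in_closed_set[OF closed _ trivial_limit_at_right_real, of "\<lambda>t. v + t *\<^sub>R (x - v)" 0 v] by simp
      qed
    qed
    then show ?thesis using insert(3) by blast
  qed auto
qed

context tet_complex begin

lemma sum_bary_slope_scaleR:
  assumes "T \<in> M" shows "(\<Sum>p\<in>verts T. bary_slope T p u *\<^sub>R p) = u"
proof -
  have "(\<Sum>p\<in>verts T. bary_slope T p u *\<^sub>R p) =
      (\<Sum>p\<in>verts T. bary (verts T) p u *\<^sub>R p) - (\<Sum>p\<in>verts T. bary (verts T) p 0 *\<^sub>R p)"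
    by (simp add: bary_slope_def scaleR_left_diff_distrib sum_subtractf)
  then show ?thesis by (simp add: sum_bary_scaleR[OF frame[OF assms]])
qed

lemma bary_slope_opp_0:
  assumes T: "T \<in> M" "F facet_of T" and F: "F \<subseteq> {x. a \<bullet> x = b}" and a: "a \<noteq> 0" "a \<bullet> u = 0"
  shows "bary_slope T (opp T F) u = 0"
proof -
  define ov where "ov = opp T F"
  have vT: "verts T = insert ov (verts F)" "ov \<notin> verts F" "finite (verts F)"
    using verts_insert_opp[OF T] opp_notin[OF T] facet_verts(3)[OF T] by (auto simp: ov_def)
  have vF: "a \<bullet> p = b" if "p \<in> verts F" for p
  proof -
    have "p \<in> F" using facet_verts(4)[OF T] hull_inc[OF that, of convex] by simp
    then show ?thesis using F by blast
  qed
  have ne: "a \<bullet> ov - b \<noteq> 0"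
  proof
    assume "a \<bullet> ov - b = 0"
    then have z: "a \<bullet> p - b = 0" if "p \<in> verts T" for p using that vT vF by auto
    have aff: "affine_functional (\<lambda>x. a \<bullet> x - b)"
      by (intro affine_functional_diff affine_functional_inner affine_functional_const)
    have "a \<bullet> x - b = 0" for x
      by (rule affine_functional_eq_0[OF aff frame[OF T(1)] z])
    from this[of 0] this[of a] show False using a(1) by simp
  qed
  have "0 = a \<bullet> (\<Sum>p\<in>verts T. bary_slope T p u *\<^sub>R p)" using a(2) sum_bary_slope_scaleR[OF T(1)] by simp
  also have "\<dots> = (\<Sum>p\<in>verts T. bary_slope T p u * (a \<bullet> p))" by (simp add: inner_sum_right)
  also have "\<dots> = bary_slope T ov u * (a \<bullet> ov) + (\<Sum>p\<in>verts F. bary_slope T p u * b)"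
    using vT vF by simp
  also have "(\<Sum>p\<in>verts F. bary_slope T p u * b) = - bary_slope T ov u * b"
  proof -
    have "(\<Sum>p\<in>verts F. bary_slope T p u) = - bary_slope T ov u"
      using sum_bary_slope[OF T(1), of u] vT by simp
    then show ?thesis by (simp add: sum_distrib_right[symmetric])
  qed
  finally have "bary_slope T ov u * (a \<bullet> ov - b) = 0" by (auto simp: algebra_simps)
  then show ?thesis using ne by (simp add: ov_def)
qed

text \<open>On directions in the plane, the slope of a barycentric coordinate is represented by the projection of its
  gradient. The projection is nonzero, because the coordinate takes different values at two vertices in
  the plane.\<close>

lemma generic_slopes_in_plane:
  assumes a: "a \<noteq> 0"
  obtains u where "a \<bullet> u = 0"
    "\<And>T F p b. T \<in> M \<Longrightarrow> F facet_of T \<Longrightarrow> F \<subseteq> {x. a \<bullet> x = b} \<Longrightarrow> p \<in> verts F \<Longrightarrow> bary_slope T p u \<noteq> 0"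
proof -
  define proj where "proj g = g - ((g \<bullet> a) / (a \<bullet> a)) *\<^sub>R a" for g
  have sl: "\<exists>g. \<forall>x. bary_slope T p x = g \<bullet> x" if T: "T \<in> M" "p \<in> verts T" for T p
  proof -
    obtain g c where "\<And>x. bary (verts T) p x = g \<bullet> x + c"
      using affine_functional_bary[OF frame[OF T(1)] T(2)] unfolding affine_functional_def by auto
    then show ?thesis by (intro exI[of _ g]) (simp add: bary_slope_def)
  qed
  define G where "G T p = (SOME g. \<forall>x. bary_slope T p x = g \<bullet> x)" for T p
  have G: "bary_slope T p x = G T p \<bullet> x" if "T \<in> M" "p \<in> verts T" for T p x
    unfolding G_def by (rule spec[OF someI_ex[OF sl[OF that]]])
  let ?A = "(\<Union>T\<in>M. (\<lambda>p. proj (G T p)) ` verts T) - {0}"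
  have "finite ?A" using finite_M finite_verts by simp
  moreover have "0 \<notin> ?A" by simp
  ultimately obtain w where w: "\<And>g. g \<in> ?A \<Longrightarrow> g \<bullet> w \<noteq> 0" by (rule generic_direction) blast
  define u where "u = proj w"
  have pr: "g \<bullet> u = proj g \<bullet> w" for g
    by (simp add: u_def proj_def inner_diff_left inner_diff_right inner_commute)
  show ?thesis
  proof (rule that[of u])
    show "a \<bullet> u = 0" using a by (simp add: u_def proj_def inner_diff_right inner_commute)
    fix T F p b assume T: "T \<in> M" "F facet_of T" "F \<subseteq> {x. a \<bullet> x = b}" and p: "p \<in> verts F"
    have pT: "p \<in> verts T" using facet_verts(1)[OF T(1,2)] p by blast
    have "verts F \<noteq> {p}" using facet_verts(2)[OF T(1,2)] by auto
    then obtain q where q: "q \<in> verts F" "q \<noteq> p" using p by blast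
    have inF: "v \<in> F" if "v \<in> verts F" for v
      using facet_verts(4)[OF T(1,2)] hull_inc[OF that, of convex] by simp
    have apq: "a \<bullet> (p - q) = 0" using inF[OF p] inF[OF q(1)] T(3) by (auto simp: inner_diff_right)
    have "bary_slope T p (p - q) = bary (verts T) p p - bary (verts T) p q"
      using bary_line[OF T(1) pT, of q 1 "p - q"] by simp
    also have "\<dots> = 1" using bary_vertex[OF frame[OF T(1)] pT] pT q facet_verts(1)[OF T(1,2)] by auto
    finally have "G T p \<bullet> (p - q) = 1" unfolding G[OF T(1) pT] .
    then have "proj (G T p) \<bullet> (p - q) = 1" using apq by (simp add: proj_def inner_diff_left)
    then have "proj (G T p) \<noteq> 0" by auto
    then have "proj (G T p) \<bullet> w \<noteq> 0" using T(1) pT by (intro w) blast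
    then show "bary_slope T p u \<noteq> 0" unfolding G[OF T(1) pT] pr .
  qed
qed

text \<open>In a plane, a generic direction or its negative enters each triangle through exactly one
  vertex, and at most one triangle is entered through a given vertex.\<close>

lemma card_faces_in_hyperplane_le:
  assumes a: "a \<noteq> 0" and B: "B \<subseteq> mesh_faces M" "\<And>F. F \<in> B \<Longrightarrow> F \<subseteq> {x. a \<bullet> x = b}"
    and V: "\<And>F. F \<in> B \<Longrightarrow> verts F \<subseteq> X" "finite X"
  shows "card B \<le> 2 * card X"
proof -
  obtain u where u: "a \<bullet> u = 0"
    "\<And>T F p b. T \<in> M \<Longrightarrow> F facet_of T \<Longrightarrow> F \<subseteq> {x. a \<bullet> x = b} \<Longrightarrow> p \<in> verts F \<Longrightarrow> bary_slope T p u \<noteq> 0"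
    by (rule generic_slopes_in_plane[OF a]) blast
  define w where "w s = (if s then u else - u)" for s
  have "\<forall>F\<in>B. \<exists>ps. fst ps \<in> verts F \<and> (\<forall>\<^sub>F t in at_right 0. fst ps + t *\<^sub>R w (snd ps) \<in> rel_interior F)"
  proof
    fix F assume F: "F \<in> B"
    then obtain T where T: "T \<in> M" "F facet_of T" using B(1) by (auto simp: mesh_faces_def)
    note vF = facet_verts[OF T]
    obtain p q r where pqr: "verts F = {p, q, r}" "p \<noteq> q" "p \<noteq> r" "q \<noteq> r"
      using vF(2) by (auto simp: card_3_iff)
    have o0: "bary_slope T (opp T F) u = 0"
      by (rule bary_slope_opp_0[OF T B(2)[OF F] a u(1)])
    have sum0: "bary_slope T p u + bary_slope T q u + bary_slope T r u = 0"
      using sum_bary_slope[OF T(1), of u] verts_insert_opp[OF T] opp_notin[OF T] pqr o0 vF(3) by simp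
    have enter: "\<forall>\<^sub>F t in at_right 0. v + t *\<^sub>R w s \<in> rel_interior F"
      if v: "v \<in> verts F" and pos: "\<forall>v'\<in>verts F - {v}. 0 < bary_slope T v' (w s)" for v s
    proof -
      have vT: "v \<in> verts T" using v vF(1) by blast
      have b: "bary (verts T) v' (v + t *\<^sub>R w s) = (if v' = v then 1 else 0) + t * bary_slope T v' (w s)"
        if "v' \<in> verts T" for v' t
        using bary_line[OF T(1) that, of v t "w s"] bary_vertex[OF frame[OF T(1)] that vT] by simp
      have "((\<lambda>t. 1 + t * bary_slope T v (w s)) \<longlongrightarrow> 1 + 0 * bary_slope T v (w s)) (at_right 0)"
        by (intro tendsto_intros)
      then have "\<forall>\<^sub>F t in at_right 0. 0 < 1 + t * bary_slope T v (w s)"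
        using order_tendstoD(1)[of "\<lambda>t. 1 + t * bary_slope T v (w s)" 1 _ 0] by simp
      then show ?thesis
        using eventually_at_right_less[of "0::real"]
      proof eventually_elim
        fix t :: real assume t: "0 < 1 + t * bary_slope T v (w s)" "0 < t"
        have "0 < bary (verts T) v' (v + t *\<^sub>R w s)" if "v' \<in> verts F" for v'
          using b[of v' t] that vF(1) t pos by (cases "v' = v") auto
        moreover have "bary (verts T) v' (v + t *\<^sub>R w s) = 0" if "v' \<in> verts T - verts F" for v'
        proof -
          have v': "v' = opp T F" "v' \<in> verts T" "v' \<noteq> v" using that verts_insert_opp[OF T] v by auto
          have "bary_slope T (opp T F) (w s) = 0"
            using o0 bary_slope_minus[OF T(1) opp(1)[OF T], of u] by (simp add: w_def)
          then show ?thesis using b[OF v'(2), of t] v' by simp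
        qed
        ultimately show "v + t *\<^sub>R w s \<in> rel_interior F"
          using rel_interior_convex_hull_bary[OF frame[OF T(1)] vF(1), of "v + t *\<^sub>R w s"] vF(4) by simp
      qed
    qed
    have pq: "v \<in> verts F \<Longrightarrow> bary_slope T v u \<noteq> 0" for v using u(2)[OF T B(2)[OF F]] .
    have minus: "v \<in> verts F \<Longrightarrow> bary_slope T v (- u) = - bary_slope T v u" for v
      using bary_slope_minus[OF T(1), of v u] vF(1) by blast
    have nz: "bary_slope T p u \<noteq> 0" "bary_slope T q u \<noteq> 0" "bary_slope T r u \<noteq> 0"
      and mi: "bary_slope T p (-u) = - bary_slope T p u" "bary_slope T q (-u) = - bary_slope T q u"
        "bary_slope T r (-u) = - bary_slope T r u"
      using pq minus pqr(1) by auto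
    have "\<exists>v s. v \<in> verts F \<and> (\<forall>v'\<in>verts F - {v}. 0 < bary_slope T v' (w s))"
    proof -
      have ex: "\<exists>v s. v \<in> verts F \<and> (\<forall>v'\<in>verts F - {v}. 0 < bary_slope T v' (w s))"
        if "x \<in> {p, q, r}" "\<forall>v'\<in>{p, q, r} - {x}. 0 < bary_slope T v' (w s)" for x s
        using that pqr(1) by (intro exI[of _ x] exI[of _ s]) simp
      consider "0 < bary_slope T q u \<and> 0 < bary_slope T r u" | "bary_slope T q u < 0 \<and> bary_slope T r u < 0"
        | "0 < bary_slope T p u \<and> 0 < bary_slope T r u" | "bary_slope T p u < 0 \<and> bary_slope T r u < 0"
        | "0 < bary_slope T p u \<and> 0 < bary_slope T q u" | "bary_slope T p u < 0 \<and> bary_slope T q u < 0"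
        using nz by linarith
      then show ?thesis
      proof cases
        case 1 then show ?thesis by (intro ex[of p True]) (auto simp: w_def)
      next
        case 2 then show ?thesis by (intro ex[of p False]) (auto simp: w_def mi)
      next
        case 3 then show ?thesis by (intro ex[of q True]) (auto simp: w_def)
      next
        case 4 then show ?thesis by (intro ex[of q False]) (auto simp: w_def mi)
      next
        case 5 then show ?thesis by (intro ex[of r True]) (auto simp: w_def)
      next
        case 6 then show ?thesis by (intro ex[of r False]) (auto simp: w_def mi)
      qed
    qed
    then obtain v s where "v \<in> verts F" "\<forall>v'\<in>verts F - {v}. 0 < bary_slope T v' (w s)" by blast
    then show "\<exists>ps. fst ps \<in> verts F \<and> (\<forall>\<^sub>F t in at_right 0. fst ps + t *\<^sub>R w (snd ps) \<in> rel_interior F)"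
      using enter[of v s] by (intro exI[of _ "(v, s)"]) simp
  qed
  from bchoice[OF this] obtain f where
    f: "\<forall>F\<in>B. fst (f F) \<in> verts F \<and> (\<forall>\<^sub>F t in at_right 0. fst (f F) + t *\<^sub>R w (snd (f F)) \<in> rel_interior F)" ..
  have "inj_on f B"
  proof (rule inj_onI)
    fix F G assume FG: "F \<in> B" "G \<in> B" "f F = f G"
    have "\<forall>\<^sub>F t in at_right 0. fst (f F) + t *\<^sub>R w (snd (f F)) \<in> rel_interior F \<and>
        fst (f F) + t *\<^sub>R w (snd (f F)) \<in> rel_interior G"
      using conjunct2[OF bspec[OF f FG(1)]] conjunct2[OF bspec[OF f FG(2)]] unfolding FG(3)
      by (rule eventually_conj)
    then obtain x where x: "x \<in> rel_interior F" "x \<in> rel_interior G"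
      using eventually_happens'[OF trivial_limit_at_right_real] by blast
    obtain T S where T: "T \<in> M" "F facet_of T" and S: "S \<in> M" "G facet_of S"
      using B(1) FG(1,2) unfolding mesh_faces_def by blast
    have "0 < coord x p \<longleftrightarrow> p \<in> verts F" for p
      using coord_rel_interior(2)[OF T(1) facet_verts(1)[OF T]] x(1) facet_verts(4)[OF T] by simp
    moreover have "0 < coord x p \<longleftrightarrow> p \<in> verts G" for p
      using coord_rel_interior(2)[OF S(1) facet_verts(1)[OF S]] x(2) facet_verts(4)[OF S] by simp
    ultimately have "verts F = verts G" by blast
    then show "F = G" using facet_verts(4)[OF T] facet_verts(4)[OF S] by metis
  qed
  moreover have "f ` B \<subseteq> X \<times> (UNIV :: bool set)"
  proof
    fix ps assume "ps \<in> f ` B"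
    then obtain F where F: "F \<in> B" "ps = f F" by blast
    then have "fst ps \<in> X" using bspec[OF f F(1)] V(1)[OF F(1)] by blast
    then show "ps \<in> X \<times> UNIV" by (cases ps) simp
  qed
  ultimately have "card B \<le> card (X \<times> (UNIV :: bool set))"
    using V(2) by (intro card_inj_on_le[of f]) auto
  then show ?thesis by (simp add: card_cartesian_product)
qed

end

lemma card_boundary_faces_le:
  assumes "polytopal_domain \<Omega>"
  obtains C where "\<And>M. conforming_mesh \<Omega> M \<Longrightarrow> card (boundary_faces \<Omega> M) \<le> C * card (boundary_vertices \<Omega> M)"
proof -
  obtain HH :: "((real^3) \<times> real) set" where H: "finite HH" "\<forall>h\<in>HH. fst h \<noteq> 0"
    "frontier \<Omega> \<subseteq> (\<Union>h\<in>HH. {x. fst h \<bullet> x = snd h})"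
    by (rule polytopal_frontier_hyperplanes[OF assms])
  have op: "open \<Omega>" using assms by (simp add: polytopal_domain_def)
  show ?thesis
  proof (rule that[of "2 * card HH"])
    fix M assume M: "conforming_mesh \<Omega> M"
    interpret tet_complex \<Omega> M by (rule conforming_mesh_complex[OF M op])
    define B where "B h = {F\<in>boundary_faces \<Omega> M. F \<subseteq> {x. fst h \<bullet> x = snd h}}" for h
    have fin: "finite (boundary_faces \<Omega> M)" using finite_mesh_faces by (simp add: boundary_faces_def)
    have "boundary_faces \<Omega> M \<subseteq> (\<Union>h\<in>HH. B h)"
    proof
      fix F assume F: "F \<in> boundary_faces \<Omega> M"
      then have FM: "F \<in> mesh_faces M" "F \<subseteq> frontier \<Omega>" by (auto simp: boundary_faces_def)
      have "convex F" using mesh_face_verts(3)[OF FM(1)] convex_convex_hull by metis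
      moreover have "F \<noteq> {}" using FM(1) by (auto simp: mesh_faces_def facet_of_def)
      ultimately obtain h where "h \<in> HH" "F \<subseteq> {x. fst h \<bullet> x = snd h}"
        using convex_subset_Union_hyperplanes[OF H(1), of F] FM(2) H(3) by blast
      then show "F \<in> (\<Union>h\<in>HH. B h)" using F by (auto simp: B_def)
    qed
    then have "card (boundary_faces \<Omega> M) \<le> card (\<Union>h\<in>HH. B h)"
      using fin H(1) by (intro card_mono) (auto simp: B_def)
    also have "\<dots> \<le> (\<Sum>h\<in>HH. card (B h))" by (rule card_UN_le[OF H(1)])
    also have "\<dots> \<le> (\<Sum>h\<in>HH. 2 * card (boundary_vertices \<Omega> M))"
    proof (rule sum_mono)
      fix h assume h: "h \<in> HH"
      show "card (B h) \<le> 2 * card (boundary_vertices \<Omega> M)"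
      proof (rule card_faces_in_hyperplane_le[of "fst h" _ "snd h"])
        show "fst h \<noteq> 0" using H(2) h by blast
        show "finite (boundary_vertices \<Omega> M)"
          using finite_mesh_vertices by (simp add: boundary_vertices_def)
        fix F assume F: "F \<in> B h"
        then have FM: "F \<in> mesh_faces M" "F \<subseteq> frontier \<Omega>" by (auto simp: B_def boundary_faces_def)
        have "verts F \<subseteq> F" using mesh_face_verts(3)[OF FM(1)] hull_subset[of "verts F" convex] by simp
        then show "verts F \<subseteq> boundary_vertices \<Omega> M"
          using mesh_face_verts(4)[OF FM(1)] FM(2) by (auto simp: boundary_vertices_def)
        show "F \<subseteq> {x. fst h \<bullet> x = snd h}" using F by (simp add: B_def)
      qed (auto simp: B_def boundary_faces_def)
    qed
    also have "\<dots> = 2 * card HH * card (boundary_vertices \<Omega> M)" by simp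
    finally show "card (boundary_faces \<Omega> M) \<le> 2 * card HH * card (boundary_vertices \<Omega> M)" .
  qed
qed


section \<open>Sequences of meshes with large average vertex degree\<close>

theorem eventually_proper_subset_of_average_edges:
  assumes \<Omega>: "polytopal_domain \<Omega>" and T: "\<And>n. conforming_mesh \<Omega> (T n)"
    and V: "filterlim (\<lambda>n. card (mesh_vertices (T n))) at_top sequentially"
    and Vb: "(\<lambda>n. real (card (boundary_vertices \<Omega> (T n))) / real (card (mesh_vertices (T n)))) \<longlonglongrightarrow> 0"
    and W: "\<And>n. Worsey_Farin_split (T n) (W n)"
    and c: "c > 4.4" "\<And>n. average_edges (T n) \<ge> c"
  shows "\<forall>\<^sub>F n in sequentially. curl_image \<Omega> (S_space \<Omega> 3 (W n)) \<subset> Z_space \<Omega> 2 (W n)"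
proof -
  have op: "open \<Omega>" using \<Omega> by (simp add: polytopal_domain_def)
  obtain C where C: "\<And>M. conforming_mesh \<Omega> M \<Longrightarrow> card (boundary_faces \<Omega> M) \<le> C * card (boundary_vertices \<Omega> M)"
    by (rule card_boundary_faces_le[OF \<Omega>]) blast
  define K where "K = 13 * (1 + 3 * real C)"
  have K: "K > 0" by (simp add: K_def)
  have "\<forall>\<^sub>F n in sequentially. 1 \<le> card (mesh_vertices (T n))"
    using V by (auto simp: filterlim_at_top)
  moreover have "\<forall>\<^sub>F n in sequentially.
      real (card (boundary_vertices \<Omega> (T n))) / real (card (mesh_vertices (T n))) < (5 * c - 22) / K"
    using Vb c(1) K by (intro order_tendstoD(2)) (auto intro: divide_pos_pos)
  ultimately show ?thesis
  proof eventually_elim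
    case (elim n)
    interpret tet_complex \<Omega> "T n" by (rule conforming_mesh_complex[OF T op])
    define v e t vb where "v = real (card (mesh_vertices (T n)))" and "e = real (card (mesh_edges (T n)))"
      and "t = real (card (T n))" and "vb = real (card (boundary_vertices \<Omega> (T n)))"
    have v: "v > 0" using elim(1) by (simp add: v_def)
    have "vb / v < (5 * c - 22) / K" using elim(2) by (simp add: vb_def v_def)
    then have vb: "K * vb < (5 * c - 22) * v" using v K by (simp add: field_simps)
    have "c \<le> 2 * e / v" using c(2)[of n] by (simp add: average_edges_def e_def v_def)
    then have e: "c * v \<le> 2 * e" using v by (simp add: field_simps)
    have "card (mesh_edges (T n)) \<le> card (T n) + card (mesh_vertices (T n)) + card (boundary_vertices \<Omega> (T n))
        + 3 * C * card (boundary_vertices \<Omega> (T n))"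
      using card_edges_le(1) card_boundary_edges_le[OF T[of n] op] C[OF T[of n]] by linarith
    from of_nat_mono[OF this, where 'a = real] have "e \<le> t + v + vb + 3 * real C * vb"
      by (simp add: e_def t_def v_def vb_def)
    then have t: "13 * e \<le> 13 * t + 13 * v + K * vb" by (simp add: K_def algebra_simps)
    \<comment> \<open>\<open>13 t - 9 v - 3 e\<close> is at least \<open>10 e - 22 v\<close> up to the boundary term, and \<open>10 e\<close> is at least \<open>5 c v\<close>\<close>
    have "9 * v + 3 * e < 13 * t" using t e vb by (simp add: algebra_simps)
    then have "9 * card (mesh_vertices (T n)) + 3 * card (mesh_edges (T n)) < 13 * card (T n)"
      unfolding e_def t_def v_def by linarith
    then show ?case by (rule Worsey_Farin_curl_proper_subset[OF tet_complex_axioms W])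
  qed
qed

section \<open>Uniform refinement\<close>

context tet_complex begin

lemma interior_unique:
  assumes "T \<in> M" "S \<in> M" "x \<in> interior T" "x \<in> S"
  shows "T = S"
proof -
  have "x \<in> rel_interior (convex hull (verts T))"
    using assms(3) hull_verts[OF assms(1)] interior_subset_rel_interior by auto
  from face_verts_subset[OF assms(1) subset_refl this assms(2,4)] show ?thesis
    by (rule verts_subset_eq[OF assms(1,2)])
qed

lemma interior_nonempty: "T \<in> M \<Longrightarrow> interior T \<noteq> {}"
  using affine_frame_interior_nonempty[OF frame, of T] hull_verts[of T] by simp

lemma mesh_edge_midpoint:
  assumes "closed_segment p q \<in> mesh_edges M"
  shows "midpoint p q = (\<Sum>v\<in>verts (closed_segment p q). (1/2) *\<^sub>R v)"
proof -
  have v: "verts (closed_segment p q) = {p, q}"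
    unfolding segment_convex_hull by (rule verts_convex_hull) (rule affine_independent_2)
  then have "p \<noteq> q" using mesh_edge_verts(1)[OF assms] by auto
  then show ?thesis by (simp add: v midpoint_def scaleR_right_distrib)
qed

end

context
  fixes \<Omega> M M'
  assumes M: "tet_complex \<Omega> M" and M': "tet_complex \<Omega> M'" and ref: "uniformly_refines M' M"
begin

interpretation M: tet_complex \<Omega> M by (rule M)
interpretation M': tet_complex \<Omega> M' by (rule M')

lemmas refinement_clauses = conjunct1[OF ref[unfolded uniformly_refines_def]]
  conjunct1[OF conjunct2[OF ref[unfolded uniformly_refines_def]]]
  conjunct1[OF conjunct2[OF conjunct2[OF ref[unfolded uniformly_refines_def]]]]
  conjunct2[OF conjunct2[OF conjunct2[OF conjunct2[OF ref[unfolded uniformly_refines_def]]]]]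

lemma refinement_parent:
  assumes "T' \<in> M'" obtains T where "T \<in> M" "T' \<subseteq> T"
  using bspec[OF refinement_clauses(1) assms] by blast

lemma refinement_parent_unique:
  assumes "T' \<in> M'" "T \<in> M" "S \<in> M" "T' \<subseteq> T" "T' \<subseteq> S"
  shows "T = S"
proof -
  obtain x where "x \<in> interior T'" using M'.interior_nonempty[OF assms(1)] by blast
  then have "x \<in> interior T" "x \<in> S" using interior_mono[OF assms(4)] interior_subset[of T'] assms(5) by blast+
  then show ?thesis by (rule M.interior_unique[OF assms(2,3)])
qed

lemma refinement_child:
  assumes "T \<in> M" "x \<in> T" obtains T' where "T' \<in> M'" "T' \<subseteq> T" "x \<in> T'"
proof -
  have "\<Union>{T'\<in>M'. T' \<subseteq> T} = T" using bspec[OF refinement_clauses(2) assms(1)] by (rule conjunct2)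
  then have "x \<in> \<Union>{T'\<in>M'. T' \<subseteq> T}" using assms(2) by simp
  then show ?thesis using that by blast
qed

lemma card_refinement: "card M' = 8 * card M"
proof -
  let ?C = "\<lambda>T. {T'\<in>M'. T' \<subseteq> T}"
  have "M' = (\<Union>T\<in>M. ?C T)"
  proof
    show "M' \<subseteq> (\<Union>T\<in>M. ?C T)"
    proof
      fix T' assume T': "T' \<in> M'"
      obtain T where "T \<in> M" "T' \<subseteq> T" by (rule refinement_parent[OF T'])
      then show "T' \<in> (\<Union>T\<in>M. ?C T)" using T' by blast
    qed
  qed blast
  then have "card M' = card (\<Union>T\<in>M. ?C T)" by simp
  also have "\<dots> = (\<Sum>T\<in>M. card (?C T))"
  proof (rule card_UN_disjoint[OF M.finite_M])
    show "\<forall>T\<in>M. finite (?C T)" using M'.finite_M by simp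
    show "\<forall>T\<in>M. \<forall>S\<in>M. T \<noteq> S \<longrightarrow> ?C T \<inter> ?C S = {}"
      using refinement_parent_unique by blast
  qed
  also have "\<dots> = (\<Sum>T\<in>M. 8)"
    using refinement_clauses(2) by (intro sum.cong) simp_all
  finally show ?thesis by simp
qed

lemma card_vertices_refinement: "card (mesh_vertices M') \<le> card (mesh_vertices M) + card (mesh_edges M)"
proof -
  let ?P = "{midpoint p q | p q. closed_segment p q \<in> mesh_edges M}"
  have "?P \<subseteq> (\<lambda>e. \<Sum>v\<in>verts e. (1/2) *\<^sub>R v) ` mesh_edges M"
  proof
    fix x assume "x \<in> ?P"
    then obtain p q where pq: "x = midpoint p q" "closed_segment p q \<in> mesh_edges M" by blast
    then show "x \<in> (\<lambda>e. \<Sum>v\<in>verts e. (1/2) *\<^sub>R v) ` mesh_edges M"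
      using M.mesh_edge_midpoint[OF pq(2)] by blast
  qed
  then have "card ?P \<le> card ((\<lambda>e. \<Sum>v\<in>verts e. (1/2) *\<^sub>R v) ` mesh_edges M)"
    by (intro card_mono finite_imageI M.finite_mesh_edges)
  also have "\<dots> \<le> card (mesh_edges M)" by (rule card_image_le[OF M.finite_mesh_edges])
  finally have "card ?P \<le> card (mesh_edges M)" .
  moreover have "mesh_vertices M' = mesh_vertices M \<union> ?P"
    by (rule refinement_clauses(4))
  ultimately show ?thesis using card_Un_le[of "mesh_vertices M" ?P] by simp
qed

text \<open>A boundary face of the refinement cannot meet the interior of a tetrahedron of the coarse mesh,
  nor a coarse face inside the domain: in both cases the refined tetrahedra on its other side would
  also have it as a facet.\<close>

lemma boundary_face_refinement:
  assumes conf: "conforming_mesh \<Omega> M" and conf': "conforming_mesh \<Omega> M'" and F': "F' \<in> boundary_faces \<Omega> M'"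
  shows "\<exists>F\<in>boundary_faces \<Omega> M. F' \<subseteq> F"
proof -
  have F'M: "F' \<in> mesh_faces M'" "F' \<subseteq> frontier \<Omega>" using F' by (auto simp: boundary_faces_def)
  then have "card {T\<in>M'. F' facet_of T} = 1"
    using conf' unfolding conforming_mesh_def by simp
  then obtain T' where T'eq: "{T\<in>M'. F' facet_of T} = {T'}" by (auto simp: card_1_singleton_iff)
  then have T': "T' \<in> M'" "F' facet_of T'" by blast+
  note vF' = M'.facet_verts[OF T']
  obtain x where x: "x \<in> rel_interior F'"
    using rel_interior_eq_empty[of F'] vF'(2,4) convex_convex_hull[of "verts F'"] by force
  then have xF': "x \<in> F'" using rel_interior_subset by blast
  then have xT': "x \<in> T'" using facet_of_imp_subset[OF T'(2)] by blast
  have unique: "S' = T'" if "S' \<in> M'" "x \<in> S'" for S'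
  proof -
    have "verts F' \<subseteq> verts S'"
      using M'.face_verts_subset[OF T'(1) vF'(1) _ that] x vF'(4) by simp
    then have "F' facet_of S'" by (rule M'.facet_if_verts_subset[OF that(1) T'])
    then show ?thesis using T'eq that(1) by blast
  qed
  obtain T where T: "T \<in> M" "T' \<subseteq> T" by (rule refinement_parent[OF T'(1)])
  have xT: "x \<in> T" using xT' T(2) by blast
  \<comment> \<open>otherwise points across \<open>F'\<close> near \<open>x\<close> lie in another refined tetrahedron, which then has facet \<open>F'\<close>\<close>
  have not_int: "x \<notin> interior T"
  proof
    assume xi: "x \<in> interior T"
    define ov where "ov = M'.opp T' F'"
    have ovT: "ov \<in> verts T'" "ov \<notin> verts F'"
      using M'.opp(1)[OF T'] M'.opp_notin[OF T'] by (simp_all add: ov_def)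
    have b0: "bary (verts T') ov x = 0"
      using rel_interior_convex_hull_bary[OF M'.frame[OF T'(1)] vF'(1), of x] x vF'(4) ovT by simp
    have sl: "bary_slope T' ov (x - ov) = - 1"
      using M'.bary_line[OF T'(1) ovT(1), of ov 1 "x - ov"] b0
        bary_vertex[OF M'.frame[OF T'(1)] ovT(1) ovT(1)] by simp
    have lim: "((\<lambda>t. x + t *\<^sub>R (x - ov)) \<longlongrightarrow> x + 0 *\<^sub>R (x - ov)) (at_right 0)"
      by (intro tendsto_intros)
    have "\<forall>\<^sub>F t in at_right 0. x + t *\<^sub>R (x - ov) \<in> interior T"
      using topological_tendstoD[OF lim open_interior] xi by simp
    then have "\<forall>\<^sub>F t in at_right 0. \<exists>S'\<in>M' - {T'}. x + t *\<^sub>R (x - ov) \<in> S'"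
      using eventually_at_right_less[of "0::real"]
    proof eventually_elim
      fix t :: real assume t: "x + t *\<^sub>R (x - ov) \<in> interior T" "0 < t"
      then obtain S' where S': "S' \<in> M'" "x + t *\<^sub>R (x - ov) \<in> S'"
        using refinement_child[OF T(1), of "x + t *\<^sub>R (x - ov)"] interior_subset by blast
      have "S' \<noteq> T'"
      proof
        assume "S' = T'"
        then have "x + t *\<^sub>R (x - ov) \<in> T'" using S' by simp
        then have "0 \<le> bary (verts T') ov (x + t *\<^sub>R (x - ov))"
          using M'.coord_nonneg[of "x + t *\<^sub>R (x - ov)" ov] M'.coord_eq[OF T'(1), of "x + t *\<^sub>R (x - ov)" ov] ovT(1)
          by simp
        then show False using M'.bary_line[OF T'(1) ovT(1), of x t "x - ov"] b0 sl t(2) by simp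
      qed
      then show "\<exists>S'\<in>M' - {T'}. x + t *\<^sub>R (x - ov) \<in> S'" using S' by blast
    qed
    then have "\<exists>\<^sub>F t in at_right 0. \<exists>S'\<in>M' - {T'}. x + t *\<^sub>R (x - ov) \<in> S'"
      by (rule eventually_frequently[OF trivial_limit_at_right_real])
    from frequently_bex_finite[OF _ this]
    obtain S' where S': "S' \<in> M' - {T'}" "\<exists>\<^sub>F t in at_right 0. x + t *\<^sub>R (x - ov) \<in> S'"
      using M'.finite_M by blast
    have "x \<in> S'"
    proof (rule ccontr)
      assume "x \<notin> S'"
      moreover have "open (- S')"
        using closed_simplex[OF M'.simplex_M, of S'] S'(1) by (intro open_Compl) blast
      ultimately have "\<forall>\<^sub>F t in at_right 0. x + t *\<^sub>R (x - ov) \<in> - S'"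
        by (intro topological_tendstoD[OF lim]) simp_all
      then have "\<not> (\<exists>\<^sub>F t in at_right 0. x + t *\<^sub>R (x - ov) \<in> S')" by (simp add: frequently_def)
      then show False using S'(2) by blast
    qed
    then show False using unique[of S'] S'(1) by blast
  qed
  then obtain p where p: "p \<in> verts T" "bary (verts T) p x \<le> 0"
    using M.mem_interior_bary[OF T(1)] by (auto simp: not_less)
  define F where "F = convex hull (verts T - {p})"
  have F: "F facet_of T" using facet_of_simplex3[OF M.simplex_M[OF T(1)]] p(1) F_def by auto
  have "bary (verts T) q x = M.coord x q" if "q \<in> verts T" for q using M.coord_eq[OF T(1) xT] that by simp
  then have xF: "x \<in> F"
    unfolding F_def convex_hull_subset_bary[OF M.frame[OF T(1)] Diff_subset]
    using p M.coord_nonneg[of x] by (auto intro: antisym)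
  have F'F: "F' \<subseteq> F"
  proof (rule subset_of_face_of)
    show "F face_of T" using F by (rule facet_of_imp_face_of)
    show "F' \<subseteq> T" using facet_of_imp_subset[OF T'(2)] T(2) by blast
    show "F \<inter> rel_interior F' \<noteq> {}" using x xF by blast
  qed
  have FM: "F \<in> mesh_faces M" using M.facet_in_mesh_faces[OF T(1) F] .
  have "F \<subseteq> frontier \<Omega>"
  proof (rule ccontr)
    assume "\<not> F \<subseteq> frontier \<Omega>"
    then have "card {T\<in>M. F facet_of T} = 2" using conf FM unfolding conforming_mesh_def by simp
    then have "{T\<in>M. F facet_of T} \<noteq> {T}" by auto
    then obtain S where S: "S \<in> M" "F facet_of S" "S \<noteq> T" using T(1) F by blast
    have "x \<in> S" using xF facet_of_imp_subset[OF S(2)] by blast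
    then obtain S' where S': "S' \<in> M'" "S' \<subseteq> S" "x \<in> S'" by (rule refinement_child[OF S(1)])
    have "S' = T'" by (rule unique[OF S'(1,3)])
    then have "T = S" using refinement_parent_unique[OF T'(1) T(1) S(1) T(2)] S'(2) by simp
    then show False using S(3) by simp
  qed
  then show ?thesis using FM F'F by (auto simp: boundary_faces_def)
qed

lemma card_boundary_faces_refinement:
  assumes "conforming_mesh \<Omega> M" "conforming_mesh \<Omega> M'"
  shows "card (boundary_faces \<Omega> M') \<le> 4 * card (boundary_faces \<Omega> M)"
proof -
  let ?C = "\<lambda>F. {F'\<in>mesh_faces M'. F' \<subseteq> F}"
  have fin: "finite (boundary_faces \<Omega> M)" using M.finite_mesh_faces by (simp add: boundary_faces_def)
  have "boundary_faces \<Omega> M' \<subseteq> (\<Union>F\<in>boundary_faces \<Omega> M. ?C F)"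
  proof
    fix F' assume F': "F' \<in> boundary_faces \<Omega> M'"
    then have "F' \<in> mesh_faces M'" by (simp add: boundary_faces_def)
    then show "F' \<in> (\<Union>F\<in>boundary_faces \<Omega> M. ?C F)" using boundary_face_refinement[OF assms F'] by blast
  qed
  then have "card (boundary_faces \<Omega> M') \<le> card (\<Union>F\<in>boundary_faces \<Omega> M. ?C F)"
    using fin M'.finite_mesh_faces by (intro card_mono) auto
  also have "\<dots> \<le> (\<Sum>F\<in>boundary_faces \<Omega> M. card (?C F))" by (rule card_UN_le[OF fin])
  also have "\<dots> = (\<Sum>F\<in>boundary_faces \<Omega> M. 4)"
    using refinement_clauses(3) by (intro sum.cong) (simp_all add: boundary_faces_def)
  finally show ?thesis by simp
qed

end

text \<open>With \<open>T\<close> tetrahedra in the initial mesh, the number \<open>V\<close> of vertices after \<open>n\<close> refinements is at most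
  \<open>8 ^ n * T / 5\<close> up to a term of order \<open>4 ^ n\<close>, because the next mesh has at most
  \<open>V + (8 ^ n * T + 2 * V)\<close> vertices up to such a term.\<close>

theorem eventually_proper_subset_refinement:
  assumes \<Omega>: "polytopal_domain \<Omega>" and T0: "conforming_mesh \<Omega> T0" and R: "uniform_refinement_scheme \<Omega> R"
  shows "\<exists>N. \<forall>n\<ge>N. \<forall>W. Worsey_Farin_split ((R ^^ n) T0) W \<longrightarrow>
    curl_image \<Omega> (S_space \<Omega> 3 W) \<subset> Z_space \<Omega> 2 W"
proof -
  have op: "open \<Omega>" and ne: "\<Omega> \<noteq> {}" using \<Omega> by (auto simp: polytopal_domain_def)
  define M where "M n = (R ^^ n) T0" for n
  have conf: "conforming_mesh \<Omega> (M n)" for n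
    by (induction n) (use T0 R in \<open>auto simp: M_def uniform_refinement_scheme_def\<close>)
  have ref: "uniformly_refines (M (Suc n)) (M n)" for n
    using R conf[of n] by (auto simp: M_def uniform_refinement_scheme_def)
  have cplx: "tet_complex \<Omega> (M n)" for n by (rule conforming_mesh_complex[OF conf op])
  define v e b where "v n = card (mesh_vertices (M n))" and "e n = card (mesh_edges (M n))"
    and "b n = card (boundary_faces \<Omega> (M n))" for n
  define t f where "t = card (M 0)" and "f = b 0"
  have M0: "finite (M 0)" "\<Union>(M 0) = closure \<Omega>"
    using conf[of 0] unfolding conforming_mesh_def by auto
  have "M 0 \<noteq> {}"
  proof
    assume "M 0 = {}"
    then have "closure \<Omega> = {}" using M0(2) by simp
    then show False using ne by simp
  qed
  then have t: "1 \<le> t" using M0(1) by (simp add: t_def Suc_le_eq card_gt_0_iff)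
  have cM: "card (M n) = 8 ^ n * t" for n
  proof (induction n)
    case (Suc n)
    then show ?case using card_refinement[OF cplx cplx ref[of n]] by simp
  qed (simp add: t_def)
  have b: "b n \<le> 4 ^ n * f" for n
  proof (induction n)
    case (Suc n)
    have "b (Suc n) \<le> 4 * b n"
      unfolding b_def by (rule card_boundary_faces_refinement[OF cplx cplx ref conf conf])
    then show ?case using Suc by simp
  qed (simp add: f_def)
  have e: "e n \<le> 8 ^ n * t + 2 * v n + 3 * (4 ^ n * f)" for n
    using tet_complex.card_edges_le(2)[OF cplx[of n]] card_boundary_edges_le[OF conf[of n] op] b[of n] cM[of n]
    unfolding e_def v_def b_def by linarith
  have v': "v (Suc n) \<le> v n + e n" for n
    unfolding v_def e_def by (rule card_vertices_refinement[OF cplx cplx ref])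
  define A where "A = v 0 + 3 * f"
  have v: "5 * v n \<le> 8 ^ n * t + 5 * (4 ^ n * A)" for n
  proof (induction n)
    case 0
    then show ?case by (simp add: A_def)
  next
    case (Suc n)
    have "3 * (4 ^ n * f) \<le> 4 ^ n * A" by (simp add: A_def algebra_simps)
    then have "5 * v (Suc n) \<le> 8 * (8 ^ n * t) + 20 * (4 ^ n * A)"
      using v'[of n] e[of n] Suc by linarith
    then show ?case by (simp add: mult.assoc)
  qed
  \<comment> \<open>the terms of order \<open>4 ^ n\<close> add up to at most \<open>N * 4 ^ n\<close>, less than \<open>8 ^ n\<close> once \<open>N < 2 ^ n\<close>\<close>
  define N where "N = 15 * A + 9 * f"
  have "curl_image \<Omega> (S_space \<Omega> 3 W) \<subset> Z_space \<Omega> 2 W"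
    if n: "N \<le> n" and W: "Worsey_Farin_split ((R ^^ n) T0) W" for n W
  proof (rule Worsey_Farin_curl_proper_subset[OF cplx W[folded M_def]])
    have "N < 2 ^ n" using n less_exp[of n] by linarith
    also have "\<dots> \<le> 2 ^ n * t" using t by simp
    finally have "4 ^ n * N < 4 ^ n * (2 ^ n * t)" by simp
    also have "\<dots> = 8 ^ n * t" by (simp add: mult.assoc[symmetric] power_mult_distrib[symmetric])
    finally have "15 * (4 ^ n * A) + 9 * (4 ^ n * f) < 8 ^ n * t"
      by (simp add: N_def algebra_simps)
    then show "9 * card (mesh_vertices (M n)) + 3 * card (mesh_edges (M n)) < 13 * card (M n)"
      using v[of n] e[of n] unfolding cM v_def e_def by linarith
  qed
  then show ?thesis by blast
qed

section \<open>Freudenthal triangulations\<close>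

lemma convex_hull_combination:
  fixes v :: "'i \<Rightarrow> 'a::real_vector"
  assumes "finite I" "\<And>i. i \<in> I \<Longrightarrow> 0 \<le> w i" "sum w I = 1" "\<And>i. i \<in> I \<Longrightarrow> 0 < w i \<Longrightarrow> v i \<in> C"
  shows "(\<Sum>i\<in>I. w i *\<^sub>R v i) \<in> convex hull C"
proof -
  let ?J = "{i\<in>I. 0 < w i}"
  have J: "w i = 0" if "i \<in> I - ?J" for i using assms(2)[of i] that by auto
  have "(\<Sum>i\<in>I. w i *\<^sub>R v i) = (\<Sum>i\<in>?J. w i *\<^sub>R v i)"
    by (rule sum.mono_neutral_right) (use assms(1) J in auto)
  moreover have "sum w I = sum w ?J"
    by (rule sum.mono_neutral_right) (use assms(1) J in auto)
  then have one: "sum w ?J = 1" using assms(3) by simp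
  moreover have "(\<Sum>i\<in>?J. w i *\<^sub>R v i) \<in> convex hull C"
  proof (rule convex_sum)
    show "v i \<in> convex hull C" if "i \<in> ?J" for i using assms(4)[of i] that hull_inc by fast
  qed (use assms(1) one in auto)
  ultimately show ?thesis by simp
qed

lemma distinct_3_UNIV:
  assumes "p \<noteq> q" "p \<noteq> r" "q \<noteq> (r :: 3)"
  shows "UNIV = {p, q, r}"
proof -
  have "card {p, q, r} = 3" using assms by simp
  then show ?thesis using card_subset_eq[of "UNIV :: 3 set" "{p, q, r}"] by simp
qed

lemma bij_3_distinct:
  assumes "bij (\<pi> :: 3 \<Rightarrow> 3)"
  shows "\<pi> 1 \<noteq> \<pi> 2" "\<pi> 1 \<noteq> \<pi> 3" "\<pi> 2 \<noteq> \<pi> 3"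
  using bij_is_inj[OF assms] by (simp_all add: inj_eq)

lemma bij_3_cases:
  assumes "bij (\<pi> :: 3 \<Rightarrow> 3)"
  shows "t = \<pi> 1 \<or> t = \<pi> 2 \<or> t = \<pi> 3"
  using distinct_3_UNIV[OF bij_3_distinct[OF assms]] by blast

lemma sorting_permutation_3:
  fixes u :: "3 \<Rightarrow> real"
  shows "\<exists>\<pi> :: 3 \<Rightarrow> 3. bij \<pi> \<and> u (\<pi> 1) \<ge> u (\<pi> 2) \<and> u (\<pi> 2) \<ge> u (\<pi> 3)"
proof -
  have perm: "\<exists>\<pi> :: 3 \<Rightarrow> 3. bij \<pi> \<and> u (\<pi> 1) \<ge> u (\<pi> 2) \<and> u (\<pi> 2) \<ge> u (\<pi> 3)"
    if "p \<noteq> q" "p \<noteq> r" "q \<noteq> r" "u p \<ge> u q" "u q \<ge> u r" for p q r :: 3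
  proof -
    define \<pi> where "\<pi> t = (if t = 1 then p else if t = 2 then q else r)" for t :: 3
    have v: "\<pi> 1 = p" "\<pi> 2 = q" "\<pi> 3 = r" by (simp_all add: \<pi>_def)
    have "surj \<pi>"
    proof -
      have "s \<in> range \<pi>" for s
        using distinct_3_UNIV[OF that(1-3)] v rangeI[of \<pi> 1] rangeI[of \<pi> 2] rangeI[of \<pi> 3] by auto
      then show ?thesis by blast
    qed
    then have "bij \<pi>" using finite_UNIV_surj_inj[of \<pi>] by (simp add: bij_def)
    then show ?thesis using v that(4,5) by (intro exI[of _ \<pi>]) simp
  qed
  have d: "(1::3) \<noteq> 2" "(1::3) \<noteq> 3" "(2::3) \<noteq> 3" by simp_all
  consider "u 1 \<ge> u 2 \<and> u 2 \<ge> u 3" | "u 1 \<ge> u 3 \<and> u 3 \<ge> u 2" | "u 2 \<ge> u 1 \<and> u 1 \<ge> u 3"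
    | "u 2 \<ge> u 3 \<and> u 3 \<ge> u 1" | "u 3 \<ge> u 1 \<and> u 1 \<ge> u 2" | "u 3 \<ge> u 2 \<and> u 2 \<ge> u 1" by linarith
  then show ?thesis
  proof cases
    case 1 then show ?thesis using perm[of 1 2 3] d by simp
  next
    case 2 then show ?thesis using perm[of 1 3 2] d by simp
  next
    case 3 then show ?thesis using perm[of 2 1 3] d by simp
  next
    case 4 then show ?thesis using perm[of 2 3 1] d by simp
  next
    case 5 then show ?thesis using perm[of 3 1 2] d by simp
  next
    case 6 then show ?thesis using perm[of 3 2 1] d by simp
  qed
qed

locale freudenthal =
  fixes a b :: "real^3" and N :: "3 \<Rightarrow> nat"
  assumes box: "a $ t < b $ t" and N_pos: "0 < N t"
begin

text \<open>Grid coordinates, in which the cells are unit cubes.\<close>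

definition grid_coord :: "3 \<Rightarrow> real^3 \<Rightarrow> real" where
  "grid_coord t y = (y $ t - a $ t) / (b $ t - a $ t) * real (N t)"

definition grid_point :: "(3 \<Rightarrow> nat) \<Rightarrow> real^3" where
  "grid_point J = (\<chi> t. a $ t + (b $ t - a $ t) * (real (J t) / real (N t)))"

lemma grid_coord_point: "grid_coord t (grid_point J) = real (J t)"
  using box[of t] N_pos[of t] by (simp add: grid_coord_def grid_point_def)

lemma grid_coord_inverse: "y $ t = a $ t + (b $ t - a $ t) * (grid_coord t y / real (N t))"
  using box[of t] N_pos[of t] by (simp add: grid_coord_def)

lemma grid_coord_eq: "(\<And>t. grid_coord t x = grid_coord t y) \<Longrightarrow> x = y"
  unfolding vec_eq_iff using grid_coord_inverse by metis

lemma affine_grid_coord: "affine_functional (grid_coord t)"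
proof -
  have "affine_functional (\<lambda>w :: real^3. w $ t)"
    using affine_functional_inner[of "axis t 1 :: real^3"] by (simp add: inner_axis')
  then show ?thesis
    unfolding grid_coord_def[abs_def]
    by (intro affine_functional_multc affine_functional_divide affine_functional_diff affine_functional_const)
qed

definition kuhn_tet :: "(3 \<Rightarrow> nat) \<Rightarrow> (3 \<Rightarrow> 3) \<Rightarrow> (real^3) set" where
  "kuhn_tet I \<pi> = {y. grid_coord (\<pi> 1) y - real (I (\<pi> 1)) \<le> 1 \<and>
     grid_coord (\<pi> 2) y - real (I (\<pi> 2)) \<le> grid_coord (\<pi> 1) y - real (I (\<pi> 1)) \<and>
     grid_coord (\<pi> 3) y - real (I (\<pi> 3)) \<le> grid_coord (\<pi> 2) y - real (I (\<pi> 2)) \<and>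
     0 \<le> grid_coord (\<pi> 3) y - real (I (\<pi> 3))}"

definition shift :: "(3 \<Rightarrow> nat) \<Rightarrow> 3 set \<Rightarrow> 3 \<Rightarrow> nat" where
  "shift I S t = I t + (if t \<in> S then 1 else 0)"

text \<open>The sets of coordinates by which the vertices of a Kuhn tetrahedron differ from the corner of
  its cube form a maximal chain.\<close>

definition chain :: "(3 \<Rightarrow> 3) \<Rightarrow> nat \<Rightarrow> 3 set" where
  "chain \<pi> s = (if s = 0 then {} else if s = 1 then {\<pi> 1} else if s = 2 then {\<pi> 1, \<pi> 2} else UNIV)"

definition kuhn_weight :: "(3 \<Rightarrow> nat) \<Rightarrow> (3 \<Rightarrow> 3) \<Rightarrow> real^3 \<Rightarrow> nat \<Rightarrow> real" where
  "kuhn_weight I \<pi> y s =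
    (if s = 0 then 1 - (grid_coord (\<pi> 1) y - real (I (\<pi> 1)))
     else if s = 1 then (grid_coord (\<pi> 1) y - real (I (\<pi> 1))) - (grid_coord (\<pi> 2) y - real (I (\<pi> 2)))
     else if s = 2 then (grid_coord (\<pi> 2) y - real (I (\<pi> 2))) - (grid_coord (\<pi> 3) y - real (I (\<pi> 3)))
     else grid_coord (\<pi> 3) y - real (I (\<pi> 3)))"

lemma lessThan_4: "{..<4::nat} = {0, 1, 2, 3}" by auto

lemma sum_kuhn_weight: "(\<Sum>s<4. kuhn_weight I \<pi> y s) = 1"
  by (simp add: lessThan_4 kuhn_weight_def)

lemma kuhn_tet_weights: "y \<in> kuhn_tet I \<pi> \<longleftrightarrow> (\<forall>s<4. 0 \<le> kuhn_weight I \<pi> y s)"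
proof -
  have "(\<forall>s<4. 0 \<le> kuhn_weight I \<pi> y s) \<longleftrightarrow> (\<forall>s\<in>{0, 1, 2, 3}. 0 \<le> kuhn_weight I \<pi> y s)"
    using lessThan_4 by (metis lessThan_iff)
  then show ?thesis by (auto simp: kuhn_tet_def kuhn_weight_def)
qed

lemma kuhn_combination:
  assumes "bij \<pi>"
  shows "y = (\<Sum>s<4. kuhn_weight I \<pi> y s *\<^sub>R grid_point (shift I (chain \<pi> s)))"
proof (rule grid_coord_eq)
  fix t
  note d = bij_3_distinct[OF assms]
  have "grid_coord t (\<Sum>s<4. kuhn_weight I \<pi> y s *\<^sub>R grid_point (shift I (chain \<pi> s))) =
      (\<Sum>s<4. kuhn_weight I \<pi> y s * real (shift I (chain \<pi> s) t))"
    using affine_functional_combination[OF affine_grid_coord sum_kuhn_weight] by (simp add: grid_coord_point)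
  also have "\<dots> = grid_coord t y"
    using bij_3_cases[OF assms, of t] d
    by (auto simp: lessThan_4 kuhn_weight_def shift_def chain_def algebra_simps)
  finally show "grid_coord t y = grid_coord t (\<Sum>s<4. kuhn_weight I \<pi> y s *\<^sub>R grid_point (shift I (chain \<pi> s)))"
    by simp
qed

definition kuhn_verts :: "(3 \<Rightarrow> nat) \<Rightarrow> (3 \<Rightarrow> 3) \<Rightarrow> (real^3) set" where
  "kuhn_verts I \<pi> = (\<lambda>s. grid_point (shift I (chain \<pi> s))) ` {..<4}"

lemma convex_kuhn_tet: "convex (kuhn_tet I \<pi>)"
proof -
  have aff: "affine_functional (\<lambda>y. kuhn_weight I \<pi> y s)" for s
    unfolding kuhn_weight_def
    by (cases "s = 0"; cases "s = 1"; cases "s = 2"; simp;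
        intro affine_functional_diff affine_functional_const affine_grid_coord)
  have "convex {y. 0 \<le> kuhn_weight I \<pi> y s}" for s
  proof -
    obtain c d where "\<And>y. kuhn_weight I \<pi> y s = c \<bullet> y + d"
      using aff[of s] unfolding affine_functional_def by blast
    then have "{y. 0 \<le> kuhn_weight I \<pi> y s} = {y. c \<bullet> y \<ge> - d}" by auto
    then show ?thesis using convex_halfspace_ge[of "- d" c] by simp
  qed
  then have "convex (\<Inter>s\<in>{..<4}. {y. 0 \<le> kuhn_weight I \<pi> y s})" by (intro convex_INT) auto
  moreover have "(\<Inter>s\<in>{..<4}. {y. 0 \<le> kuhn_weight I \<pi> y s}) = kuhn_tet I \<pi>"
    using kuhn_tet_weights by blast
  ultimately show ?thesis by simp
qed

lemma kuhn_tet_hull: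
  assumes "bij \<pi>"
  shows "convex hull (kuhn_verts I \<pi>) = kuhn_tet I \<pi>"
proof
  note d = bij_3_distinct[OF assms]
  have "grid_point (shift I (chain \<pi> s)) \<in> kuhn_tet I \<pi>" if "s < 4" for s
    using that d by (auto simp: kuhn_tet_def grid_coord_point shift_def chain_def)
  then show "convex hull (kuhn_verts I \<pi>) \<subseteq> kuhn_tet I \<pi>"
    by (intro hull_minimal convex_kuhn_tet) (auto simp: kuhn_verts_def)
  show "kuhn_tet I \<pi> \<subseteq> convex hull (kuhn_verts I \<pi>)"
  proof
    fix y assume "y \<in> kuhn_tet I \<pi>"
    then have "(\<Sum>s<4. kuhn_weight I \<pi> y s *\<^sub>R grid_point (shift I (chain \<pi> s))) \<in> convex hull (kuhn_verts I \<pi>)"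
      by (intro convex_hull_combination sum_kuhn_weight) (auto simp: kuhn_tet_weights kuhn_verts_def)
    then show "y \<in> convex hull (kuhn_verts I \<pi>)" using kuhn_combination[OF assms, of y I] by simp
  qed
qed

definition kuhn_center :: "(3 \<Rightarrow> nat) \<Rightarrow> (3 \<Rightarrow> 3) \<Rightarrow> real^3" where
  "kuhn_center I \<pi> = (\<Sum>s<4. (1/4) *\<^sub>R grid_point (shift I (chain \<pi> s)))"

lemma grid_coord_kuhn_center:
  assumes "bij \<pi>"
  shows "grid_coord (\<pi> 1) (kuhn_center I \<pi>) = real (I (\<pi> 1)) + 3/4"
    "grid_coord (\<pi> 2) (kuhn_center I \<pi>) = real (I (\<pi> 2)) + 2/4"
    "grid_coord (\<pi> 3) (kuhn_center I \<pi>) = real (I (\<pi> 3)) + 1/4"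
proof -
  note d = bij_3_distinct[OF assms]
  have "grid_coord t (kuhn_center I \<pi>) = (\<Sum>s<4. (1/4) * real (shift I (chain \<pi> s) t))" for t
    unfolding kuhn_center_def
    using affine_functional_combination[OF affine_grid_coord, of "\<lambda>_. 1/4" "{..<4::nat}"]
    by (simp add: grid_coord_point)
  then show "grid_coord (\<pi> 1) (kuhn_center I \<pi>) = real (I (\<pi> 1)) + 3/4"
    "grid_coord (\<pi> 2) (kuhn_center I \<pi>) = real (I (\<pi> 2)) + 2/4"
    "grid_coord (\<pi> 3) (kuhn_center I \<pi>) = real (I (\<pi> 3)) + 1/4"
    using d by (simp_all add: lessThan_4 shift_def chain_def add_divide_distrib)
qed

lemma interior_kuhn_tet: "bij \<pi> \<Longrightarrow> interior (kuhn_tet I \<pi>) \<noteq> {}"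
proof -
  assume \<pi>: "bij \<pi>"
  define u where "u t y = grid_coord t y - real (I t)" for t y
  have cont: "continuous_on UNIV (u t)" for t
    unfolding u_def[abs_def]
    by (intro affine_functional_continuous affine_functional_diff affine_grid_coord affine_functional_const)
  let ?U = "{y. u (\<pi> 1) y < 1} \<inter> {y. u (\<pi> 2) y < u (\<pi> 1) y} \<inter> {y. u (\<pi> 3) y < u (\<pi> 2) y} \<inter> {y. 0 < u (\<pi> 3) y}"
  have "open ?U" by (intro open_Int open_Collect_less cont continuous_on_const)
  moreover have "?U \<subseteq> kuhn_tet I \<pi>" by (auto simp: kuhn_tet_def u_def)
  moreover have "kuhn_center I \<pi> \<in> ?U" using grid_coord_kuhn_center[OF \<pi>] by (simp add: u_def)
  ultimately show ?thesis using interior_maximal[of ?U] by blast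
qed

lemma kuhn_tet_simplex:
  assumes "bij \<pi>"
  shows "3 simplex kuhn_tet I \<pi>" "verts (kuhn_tet I \<pi>) = kuhn_verts I \<pi>"
proof -
  have "aff_dim (kuhn_tet I \<pi>) = 3"
    using aff_dim_nonempty_interior[OF interior_kuhn_tet[OF assms, of I]] by simp
  then have dim: "aff_dim (kuhn_verts I \<pi>) = 3"
    using kuhn_tet_hull[OF assms, of I] aff_dim_convex_hull[of "kuhn_verts I \<pi>"] by simp
  have fin: "finite (kuhn_verts I \<pi>)" by (simp add: kuhn_verts_def)
  have "card (kuhn_verts I \<pi>) \<le> 4"
    using card_image_le[of "{..<4::nat}"] by (simp add: kuhn_verts_def)
  moreover have "aff_dim (kuhn_verts I \<pi>) \<le> int (card (kuhn_verts I \<pi>)) - 1"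
    by (rule aff_dim_le_card[OF fin])
  ultimately have c: "card (kuhn_verts I \<pi>) = 4" using dim by linarith
  then have ind: "\<not> affine_dependent (kuhn_verts I \<pi>)"
    using affine_independent_iff_card[of "kuhn_verts I \<pi>"] fin dim by simp
  then show "3 simplex kuhn_tet I \<pi>"
    unfolding simplex_def using c kuhn_tet_hull[OF assms, of I] by (intro exI[of _ "kuhn_verts I \<pi>"]) simp
  show "verts (kuhn_tet I \<pi>) = kuhn_verts I \<pi>"
    using verts_convex_hull[OF ind] kuhn_tet_hull[OF assms, of I] by simp
qed

text \<open>A vertex that carries positive weight at a point is a vertex of every Kuhn tetrahedron that
  contains the point: the offsets of the point from the vertex, and their differences, are smaller than
  1 in absolute value, which characterizes the lattice points that are vertices.\<close>

lemma kuhn_vertex_shared: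
  assumes \<pi>: "bij \<pi>" and \<sigma>: "bij \<sigma>" and y: "y \<in> kuhn_tet I \<pi>" "y \<in> kuhn_tet J \<sigma>"
    and s: "s < 4" "0 < kuhn_weight I \<pi> y s"
  shows "grid_point (shift I (chain \<pi> s)) \<in> kuhn_verts J \<sigma>"
proof -
  define R where "R = shift I (chain \<pi> s)"
  define \<delta> where "\<delta> t = grid_coord t y - real (R t)" for t
  define v where "v t = grid_coord t y - real (J t)" for t
  have "s \<in> {0, 1, 2, 3}" using s(1) lessThan_4 by (metis lessThan_iff)
  then have s4: "s = 0 \<or> s = 1 \<or> s = 2 \<or> s = 3" by blast
  have bounds: "- 1 < \<delta> t \<and> \<delta> t < 1 \<and> \<delta> t - \<delta> t' < 1" for t t'
    using s4 s(2) y(1) bij_3_cases[OF \<pi>, of t] bij_3_cases[OF \<pi>, of t'] bij_3_distinct[OF \<pi>]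
    by (auto simp: \<delta>_def R_def shift_def chain_def kuhn_weight_def kuhn_tet_def)
  have v: "v (\<sigma> 1) \<le> 1" "v (\<sigma> 2) \<le> v (\<sigma> 1)" "v (\<sigma> 3) \<le> v (\<sigma> 2)" "0 \<le> v (\<sigma> 3)"
    using y(2) by (simp_all add: kuhn_tet_def v_def)
  have v01: "0 \<le> v t \<and> v t \<le> 1" for t using bij_3_cases[OF \<sigma>, of t] v by auto
  define D where "D = {t. R t = J t + 1}"
  have RJ: "R t = J t \<or> R t = J t + 1" for t
  proof -
    have "- 1 < real (R t) - real (J t)" "real (R t) - real (J t) < 2"
      using bounds[of t t] v01[of t] by (simp_all add: \<delta>_def v_def)
    then show ?thesis by linarith
  qed
  have R: "R = shift J D"
  proof
    fix t show "R t = shift J D t" using RJ[of t] by (auto simp: shift_def D_def)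
  qed
  have up: "t \<in> D" if "t' \<in> D" "v t' \<le> v t" for t t'
  proof (rule ccontr)
    assume "t \<notin> D"
    then have "real (R t) = real (J t)" "real (R t') = real (J t') + 1"
      using RJ[of t] that(1) by (auto simp: D_def)
    then have "1 \<le> \<delta> t - \<delta> t'" using that(2) by (simp add: \<delta>_def v_def)
    then show False using bounds[of t t'] by simp
  qed
  have "\<exists>s'<4. D = chain \<sigma> s'"
  proof -
    have mem: "D = {t. (t = \<sigma> 1 \<and> \<sigma> 1 \<in> D) \<or> (t = \<sigma> 2 \<and> \<sigma> 2 \<in> D) \<or> (t = \<sigma> 3 \<and> \<sigma> 3 \<in> D)}"
    proof (rule set_eqI)
      fix t show "t \<in> D \<longleftrightarrow> t \<in> {t. (t = \<sigma> 1 \<and> \<sigma> 1 \<in> D) \<or> (t = \<sigma> 2 \<and> \<sigma> 2 \<in> D) \<or> (t = \<sigma> 3 \<and> \<sigma> 3 \<in> D)}"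
        using bij_3_cases[OF \<sigma>, of t] by auto
    qed
    have c: "\<sigma> 2 \<in> D \<Longrightarrow> \<sigma> 1 \<in> D" "\<sigma> 3 \<in> D \<Longrightarrow> \<sigma> 2 \<in> D" using up v by blast+
    consider "\<sigma> 1 \<notin> D" | "\<sigma> 1 \<in> D" "\<sigma> 2 \<notin> D" | "\<sigma> 2 \<in> D" "\<sigma> 3 \<notin> D" | "\<sigma> 3 \<in> D" by blast
    then show ?thesis
    proof cases
      case 1
      then have "D = {}" using mem c by blast
      then show ?thesis by (intro exI[of _ 0]) (simp add: chain_def)
    next
      case 2
      then have "D = {\<sigma> 1}" using mem c by blast
      then show ?thesis by (intro exI[of _ 1]) (simp add: chain_def)
    next
      case 3
      then have "D = {\<sigma> 1, \<sigma> 2}" using mem c by blast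
      then show ?thesis by (intro exI[of _ 2]) (simp add: chain_def)
    next
      case 4
      then have "\<sigma> 1 \<in> D" "\<sigma> 2 \<in> D" "\<sigma> 3 \<in> D" using c by blast+
      then have "t \<in> D" for t using bij_3_cases[OF \<sigma>, of t] by auto
      then have "D = UNIV" by blast
      then show ?thesis by (intro exI[of _ 3]) (simp add: chain_def)
    qed
  qed
  then obtain s' where "s' < 4" "D = chain \<sigma> s'" by blast
  then show ?thesis using R by (auto simp: kuhn_verts_def R_def)
qed

definition mesh :: "(real^3) set set" where
  "mesh = {kuhn_tet I \<pi> | I \<pi>. (\<forall>t. I t < N t) \<and> bij \<pi>}"

lemma grid_finite: "finite {I :: 3 \<Rightarrow> nat. \<forall>t. I t < K t}" "finite {\<pi> :: 3 \<Rightarrow> 3. bij \<pi>}"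
proof -
  have "{I :: 3 \<Rightarrow> nat. \<forall>t. I t < K t} \<subseteq> PiE UNIV (\<lambda>t. {..<K t})" by auto
  then show "finite {I :: 3 \<Rightarrow> nat. \<forall>t. I t < K t}"
    by (rule finite_subset) (intro finite_PiE; simp)
qed simp

lemma card_grid: "card {I :: 3 \<Rightarrow> nat. \<forall>t. I t < K t} = K 1 * K 2 * K 3"
proof -
  have "{I :: 3 \<Rightarrow> nat. \<forall>t. I t < K t} = PiE UNIV (\<lambda>t. {..<K t})" by auto
  then have "card {I :: 3 \<Rightarrow> nat. \<forall>t. I t < K t} = (\<Prod>t\<in>UNIV. card {..<K t})"
    by (simp only:) (rule card_PiE, simp)
  also have "\<dots> = K 1 * K 2 * K 3"
    by (simp only: card_lessThan UNIV_3) simp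
  finally show ?thesis .
qed

lemma mesh_image: "mesh = (\<lambda>(I, \<pi>). kuhn_tet I \<pi>) ` ({I. \<forall>t. I t < N t} \<times> {\<pi>. bij \<pi>})"
  by (auto simp: mesh_def)

lemma kuhn_tet_inj:
  assumes \<pi>: "bij \<pi>" and \<sigma>: "bij \<sigma>" and eq: "kuhn_tet I \<pi> = kuhn_tet J \<sigma>"
  shows "I = J \<and> \<pi> = \<sigma>"
proof -
  let ?c = "kuhn_center I \<pi>"
  have "?c \<in> kuhn_tet I \<pi>" using grid_coord_kuhn_center[OF \<pi>, of I] by (simp add: kuhn_tet_def)
  then have c: "?c \<in> kuhn_tet J \<sigma>" using eq by simp
  define w where "w t = grid_coord t ?c - real (I t)" for t
  have w: "w (\<pi> 1) = 3/4" "w (\<pi> 2) = 2/4" "w (\<pi> 3) = 1/4"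
    using grid_coord_kuhn_center[OF \<pi>, of I] by (simp_all add: w_def)
  have w01: "0 < w t \<and> w t < 1" for t using bij_3_cases[OF \<pi>, of t] w by auto
  have J: "I t = J t" for t
  proof -
    have "0 \<le> grid_coord t ?c - real (J t) \<and> grid_coord t ?c - real (J t) \<le> 1"
      using c bij_3_cases[OF \<sigma>, of t] by (auto simp: kuhn_tet_def)
    then have "- 1 < real (I t) - real (J t)" "real (I t) - real (J t) < 1"
      using w01[of t] by (auto simp: w_def)
    then show ?thesis by linarith
  qed
  then have ord: "w (\<sigma> 2) \<le> w (\<sigma> 1)" "w (\<sigma> 3) \<le> w (\<sigma> 2)"
    using c by (simp_all add: kuhn_tet_def w_def)
  note d\<sigma> = bij_3_distinct[OF \<sigma>]
  have "\<sigma> 1 = \<pi> 1 \<and> \<sigma> 2 = \<pi> 2 \<and> \<sigma> 3 = \<pi> 3"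
    using bij_3_cases[OF \<pi>, of "\<sigma> 1"] bij_3_cases[OF \<pi>, of "\<sigma> 2"] bij_3_cases[OF \<pi>, of "\<sigma> 3"] d\<sigma> ord w
    by auto
  then have "\<pi> t = \<sigma> t" for t using exhaust_3[of t] by auto
  then show ?thesis using J by auto
qed

lemma card_mesh: "card mesh = 6 * (N 1 * N 2 * N 3)"
proof -
  have "inj_on (\<lambda>(I, \<pi>). kuhn_tet I \<pi>) ({I. \<forall>t. I t < N t} \<times> {\<pi>. bij \<pi>})"
  proof (rule inj_onI, clarify)
    fix I \<pi> J \<sigma> assume "bij \<pi>" "bij \<sigma>" "kuhn_tet I \<pi> = kuhn_tet J \<sigma>"
    then show "I = J \<and> \<pi> = \<sigma>" by (rule kuhn_tet_inj)
  qed
  moreover have "card {\<pi> :: 3 \<Rightarrow> 3. bij \<pi>} = 6"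
  proof -
    have "{\<pi> :: 3 \<Rightarrow> 3. bij \<pi>} = {\<pi>. \<pi> permutes UNIV}" by (simp add: permutes_univ bij_iff)
    then show ?thesis using card_permutations[of "UNIV :: 3 set" 3] by (simp add: fact_numeral)
  qed
  ultimately show ?thesis
    unfolding mesh_image using card_grid[of N] by (simp add: card_image card_cartesian_product)
qed

lemma mesh_cover: "\<Union>mesh = cbox a b"
proof
  show "\<Union>mesh \<subseteq> cbox a b"
  proof
    fix y assume "y \<in> \<Union>mesh"
    then obtain I \<pi> where I: "\<forall>t. I t < N t" "bij \<pi>" "y \<in> kuhn_tet I \<pi>" by (auto simp: mesh_def)
    have "a $ t \<le> y $ t \<and> y $ t \<le> b $ t" for t
    proof -
      have "0 \<le> grid_coord t y - real (I t) \<and> grid_coord t y - real (I t) \<le> 1"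
        using I(3) bij_3_cases[OF I(2), of t] by (auto simp: kuhn_tet_def)
      moreover have "real (I t) + 1 \<le> real (N t)" using I(1) by (metis Suc_eq_plus1 Suc_leI of_nat_1 of_nat_add of_nat_mono)
      ultimately have g: "0 \<le> grid_coord t y" "grid_coord t y \<le> real (N t)" by linarith+
      then have q: "0 \<le> grid_coord t y / real (N t)" "grid_coord t y / real (N t) \<le> 1"
        using N_pos[of t] by (simp_all add: divide_le_eq_1)
      have ba: "0 < b $ t - a $ t" using box[of t] by simp
      have "0 \<le> (b $ t - a $ t) * (grid_coord t y / real (N t))"
        using q(1) ba by (intro mult_nonneg_nonneg) auto
      moreover have "(b $ t - a $ t) * (grid_coord t y / real (N t)) \<le> (b $ t - a $ t) * 1"
        using q(2) ba by (intro mult_left_mono) auto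
      ultimately show ?thesis using grid_coord_inverse[of y t] by simp
    qed
    then show "y \<in> cbox a b" by (simp add: mem_box_cart)
  qed
  show "cbox a b \<subseteq> \<Union>mesh"
  proof
    fix y assume "y \<in> cbox a b"
    then have ab: "a $ t \<le> y $ t" "y $ t \<le> b $ t" for t by (simp_all add: mem_box_cart)
    have g: "0 \<le> grid_coord t y \<and> grid_coord t y \<le> real (N t)" for t
    proof -
      have "0 \<le> (y $ t - a $ t) / (b $ t - a $ t)" "(y $ t - a $ t) / (b $ t - a $ t) \<le> 1"
        using ab[of t] box[of t] by simp_all
      then have "0 \<le> (y $ t - a $ t) / (b $ t - a $ t) * real (N t)"
        "(y $ t - a $ t) / (b $ t - a $ t) * real (N t) \<le> 1 * real (N t)"
        by (intro mult_nonneg_nonneg mult_right_mono; simp)+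
      then show ?thesis unfolding grid_coord_def by (intro conjI) (assumption, simp only: mult_1)
    qed
    define I where "I t = min (nat \<lfloor>grid_coord t y\<rfloor>) (N t - 1)" for t
    have I: "I t < N t" for t using N_pos[of t] by (simp add: I_def)
    have u: "0 \<le> grid_coord t y - real (I t) \<and> grid_coord t y - real (I t) \<le> 1" for t
    proof (cases "nat \<lfloor>grid_coord t y\<rfloor> \<le> N t - 1")
      case True
      then have "real (I t) = of_int \<lfloor>grid_coord t y\<rfloor>" using g[of t] by (simp add: I_def)
      then show ?thesis by linarith
    next
      case False
      then have "I t = N t - 1" "N t \<le> nat \<lfloor>grid_coord t y\<rfloor>" by (simp_all add: I_def)
      then have "real (I t) = real (N t) - 1" "real (N t) \<le> grid_coord t y"
        using N_pos[of t] g[of t] by (simp_all add: of_nat_diff le_nat_floor le_nat_iff le_floor_iff)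
      then show ?thesis using g[of t] by simp
    qed
    obtain \<pi> :: "3 \<Rightarrow> 3" where \<pi>: "bij \<pi>" "grid_coord (\<pi> 2) y - real (I (\<pi> 2)) \<le> grid_coord (\<pi> 1) y - real (I (\<pi> 1))"
      "grid_coord (\<pi> 3) y - real (I (\<pi> 3)) \<le> grid_coord (\<pi> 2) y - real (I (\<pi> 2))"
      using sorting_permutation_3[of "\<lambda>t. grid_coord t y - real (I t)"] by blast
    have "y \<in> kuhn_tet I \<pi>" using \<pi>(2,3) u[of "\<pi> 1"] u[of "\<pi> 3"] by (simp add: kuhn_tet_def)
    then show "y \<in> \<Union>mesh" using I \<pi>(1) by (auto simp: mesh_def)
  qed
qed

lemma mesh_complex: "tet_complex (box a b) mesh"
proof
  show "open (box a b)" by (rule open_box)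
  show "finite mesh" unfolding mesh_image using grid_finite by (intro finite_imageI finite_cartesian_product)
  show "\<Union>mesh = closure (box a b)"
  proof -
    have "box a b \<noteq> {}" using box by (simp add: interval_ne_empty_cart)
    then show ?thesis using mesh_cover by (simp add: closure_box)
  qed
  show "3 simplex T" if "T \<in> mesh" for T using that kuhn_tet_simplex(1) by (auto simp: mesh_def)
  fix T S assume "T \<in> mesh" "S \<in> mesh"
  then obtain I \<pi> J \<sigma> where T: "bij \<pi>" "T = kuhn_tet I \<pi>" and S: "bij \<sigma>" "S = kuhn_tet J \<sigma>"
    by (auto simp: mesh_def)
  show "T \<inter> S \<subseteq> convex hull (verts T \<inter> verts S)"
  proof
    fix y assume y: "y \<in> T \<inter> S"
    have "(\<Sum>s<4. kuhn_weight I \<pi> y s *\<^sub>R grid_point (shift I (chain \<pi> s))) \<in> convex hull (verts T \<inter> verts S)"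
    proof (rule convex_hull_combination[OF finite_lessThan _ sum_kuhn_weight])
      show "0 \<le> kuhn_weight I \<pi> y s" if "s \<in> {..<4}" for s
        using y that by (simp add: T(2) kuhn_tet_weights)
      fix s assume s: "s \<in> {..<4::nat}" "0 < kuhn_weight I \<pi> y s"
      then have "grid_point (shift I (chain \<pi> s)) \<in> kuhn_verts J \<sigma>"
        using kuhn_vertex_shared[OF T(1) S(1), of y I J s] y T(2) S(2) by simp
      moreover have "grid_point (shift I (chain \<pi> s)) \<in> kuhn_verts I \<pi>" using s(1) by (simp add: kuhn_verts_def)
      ultimately show "grid_point (shift I (chain \<pi> s)) \<in> verts T \<inter> verts S"
        using kuhn_tet_simplex(2)[OF T(1)] kuhn_tet_simplex(2)[OF S(1)] by (simp add: T(2) S(2))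
    qed
    then show "y \<in> convex hull (verts T \<inter> verts S)" using kuhn_combination[OF T(1), of y I] by simp
  qed
qed

lemma shift_bound:
  assumes "\<forall>t. I t < N t"
  shows "shift I S t < N t + 1"
proof -
  have "I t < N t" using assms by (rule spec)
  then show ?thesis by (simp add: shift_def)
qed

lemma card_mesh_vertices_le: "card (mesh_vertices mesh) \<le> (N 1 + 1) * (N 2 + 1) * (N 3 + 1)"
proof -
  have "mesh_vertices mesh \<subseteq> grid_point ` {J. \<forall>t. J t < N t + 1}"
  proof
    fix p assume "p \<in> mesh_vertices mesh"
    then obtain I \<pi> where I: "\<forall>t. I t < N t" "bij \<pi>" "p \<in> verts (kuhn_tet I \<pi>)"
      by (auto simp: mesh_vertices_def verts_def mesh_def)
    then obtain s where "p = grid_point (shift I (chain \<pi> s))"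
      using kuhn_tet_simplex(2)[OF I(2), of I] by (auto simp: kuhn_verts_def)
    moreover have "shift I (chain \<pi> s) \<in> {J. \<forall>t. J t < N t + 1}" using shift_bound[OF I(1)] by simp
    ultimately show "p \<in> grid_point ` {J. \<forall>t. J t < N t + 1}" by (rule image_eqI)
  qed
  then have "card (mesh_vertices mesh) \<le> card (grid_point ` {J. \<forall>t. J t < N t + 1})"
    by (intro card_mono finite_imageI grid_finite)
  also have "\<dots> \<le> card {J :: 3 \<Rightarrow> nat. \<forall>t. J t < N t + 1}" by (intro card_image_le grid_finite)
  also have "\<dots> = (N 1 + 1) * (N 2 + 1) * (N 3 + 1)" by (rule card_grid)
  finally show ?thesis .
qed

lemma chain_shift:
  assumes "S \<subseteq> S'"
  shows "shift I S' = shift (shift I S) (S' - S)"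
  using assms by (auto simp: shift_def fun_eq_iff)

text \<open>An edge joins a grid point to one that is shifted by a set of coordinate directions, of which there are 8
  (the empty set gives no edge).\<close>

lemma card_mesh_edges_le: "card (mesh_edges mesh) \<le> 8 * ((N 1 + 1) * (N 2 + 1) * (N 3 + 1))"
proof -
  let ?f = "\<lambda>(J, D). convex hull {grid_point J, grid_point (shift J D)}"
  let ?A = "{J :: 3 \<Rightarrow> nat. \<forall>t. J t < N t + 1} \<times> (UNIV :: 3 set set)"
  have "mesh_edges mesh \<subseteq> ?f ` ?A"
  proof
    fix e assume "e \<in> mesh_edges mesh"
    then obtain I \<pi> where I: "\<forall>t. I t < N t" "bij \<pi>" "e edge_of kuhn_tet I \<pi>"
      by (auto simp: mesh_edges_def mesh_def)
    then obtain c where c: "c \<subseteq> kuhn_verts I \<pi>" "card c = 2" "e = convex hull c"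
      using edge_of_simplex3[OF kuhn_tet_simplex(1)[OF I(2), of I], of e] kuhn_tet_simplex(2)[OF I(2), of I]
      by auto
    obtain p q where "c = {p, q}" using c(2) by (auto simp: card_2_iff)
    then obtain s s' where ss: "c = {grid_point (shift I (chain \<pi> s)), grid_point (shift I (chain \<pi> s'))}"
      using c(1) by (auto simp: kuhn_verts_def)
    have ch: "?f (shift I (chain \<pi> s), chain \<pi> s' - chain \<pi> s) \<in> ?f ` ?A" for s s'
      using shift_bound[OF I(1)] by (intro imageI SigmaI CollectI allI) simp_all
    have mono: "chain \<pi> s \<subseteq> chain \<pi> s'" if "s \<le> s'" for s s'
      using that by (auto simp: chain_def)
    show "e \<in> ?f ` ?A"
    proof (cases "s \<le> s'")
      case True
      then show ?thesis using ch[of s s'] chain_shift[OF mono[OF True], of I] by (simp add: c(3) ss)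
    next
      case False
      then have "s' \<le> s" by simp
      then show ?thesis using ch[of s' s] chain_shift[OF mono, of s' s I]
        by (simp add: c(3) ss insert_commute)
    qed
  qed
  moreover have "finite ?A" using grid_finite by simp
  ultimately have "card (mesh_edges mesh) \<le> card ?A"
    using card_mono[of "?f ` ?A" "mesh_edges mesh"] card_image_le[of ?A ?f] by simp
  also have "card (UNIV :: 3 set set) = 8" by (simp add: card_Pow[of "UNIV :: 3 set", simplified Pow_UNIV])
  then have "card ?A = 8 * ((N 1 + 1) * (N 2 + 1) * (N 3 + 1))"
    using card_grid[of "\<lambda>t. N t + 1"] by (simp add: card_cartesian_product)
  finally show ?thesis .
qed

text \<open>With at least 4 cubes in each direction the number of grid points is at most \<open>(5/4) ^ 3\<close> times the number
  \<open>P\<close> of cubes, and \<open>(9 + 3 * 8) * (5/4) ^ 3 < 13 * 6\<close>.\<close>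

lemma mesh_counts:
  assumes "4 \<le> N 1" "4 \<le> N 2" "4 \<le> N 3"
  shows "9 * card (mesh_vertices mesh) + 3 * card (mesh_edges mesh) < 13 * card mesh"
proof -
  let ?P = "N 1 * N 2 * N 3" and ?Q = "(N 1 + 1) * (N 2 + 1) * (N 3 + 1)"
  have cube: "(c * x) * (c * y) * (c * z) = c ^ 3 * (x * y * z)" for c x y z :: nat
    by (simp add: power3_eq_cube mult_ac)
  have le: "4 * (N 1 + 1) \<le> 5 * N 1" "4 * (N 2 + 1) \<le> 5 * N 2" "4 * (N 3 + 1) \<le> 5 * N 3"
    using assms by simp_all
  have "(4 * (N 1 + 1)) * (4 * (N 2 + 1)) * (4 * (N 3 + 1)) \<le> (5 * N 1) * (5 * N 2) * (5 * N 3)"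
    by (rule mult_mono[OF mult_mono[OF le(1,2)] le(3)]) simp_all
  then have "4 ^ 3 * ?Q \<le> 5 ^ 3 * ?P" unfolding cube .
  then have Q: "64 * ?Q \<le> 125 * ?P" by simp
  have "0 < ?P" using N_pos by simp
  then have "33 * ?Q < 78 * ?P" using Q by linarith
  then show ?thesis
    using card_mesh_vertices_le card_mesh_edges_le card_mesh by linarith
qed

end

lemma freudenthal_mesh_eq:
  assumes "\<And>t. a $ t < b $ t" "0 < n" "0 < m" "0 < l"
  shows "freudenthal_mesh a b n m l = freudenthal.mesh a b (\<lambda>t. if t = 1 then n else if t = 2 then m else l)"
proof -
  define N where "N = (\<lambda>t :: 3. if t = 1 then n else if t = 2 then m else l)"
  interpret freudenthal a b N by unfold_locales (use assms in \<open>auto simp: N_def\<close>)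
  have N: "N 1 = n" "N 2 = m" "N 3 = l" by (simp_all add: N_def)
  define G where "G i j k t = (if t = 1 then i else if t = 2 then j else k)" for i j k :: nat and t :: 3
  have gc: "grid_coord t (cell_map a b n m l i j k x) = real (G i j k t) + x $ t" for t i j k x
    using exhaust_3[of t] assms(1)[of t] assms(2-4)
    by (auto simp: grid_coord_def cell_map_def N G_def)
  have img: "cell_map a b n m l i j k ` kuhn_tetrahedron \<pi> = kuhn_tet (G i j k) \<pi>" if \<pi>: "bij \<pi>" for i j k \<pi>
  proof
    show "cell_map a b n m l i j k ` kuhn_tetrahedron \<pi> \<subseteq> kuhn_tet (G i j k) \<pi>"
      by (auto simp: kuhn_tetrahedron_def kuhn_tet_def gc mem_box_cart)
    show "kuhn_tet (G i j k) \<pi> \<subseteq> cell_map a b n m l i j k ` kuhn_tetrahedron \<pi>"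
    proof
      fix y assume y: "y \<in> kuhn_tet (G i j k) \<pi>"
      define x :: "real^3" where "x = (\<chi> t. grid_coord t y - real (G i j k t))"
      have "0 \<le> x $ t \<and> x $ t \<le> 1" for t
        using y bij_3_cases[OF \<pi>, of t] by (auto simp: kuhn_tet_def x_def)
      then have "x \<in> kuhn_tetrahedron \<pi>"
        using y by (simp add: kuhn_tetrahedron_def kuhn_tet_def x_def mem_box_cart)
      moreover have "y = cell_map a b n m l i j k x"
        by (rule grid_coord_eq) (simp add: gc x_def)
      ultimately show "y \<in> cell_map a b n m l i j k ` kuhn_tetrahedron \<pi>" by blast
    qed
  qed
  have "freudenthal_mesh a b n m l = mesh"
  proof
    show "freudenthal_mesh a b n m l \<subseteq> mesh"
    proof
      fix T assume "T \<in> freudenthal_mesh a b n m l"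
      then obtain i j k \<pi> where *: "T = cell_map a b n m l i j k ` kuhn_tetrahedron \<pi>"
        "i < n" "j < m" "k < l" "bij \<pi>" unfolding freudenthal_mesh_def by blast
      have "\<forall>t. G i j k t < N t" using *(2-4) by (simp add: G_def N_def)
      then show "T \<in> mesh" using *(1,5) img[OF *(5)] unfolding mesh_def by blast
    qed
    show "mesh \<subseteq> freudenthal_mesh a b n m l"
    proof
      fix T assume "T \<in> mesh"
      then obtain I \<pi> where *: "T = kuhn_tet I \<pi>" "\<forall>t. I t < N t" "bij \<pi>" by (auto simp: mesh_def)
      have "I = G (I 1) (I 2) (I 3)"
      proof
        fix t :: 3
        show "I t = G (I 1) (I 2) (I 3) t" using exhaust_3[of t] by (auto simp: G_def)
      qed
      then have "T = cell_map a b n m l (I 1) (I 2) (I 3) ` kuhn_tetrahedron \<pi>"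
        using img[OF *(3), of "I 1" "I 2" "I 3"] *(1) by simp
      moreover have "I 1 < n" "I 2 < m" "I 3 < l"
        using spec[OF *(2), of 1] spec[OF *(2), of 2] spec[OF *(2), of 3] N by simp_all
      ultimately show "T \<in> freudenthal_mesh a b n m l" using *(3) unfolding freudenthal_mesh_def by blast
    qed
  qed
  then show ?thesis by (simp add: N_def)
qed

theorem freudenthal_proper_subset:
  assumes ab: "\<And>t. a $ t < b $ t" and n: "4 \<le> n" "4 \<le> m" "4 \<le> l"
    and W: "Worsey_Farin_split (freudenthal_mesh a b n m l) W"
  shows "curl_image (box a b) (S_space (box a b) 3 W) \<subset> Z_space (box a b) 2 W"
proof -
  define N where "N = (\<lambda>t :: 3. if t = 1 then n else if t = 2 then m else l)"
  interpret freudenthal a b N by unfold_locales (use ab n in \<open>auto simp: N_def\<close>)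
  have eq: "freudenthal_mesh a b n m l = mesh"
    using freudenthal_mesh_eq[OF ab, where n = n and m = m and l = l] n by (simp add: N_def)
  show ?thesis
    by (rule Worsey_Farin_curl_proper_subset[OF mesh_complex W[unfolded eq]])
       (rule mesh_counts; use n in \<open>simp add: N_def\<close>)
qed

theorem theorem21:
  shows
    "(\<forall>(\<Omega> :: (real^3) set) (T :: nat \<Rightarrow> (real^3) set set) (W :: nat \<Rightarrow> (real^3) set set) (c :: real).
        polytopal_domain \<Omega> \<and>
        (\<forall>n. conforming_mesh \<Omega> (T n)) \<and>
        filterlim (\<lambda>n. card (mesh_vertices (T n))) at_top sequentially \<and>
        (\<lambda>n. real (card (boundary_vertices \<Omega> (T n))) / real (card (mesh_vertices (T n))))
           \<longlonglongrightarrow> 0 \<and>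
        (\<forall>n. Worsey_Farin_split (T n) (W n)) \<and>
        c > 4.4 \<and> (\<forall>n. average_edges (T n) \<ge> c) \<longrightarrow>
        (\<exists>N. \<forall>n\<ge>N. curl_image \<Omega> (S_space \<Omega> 3 (W n)) \<subset> Z_space \<Omega> 2 (W n)))
     \<and>
     (\<forall>a b :: real^3. (\<forall>i. a $ i < b $ i) \<longrightarrow>
        (\<exists>N. \<forall>n\<ge>N. \<forall>m\<ge>N. \<forall>l\<ge>N. \<forall>W. Worsey_Farin_split (freudenthal_mesh a b n m l) W \<longrightarrow>
           curl_image (box a b) (S_space (box a b) 3 W) \<subset> Z_space (box a b) 2 W))
     \<and>
     (\<forall>(\<Omega> :: (real^3) set) (T\<^sub>0 :: (real^3) set set) (R :: (real^3) set set \<Rightarrow> (real^3) set set).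
        polytopal_domain \<Omega> \<and> conforming_mesh \<Omega> T\<^sub>0 \<and> uniform_refinement_scheme \<Omega> R \<longrightarrow>
        (\<exists>N. \<forall>n\<ge>N. \<forall>W. Worsey_Farin_split ((R ^^ n) T\<^sub>0) W \<longrightarrow>
           curl_image \<Omega> (S_space \<Omega> 3 W) \<subset> Z_space \<Omega> 2 W))"
proof (intro conjI allI impI)
  fix \<Omega> :: "(real^3) set" and T :: "nat \<Rightarrow> (real^3) set set" and W :: "nat \<Rightarrow> (real^3) set set" and c :: real
  assume h: "polytopal_domain \<Omega> \<and>
        (\<forall>n. conforming_mesh \<Omega> (T n)) \<and>
        filterlim (\<lambda>n. card (mesh_vertices (T n))) at_top sequentially \<and>
        (\<lambda>n. real (card (boundary_vertices \<Omega> (T n))) / real (card (mesh_vertices (T n))))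
           \<longlonglongrightarrow> 0 \<and>
        (\<forall>n. Worsey_Farin_split (T n) (W n)) \<and>
        c > 4.4 \<and> (\<forall>n. average_edges (T n) \<ge> c)"
  have "\<forall>\<^sub>F n in sequentially. curl_image \<Omega> (S_space \<Omega> 3 (W n)) \<subset> Z_space \<Omega> 2 (W n)"
    by (rule eventually_proper_subset_of_average_edges[where c = c and T = T]) (use h in simp_all)
  then show "\<exists>N. \<forall>n\<ge>N. curl_image \<Omega> (S_space \<Omega> 3 (W n)) \<subset> Z_space \<Omega> 2 (W n)"
    by (simp only: eventually_sequentially)
next
  fix a b :: "real^3"
  assume "\<forall>i. a $ i < b $ i"
  then show "\<exists>N. \<forall>n\<ge>N. \<forall>m\<ge>N. \<forall>l\<ge>N. \<forall>W. Worsey_Farin_split (freudenthal_mesh a b n m l) W \<longrightarrow>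
           curl_image (box a b) (S_space (box a b) 3 W) \<subset> Z_space (box a b) 2 W"
    by (intro exI[of _ 4] allI impI freudenthal_proper_subset) simp_all
next
  fix \<Omega> :: "(real^3) set" and T\<^sub>0 :: "(real^3) set set" and R :: "(real^3) set set \<Rightarrow> (real^3) set set"
  assume h: "polytopal_domain \<Omega> \<and> conforming_mesh \<Omega> T\<^sub>0 \<and> uniform_refinement_scheme \<Omega> R"
  show "\<exists>N. \<forall>n\<ge>N. \<forall>W. Worsey_Farin_split ((R ^^ n) T\<^sub>0) W \<longrightarrow>
           curl_image \<Omega> (S_space \<Omega> 3 W) \<subset> Z_space \<Omega> 2 W"
    by (rule eventually_proper_subset_refinement) (use h in simp_all)
qed

end
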